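(* Let $\nu_1,\nu_2\in\mathbf{C}$ with $\nu_2\notin(-\infty,0]\cup[2,+\infty)$, and consider the solution $y(x)=\wp(\nu_1\omega_1(x)+\nu_2\omega_2(x)+v(x);\omega_1(x),\omega_2(x))+\frac{1+x}3$ of $PVI_\mu$ in the domain $\mathcal{D}(r;\nu_1,\nu_2)$ ($r$ sufficiently small), where $v$ is holomorphic in $\mathcal{D}(r;\nu_1,\nu_2)$ with the expansion and bound described in the context. For $\Im\nu_2\ne0$ consider the paths in $\mathcal{D}(r;\nu_1,\nu_2)$ $$|x|\le|x_0|<r,\qquad\arg x=\arg x_0+\frac{\Re\nu_2-\mathcal V}{\Im\nu_2}\ln\frac{|x|}{|x_0|},\qquad0\le\mathcal V\le2,\qquad(\ast)$$ with $x_0\in\mathcal{D}(r;\nu_1,\nu_2)$. The critical behavior of $y(x)$ for $x\to0$ in $\mathcal{D}(r;\nu_1,\nu_2)$ is the following. 1. Along $(\ast)$ if $\Im\nu_2\ne0$ and $0<\mathcal V<2$, or along any regular path if $0<\nu_2<2$: $$y(x)=\left[\frac12x-\frac14\left[\frac{e^{i\pi\nu_1}}{16^{\nu_2-1}}\right]x^{\nu_2}-\frac14\left[\frac{e^{i\pi\nu_1}}{16^{\nu_2-1}}\right]^{-1}x^{2-\nu_2}\right]\bigl(1+O(x^\delta)\bigr)$$ for some $0<\delta<1$. 2. Along $(\ast)$ if $\Im\nu_2\neq0$ and $\mathcal V=0$: $$y(x)=\frac{1}{\sin^2\left(-i\frac{\nu_2}2\ln x+\left[i\frac{\nu_2}2\ln16+\frac{\pi\nu_1}2\right]+\sum_{m=1}^\infty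 c_{0m}(\nu_2)\left[\frac{e^{i\pi\nu_1}}{16^{\nu_2}}x^{\nu_2}\right]^m\right)}\bigl(1+O(x)\bigr).$$ 3. Along $(\ast)$ if $\Im\nu_2\neq0$ and $\mathcal V=2$: $$y(x)=\frac{1}{\sin^2\left(i\frac{2-\nu_2}2\ln x+\left[i\frac{\nu_2-2}2\ln16+\frac{\pi\nu_1}2\right]+\sum_{m=1}^\infty b_{0m}(\nu_2)\left[\frac{e^{-i\pi\nu_1}}{16^{2-\nu_2}}x^{2-\nu_2}\right]^m\right)}\bigl(1+O(x)\bigr).$$
   Context: $PVI_\mu$ is $$\frac{d^2y}{dx^2}=\frac12\left[\frac1y+\frac1{y-1}+\frac1{y-x}\right]\left(\frac{dy}{dx}\right)^2-\left[\frac1x+\frac1{x-1}+\frac1{y-x}\right]\frac{dy}{dx}+\frac12\frac{y(y-1)(y-x)}{x^2(x-1)^2}\left[(2\mu-1)^2+\frac{x(x-1)}{(y-x)^2}\right].$$ $\widetilde{\mathbf{C}_0}$ is the universal covering of $\mathbf{C}\setminus\{0\}$. $\wp(z;\omega_1,\omega_2)$ is the Weierstrass function with half-periods $\omega_1,\omega_2$, and for $|x|<1$ $$\omega_1(x)=\frac\pi2F(x),\quad\omega_2(x)=-\frac i2[F(x)\ln x+F_1(x)],\quad F(x)=\sum_{n\ge0}\frac{[(\frac12)_n]^2}{(n!)^2}x^n,$$ $$F_1(x)=\sum_{n\ge0}\frac{[(\frac12)_n]^2}{(n!)^2}2[\psi(n+\tfrac12)-\psi(n+1)]x^n,\quad\psi=\frac{d}{dz}\ln\Gamma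 .$$ The domain is $$\mathcal{D}(r;\nu_1,\nu_2)=\left\{x\in\widetilde{\mathbf{C}_0}:\ |x|<r,\ \left|\frac{e^{-i\pi\nu_1}}{16^{2-\nu_2}}x^{2-\nu_2}\right|<r,\ \left|\frac{e^{i\pi\nu_1}}{16^{\nu_2}}x^{\nu_2}\right|<r\right\}.$$ For such $\nu_1,\nu_2$ and $r<1$ sufficiently small, $PVI_\mu$ has a solution of the form $y=\wp(\nu_1\omega_1+\nu_2\omega_2+v;\omega_1,\omega_2)+\frac{1+x}3$ in $\mathcal D(r;\nu_1,\nu_2)$, with $v$ holomorphic there and given by the convergent expansion $$v(x)=\sum_{n\ge1}a_nx^n+\sum_{n\ge0,m\ge1}b_{nm}x^n\left(\frac{e^{-i\pi\nu_1}}{16^{2-\nu_2}}x^{2-\nu_2}\right)^m+\sum_{n\ge0,m\ge1}c_{nm}x^n\left(\frac{e^{i\pi\nu_1}}{16^{\nu_2}}x^{\nu_2}\right)^m,$$ with coefficients rational in $\nu_2$, and $|v(x)|\le M(\nu_2)\left(|x|+\left|\frac{e^{-i\pi\nu_1}}{16^{2-\nu_2}}x^{2-\nu_2}\right|+\left|\frac{e^{i\pi\nu_1}}{16^{\nu_2}}x^{\nu_2}\right|\right)$. The $b_{0m},c_{0m}$ in the claim are the coefficients in this expansion. The paths $(\ast)$ start at $x_0$, remain in the domain, and $x\to0$ along them. A "regular path" is a path converging to $x=0$ which is a regular curve in the usual sense ($C^1$ with non-vanishing derivative up to the endpoint).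
   Formalization: In item 1 with V=1 and |e^{iπν1}16^{1-ν2}x0^{ν2-1}|=1, where the bracket vanishes at points tending to 0 and the formula fails (e.g. μ=1/2, v=0), the factor 1+O(x^δ) is instead attached to each of the three terms separately. *)

theory Defs
  imports "HOL-Complex_Analysis.Complex_Analysis" "HOL-Library.Landau_Symbols"
begin

text \<open>
  The universal covering of the punctured plane is the complex plane with covering map
  \<open>exp\<close>. A point of it is written \<open>s\<close> and lies over \<open>x = exp s\<close>, so that
  \<open>ln x = s\<close>, \<open>arg x = Im s\<close>, \<open>\<bar>x\<bar> = exp (Re s)\<close>; \<open>s\<close> is a global holomorphic coordinate.
\<close>

definition xpow :: "complex \<Rightarrow> complex \<Rightarrow> complex" where
  "xpow a s = exp (a * s)"

text \<open>\<open>d/dx\<close>, by the chain rule for \<open>x = exp s\<close>.\<close>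

definition ddx :: "(complex \<Rightarrow> complex) \<Rightarrow> complex \<Rightarrow> complex" where
  "ddx f s = deriv f s / exp s"

text \<open>
  The equation is required wherever its right-hand side is defined. A solution may have poles and
  may take the values \<open>0\<close>, \<open>1\<close>, \<open>x\<close>; at such points the formula would only be
  given a meaning by the convention on division by zero.
\<close>

definition solves_PVI :: "complex \<Rightarrow> complex set \<Rightarrow> (complex \<Rightarrow> complex) \<Rightarrow> bool" where
  "solves_PVI \<mu> S y \<longleftrightarrow>
     y meromorphic_on S \<and>
     (\<forall>s\<in>S. y analytic_on {s} \<and> y s \<notin> {0, 1, exp s} \<longrightarrow>
       (let x = exp s; Y = y s; Y' = ddx y s in
          ddx (ddx y) s =
            1/2 * (1/Y + 1/(Y - 1) + 1/(Y - x)) * Y'\<^sup>2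
            - (1/x + 1/(x - 1) + 1/(Y - x)) * Y'
            + 1/2 * (Y * (Y - 1) * (Y - x)) / (x\<^sup>2 * (x - 1)\<^sup>2)
              * ((2*\<mu> - 1)\<^sup>2 + x * (x - 1) / (Y - x)\<^sup>2)))"

text \<open>The arguments \<open>w1\<close>, \<open>w2\<close> are half-periods.\<close>

definition weierstrass_p :: "complex \<Rightarrow> complex \<Rightarrow> complex \<Rightarrow> complex" where
  "weierstrass_p z w1 w2 =
     1 / z\<^sup>2 + (\<Sum>\<^sub>\<infinity>(m, n) \<in> UNIV - {(0::int, 0::int)}.
        1 / (z - (2 * of_int m * w1 + 2 * of_int n * w2))\<^sup>2
        - 1 / (2 * of_int m * w1 + 2 * of_int n * w2)\<^sup>2)"

definition hypF :: "complex \<Rightarrow> complex" where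
  "hypF x = (\<Sum>n. (pochhammer (1/2) n)\<^sup>2 / (fact n)\<^sup>2 * x ^ n)"

definition hypF1 :: "complex \<Rightarrow> complex" where
  "hypF1 x = (\<Sum>n. (pochhammer (1/2) n)\<^sup>2 / (fact n)\<^sup>2
                 * (2 * (Digamma (of_nat n + 1/2) - Digamma (of_nat n + 1))) * x ^ n)"

definition omega1 :: "complex \<Rightarrow> complex" where
  "omega1 s = of_real pi / 2 * hypF (exp s)"

definition omega2 :: "complex \<Rightarrow> complex" where
  "omega2 s = - (\<i> / 2) * (hypF (exp s) * s + hypF1 (exp s))"

definition ellip_y ::
  "complex \<Rightarrow> complex \<Rightarrow> (complex \<Rightarrow> complex) \<Rightarrow> complex \<Rightarrow> complex" where
  "ellip_y \<nu>1 \<nu>2 v s =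
     weierstrass_p (\<nu>1 * omega1 s + \<nu>2 * omega2 s + v s) (omega1 s) (omega2 s)
     + (1 + exp s) / 3"

text \<open>The variables whose powers multiply the coefficients \<open>b\<close> and \<open>c\<close> of \<open>v\<close>.\<close>

definition monB :: "complex \<Rightarrow> complex \<Rightarrow> complex \<Rightarrow> complex" where
  "monB \<nu>1 \<nu>2 s = exp (- \<i> * of_real pi * \<nu>1) / 16 powr (2 - \<nu>2) * xpow (2 - \<nu>2) s"

definition monC :: "complex \<Rightarrow> complex \<Rightarrow> complex \<Rightarrow> complex" where
  "monC \<nu>1 \<nu>2 s = exp (\<i> * of_real pi * \<nu>1) / 16 powr \<nu>2 * xpow \<nu>2 s"

definition domD :: "real \<Rightarrow> complex \<Rightarrow> complex \<Rightarrow> complex set" where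
  "domD r \<nu>1 \<nu>2 = {s. norm (exp s) < r \<and> norm (monB \<nu>1 \<nu>2 s) < r \<and> norm (monC \<nu>1 \<nu>2 s) < r}"

definition admissible :: "complex set" where
  "admissible = - (complex_of_real ` ({..0} \<union> {2..}))"

definition rational_coeff :: "(complex \<Rightarrow> complex) \<Rightarrow> bool" where
  "rational_coeff f \<longleftrightarrow>
     (\<exists>p q :: complex poly. \<forall>z\<in>admissible. poly q z \<noteq> 0 \<and> f z = poly p z / poly q z)"

definition has_v_expansion ::
  "(nat \<Rightarrow> complex) \<Rightarrow> (nat \<Rightarrow> nat \<Rightarrow> complex) \<Rightarrow> (nat \<Rightarrow> nat \<Rightarrow> complex) \<Rightarrow>
   complex \<Rightarrow> complex \<Rightarrow> complex set \<Rightarrow> (complex \<Rightarrow> complex) \<Rightarrow> bool" where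
  "has_v_expansion a b c \<nu>1 \<nu>2 S v \<longleftrightarrow>
     (\<forall>s\<in>S. \<exists>A B C.
        ((\<lambda>n. a n * exp s ^ n) has_sum A) {1..} \<and>
        ((\<lambda>(n, m). b n m * exp s ^ n * monB \<nu>1 \<nu>2 s ^ m) has_sum B) (UNIV \<times> {1..}) \<and>
        ((\<lambda>(n, m). c n m * exp s ^ n * monC \<nu>1 \<nu>2 s ^ m) has_sum C) (UNIV \<times> {1..}) \<and>
        v s = A + B + C)"

text \<open>
  The path starting at \<open>x0 = exp s0\<close>, parametrised by \<open>t = \<bar>x\<bar>\<close> in \<open>(0, \<bar>x0\<bar>]\<close>. Along it
  \<open>norm (xpow \<nu>2 s)\<close> is a constant times \<open>t powr V\<close>, so for \<open>0 \<le> V \<le> 2\<close> it stays in the domain once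
  \<open>s0\<close> lies there.
\<close>

definition spiral :: "complex \<Rightarrow> real \<Rightarrow> complex \<Rightarrow> real \<Rightarrow> complex" where
  "spiral \<nu>2 V s0 t =
     Complex (ln t) (Im s0 + (Re \<nu>2 - V) / Im \<nu>2 * ln (t / norm (exp s0)))"

text \<open>
  A path in \<open>S\<close>, given on the covering for \<open>0 < t \<le> 1\<close>, whose projection to the \<open>x\<close>-plane extends
  by \<open>0\<close> at \<open>t = 0\<close> to a \<open>C\<^sup>1\<close> curve with non-vanishing derivative on the closed interval.
\<close>

definition regular_path_in :: "complex set \<Rightarrow> (real \<Rightarrow> complex) \<Rightarrow> bool" where
  "regular_path_in S \<sigma> \<longleftrightarrow>
     continuous_on {0<..1} \<sigma> \<and> \<sigma> ` {0<..1} \<subseteq> S \<and>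
     (\<exists>\<gamma> \<gamma>'. \<gamma> 0 = 0 \<and> (\<forall>t\<in>{0<..1}. \<gamma> t = exp (\<sigma> t)) \<and>
        (\<forall>t\<in>{0..1}. (\<gamma> has_vector_derivative \<gamma>' t) (at t within {0..1}) \<and> \<gamma>' t \<noteq> 0) \<and>
        continuous_on {0..1} \<gamma>')"

text \<open>\<open>y = g (1 + O(x\<^sup>\<delta>))\<close> as \<open>x \<rightarrow> 0\<close> along the path \<open>\<sigma>\<close>, i.e. as \<open>t\<close> decreases to \<open>0\<close>.\<close>

definition asymp_along ::
  "(real \<Rightarrow> complex) \<Rightarrow> real \<Rightarrow> (complex \<Rightarrow> complex) \<Rightarrow> (complex \<Rightarrow> complex) \<Rightarrow> bool" where
  "asymp_along \<sigma> \<delta> y g \<longleftrightarrow>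
     (\<exists>e. e \<in> O[at_right 0](\<lambda>t. xpow (of_real \<delta>) (\<sigma> t)) \<and>
          (\<forall>\<^sub>F t in at_right 0. y (\<sigma> t) = g (\<sigma> t) * (1 + e t)))"

text \<open>\<open>y = g1 (1 + O(x\<^sup>\<delta>)) + g2 (1 + O(x\<^sup>\<delta>)) + g3 (1 + O(x\<^sup>\<delta>))\<close> along \<open>\<sigma>\<close>.\<close>

definition asymp_along3 ::
  "(real \<Rightarrow> complex) \<Rightarrow> real \<Rightarrow> (complex \<Rightarrow> complex) \<Rightarrow>
   (complex \<Rightarrow> complex) \<Rightarrow> (complex \<Rightarrow> complex) \<Rightarrow> (complex \<Rightarrow> complex) \<Rightarrow> bool" where
  "asymp_along3 \<sigma> \<delta> y g1 g2 g3 \<longleftrightarrow>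
     (\<exists>e1 e2 e3.
          e1 \<in> O[at_right 0](\<lambda>t. xpow (of_real \<delta>) (\<sigma> t)) \<and>
          e2 \<in> O[at_right 0](\<lambda>t. xpow (of_real \<delta>) (\<sigma> t)) \<and>
          e3 \<in> O[at_right 0](\<lambda>t. xpow (of_real \<delta>) (\<sigma> t)) \<and>
          (\<forall>\<^sub>F t in at_right 0. y (\<sigma> t) =
             g1 (\<sigma> t) * (1 + e1 t) + g2 (\<sigma> t) * (1 + e2 t) + g3 (\<sigma> t) * (1 + e3 t)))"

definition coefA :: "complex \<Rightarrow> complex \<Rightarrow> complex" where
  "coefA \<nu>1 \<nu>2 = exp (\<i> * of_real pi * \<nu>1) / 16 powr (\<nu>2 - 1)"

definition term1 :: "complex \<Rightarrow> complex" where
  "term1 s = 1/2 * exp s"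

definition term2 :: "complex \<Rightarrow> complex \<Rightarrow> complex \<Rightarrow> complex" where
  "term2 \<nu>1 \<nu>2 s = - (1/4) * coefA \<nu>1 \<nu>2 * xpow \<nu>2 s"

definition term3 :: "complex \<Rightarrow> complex \<Rightarrow> complex \<Rightarrow> complex" where
  "term3 \<nu>1 \<nu>2 s = - (1/4) * inverse (coefA \<nu>1 \<nu>2) * xpow (2 - \<nu>2) s"

definition lead1 :: "complex \<Rightarrow> complex \<Rightarrow> complex \<Rightarrow> complex" where
  "lead1 \<nu>1 \<nu>2 s = term1 s + term2 \<nu>1 \<nu>2 s + term3 \<nu>1 \<nu>2 s"

text \<open>
  Up to the factor \<open>- x / 4\<close>, the sum \<open>lead1\<close> is \<open>E + 1/E - 2\<close> with
  \<open>E = coefA \<nu>1 \<nu>2 * xpow (\<nu>2 - 1) s\<close>. On the spiral with \<open>V = 1\<close> the modulus of \<open>E\<close> is constant while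
  its argument is unbounded. If that modulus is \<open>1\<close>, then \<open>lead1\<close> vanishes at a sequence of points
  of the spiral tending to \<open>x = 0\<close>, and a factor \<open>1 + O(x\<^sup>\<delta>)\<close> cannot be pulled out of the sum: for
  \<open>\<mu> = 1/2\<close>, \<open>v = 0\<close> the solution is non-zero at those points.
\<close>

definition cancelling :: "complex \<Rightarrow> complex \<Rightarrow> real \<Rightarrow> complex \<Rightarrow> bool" where
  "cancelling \<nu>1 \<nu>2 V s0 \<longleftrightarrow> V = 1 \<and> norm (coefA \<nu>1 \<nu>2 * xpow (\<nu>2 - 1) s0) = 1"

definition lead2 :: "(nat \<Rightarrow> complex) \<Rightarrow> complex \<Rightarrow> complex \<Rightarrow> complex \<Rightarrow> complex" where
  "lead2 c0 \<nu>1 \<nu>2 s =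
     1 / (sin (- \<i> * (\<nu>2 / 2) * s
               + (\<i> * (\<nu>2 / 2) * of_real (ln 16) + of_real pi * \<nu>1 / 2)
               + (\<Sum>\<^sub>\<infinity>m\<in>{1..}. c0 m * monC \<nu>1 \<nu>2 s ^ m)))\<^sup>2"

definition lead3 :: "(nat \<Rightarrow> complex) \<Rightarrow> complex \<Rightarrow> complex \<Rightarrow> complex \<Rightarrow> complex" where
  "lead3 b0 \<nu>1 \<nu>2 s =
     1 / (sin (\<i> * ((2 - \<nu>2) / 2) * s
               + (\<i> * ((\<nu>2 - 2) / 2) * of_real (ln 16) + of_real pi * \<nu>1 / 2)
               + (\<Sum>\<^sub>\<infinity>m\<in>{1..}. b0 m * monB \<nu>1 \<nu>2 s ^ m)))\<^sup>2"

end

theory Submission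
  imports Defs
begin

text \<open>
  Grouping the lattice sum of the Weierstrass function into rows and summing every row by
  \<open>\<Sum>m. 1 / (u - m)\<^sup>2 = (\<pi> / sin (\<pi> u))\<^sup>2\<close> turns \<open>y\<close> into a rapidly convergent series in the nome. With
  \<open>w = exp (\<i> \<pi> z / \<omega>1)\<close> and \<open>W = exp (2 \<i> \<pi> \<omega>2 / \<omega>1) / w\<close>, which are the two monomials of the domain up to
  factors \<open>1 + O(\<bar>x\<bar> + \<bar>v\<bar>)\<close>, it reads \<open>y = x/2 - 4w/(1 - w)\<^sup>2 - 4W/(1 - W)\<^sup>2 + O(x (\<bar>x\<bar> + \<bar>w\<bar> + \<bar>W\<bar>))\<close>.
  For \<open>0 < V < 2\<close> both \<open>w\<close> and \<open>W\<close> tend to \<open>0\<close> and one linearises; for \<open>V = 0\<close> (\<open>V = 2\<close>) the modulus of the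
  monomial of \<open>w\<close> (of \<open>W\<close>) is constant, the other one is \<open>O(x\<^sup>2)\<close>, and the remaining term is
  \<open>1 / sin\<^sup>2\<close>. If \<open>\<nu>2 = 1\<close> the leading term can vanish identically; then \<open>y\<close> is a holomorphic
  function of \<open>x\<close> with a zero of order at least \<open>2\<close> at \<open>0\<close>, which the equation only allows for \<open>y = 0\<close>.
\<close>

section \<open>Partial fractions of the squared cosecant\<close>

text \<open>In the interior y = \<open>lead1\<close> + O(N^2) with N = |x| + |B| + |C|, where B and
  C are the two monomials; the difficulty is to make this absolute error relative. With E =
  \<open>coefA \<nu>1 \<nu>2 * xpow (\<nu>2 - 1) s\<close> the sum \<open>lead1\<close> is -(x/4)(E
  - 1)^2/E, which dominates N as long as |E - 1| is at least a fixed multiple of 1 + |E|. On the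
  paths |E| is a constant times a power of |x|: a non-zero exponent drives E to 0 or infinity, a
  zero exponent keeps |E| fixed, and modulus 1 is critical. On a spiral this is
  \<open>cancelling\<close>, where the error is distributed over three terms instead; for
  \<open>\<nu>2 = 1\<close> E itself is constant, so that E = 1 is the one bad value, settled by the
  equation. For V = 0 and V = 2 the error must be O(x) although one monomial does not shrink. This
  works because the remainder of the nome series carries a factor |x|, and v differs by O(|x|) from
  its pure powers of that monomial. The radius is fixed before v is known, hence bounds uniform in a
  value u with |u| <= M N stand in for bounds on v.\<close>

lemma sin_pi_times_eq_0_iff:
  fixes z :: complex
  shows "sin (of_real pi * z) = 0 \<longleftrightarrow> z \<in> \<int>"
proof -
  have "sin (of_real pi * z) = 0 \<longleftrightarrow> (\<exists>n::int. of_real pi * z = of_real (of_int n * pi))"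
    by (simp add: sin_eq_0)
  also have "\<dots> \<longleftrightarrow> (\<exists>n::int. z = of_int n)"
    by (simp add: field_simps)
  finally show ?thesis by (auto elim: Ints_cases)
qed

lemma one_minus_not_Ints:
  fixes z :: complex
  assumes "z \<notin> \<int>"
  shows "1 - z \<notin> \<int>"
proof
  assume "1 - z \<in> \<int>"
  hence "1 - (1 - z) \<in> \<int>" by (intro Ints_diff) auto
  thus False using assms by simp
qed

text \<open>The two derivatives of \<open>rGamma z * rGamma (1 - z)\<close> are compared, one from
  the product rule and one from its closed form sin (pi z) / pi. Off the integers the sine can be
  cancelled.\<close>

lemma Digamma_reflection:
  fixes z :: complex
  assumes "z \<notin> \<int>"
  shows "Digamma (1 - z) - Digamma z = of_real pi * cot (of_real pi * z)"
proof -
  have z: "z \<notin> \<int>\<^sub>\<le>\<^sub>0" "1 - z \<notin> \<int>\<^sub>\<le>\<^sub>0"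
    using assms one_minus_not_Ints[OF assms] nonpos_Ints_subset_Ints by (auto simp: subset_iff)
  have "((\<lambda>z. rGamma z * rGamma (1 - z)) has_field_derivative
          (- rGamma z * Digamma z) * rGamma (1 - z) + (- rGamma (1 - z) * Digamma (1 - z)) * (-1) * rGamma z) (at z)"
    using z by (auto intro!: derivative_eq_intros)
  moreover have "((\<lambda>z. rGamma z * rGamma (1 - z)) has_field_derivative
          cos (of_real pi * z)) (at z)"
    unfolding rGamma_reflection_complex
    by (auto intro!: derivative_eq_intros simp: field_simps)
  ultimately have "(- rGamma z * Digamma z) * rGamma (1 - z) + (- rGamma (1 - z) * Digamma (1 - z)) * (-1) * rGamma z = cos (of_real pi * z)"
    by (rule DERIV_unique)
  hence "(rGamma z * rGamma (1 - z)) * (Digamma (1 - z) - Digamma z) = cos (of_real pi * z)"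
    by (simp add: algebra_simps)
  hence "sin (of_real pi * z) / of_real pi * (Digamma (1 - z) - Digamma z) = cos (of_real pi * z)"
    unfolding rGamma_reflection_complex .
  thus ?thesis
    using assms sin_pi_times_eq_0_iff[of z] by (simp add: cot_def field_simps)
qed

text \<open>Differentiates the reflection formula of \<open>Digamma\<close> once more; the formula
  holds on the open complement of the integers, as the transfer of derivatives requires.\<close>

lemma Polygamma_1_reflection:
  fixes z :: complex
  assumes "z \<notin> \<int>"
  shows "Polygamma 1 z + Polygamma 1 (1 - z) = (of_real pi / sin (of_real pi * z))\<^sup>2"
proof -
  have z: "z \<notin> \<int>\<^sub>\<le>\<^sub>0" "1 - z \<notin> \<int>\<^sub>\<le>\<^sub>0"
    using assms one_minus_not_Ints[OF assms] nonpos_Ints_subset_Ints by (auto simp: subset_iff)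
  have s: "sin (of_real pi * z) \<noteq> 0"
    using assms sin_pi_times_eq_0_iff by blast
  have "((\<lambda>z. Digamma (1 - z) - Digamma z) has_field_derivative
          - Polygamma 1 (1 - z) - Polygamma 1 z) (at z)"
    using z by (auto intro!: derivative_eq_intros)
  moreover have "((\<lambda>z. of_real pi * cot (of_real pi * z)) has_field_derivative
          of_real pi * (- inverse ((sin (of_real pi * z))\<^sup>2) * of_real pi)) (at z)"
    by (rule DERIV_cmult[OF DERIV_chain2[OF DERIV_cot[OF s] DERIV_cmult_Id]])
  hence "((\<lambda>z. Digamma (1 - z) - Digamma z) has_field_derivative
          of_real pi * (- inverse ((sin (of_real pi * z))\<^sup>2) * of_real pi)) (at z)"
  proof (rule has_field_derivative_transform_within_open)
    show "open (- \<int> :: complex set)" by (simp add: closed_Ints open_Compl)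
  qed (use assms Digamma_reflection in auto)
  ultimately have "- Polygamma 1 (1 - z) - Polygamma 1 z
      = of_real pi * (- inverse ((sin (of_real pi * z))\<^sup>2) * of_real pi)"
    by (rule DERIV_unique)
  thus ?thesis by (simp add: field_simps power2_eq_square)
qed

lemma abs_summable_Polygamma_1:
  fixes z :: complex
  assumes "z \<notin> \<int>"
  shows "summable (\<lambda>k. norm (1 / (z + of_nat k)\<^sup>2))"
proof (rule summable_comparison_test_ev)
  \<comment> \<open>Beyond this index |z| <= k/2, so |z + k| >= k/2, whose square gives the constant
    4. The summand 1 keeps k positive.\<close>
  define n where "n = nat \<lceil>2 * norm z\<rceil> + 1"
  show "\<forall>\<^sub>F k in sequentially. norm (norm (1 / (z + of_nat k)\<^sup>2)) \<le> 4 * inverse (real k ^ 2)"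
    using eventually_ge_at_top[of n]
  proof eventually_elim
    case (elim k)
    have k: "2 * norm z \<le> real k" "0 < real k" using elim unfolding n_def by linarith+
    have "real k - norm z \<le> norm (z + of_nat k)"
      using norm_diff_ineq[of "of_nat k" z] by (simp add: add.commute)
    hence "real k / 2 \<le> norm (z + of_nat k)" using k by linarith
    hence "(real k / 2)^2 \<le> norm (z + of_nat k) ^ 2" using k by (intro power_mono) auto
    hence "inverse (norm (z + of_nat k) ^ 2) \<le> inverse ((real k / 2)^2)"
      using k by (intro le_imp_inverse_le) auto
    thus ?case by (simp add: norm_divide norm_power power_divide field_simps)
  qed
  show "summable (\<lambda>k. 4 * inverse (real k ^ 2))"
    by (intro summable_mult inverse_power_summable) auto
qed

lemma has_sum_Polygamma_1:
  fixes z :: complex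
  assumes "z \<notin> \<int>"
  shows "((\<lambda>k::nat. 1 / (z + of_nat k)\<^sup>2) has_sum Polygamma 1 z) UNIV"
proof (rule norm_summable_imp_has_sum)
  show "summable (\<lambda>k. norm (1 / (z + of_nat k)\<^sup>2))" by (rule abs_summable_Polygamma_1[OF assms])
  hence "(\<lambda>k. 1 / (z + of_nat k)\<^sup>2) sums (\<Sum>k. 1 / (z + of_nat k)\<^sup>2)"
    by (rule summable_sums[OF summable_norm_cancel])
  thus "(\<lambda>k. 1 / (z + of_nat k)\<^sup>2) sums Polygamma 1 z"
    by (simp add: Polygamma_def inverse_eq_divide power2_eq_square del: mult_eq_0_iff)
qed

text \<open>The cut between 0 and 1 suits 1/(z - m)^2: the indices m = -k give the series of
  \<open>Polygamma 1\<close> at z, the indices m = 1 + k its series at 1 - z.\<close>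

lemma int_UNIV_split: "(UNIV :: int set) = (\<lambda>k::nat. - int k) ` UNIV \<union> (\<lambda>k::nat. 1 + int k) ` UNIV"
proof -
  have "x \<in> (\<lambda>k::nat. - int k) ` UNIV \<union> (\<lambda>k::nat. 1 + int k) ` UNIV" for x :: int
  proof (cases "x \<le> 0")
    case True
    thus ?thesis by (intro UnI1 image_eqI[of _ _ "nat (- x)"]) auto
  next
    case False
    thus ?thesis by (intro UnI2 image_eqI[of _ _ "nat (x - 1)"]) auto
  qed
  thus ?thesis by blast
qed

lemma has_sum_int_split:
  fixes f :: "int \<Rightarrow> 'a :: topological_comm_monoid_add"
  assumes "((\<lambda>k::nat. f (- int k)) has_sum A) UNIV" "((\<lambda>k::nat. f (1 + int k)) has_sum B) UNIV"
  shows "(f has_sum (A + B)) UNIV"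
  unfolding int_UNIV_split
proof (rule has_sum_Un_disjoint)
  show "(f has_sum A) (range (\<lambda>k. - int k))"
    using assms(1) by (subst has_sum_reindex) (auto simp: inj_on_def o_def)
  show "(f has_sum B) (range (\<lambda>k. 1 + int k))"
    using assms(2) by (subst has_sum_reindex) (auto simp: inj_on_def o_def)
qed auto

lemma has_sum_inverse_sin_squared:
  fixes z :: complex
  assumes "z \<notin> \<int>"
  shows "((\<lambda>m::int. 1 / (z - of_int m)\<^sup>2) has_sum (of_real pi / sin (of_real pi * z))\<^sup>2) UNIV"
proof -
  have z: "1 - z \<notin> \<int>"
    by (rule one_minus_not_Ints[OF assms])
  have "(z - (1 + of_nat k))\<^sup>2 = (1 - z + of_nat k)\<^sup>2" for k :: nat
    by (simp add: power2_eq_square algebra_simps)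
  hence "((\<lambda>m::int. 1 / (z - of_int m)\<^sup>2) has_sum (Polygamma 1 z + Polygamma 1 (1 - z))) UNIV"
    using has_sum_Polygamma_1[OF assms] has_sum_Polygamma_1[OF z]
    by (intro has_sum_int_split) auto
  thus ?thesis using Polygamma_1_reflection[OF assms] by simp
qed

text \<open>Twice the Basel sum. It is the reference value of row 0, where the origin is missing,
  and becomes the constant -1/3 of the nome series.\<close>

lemma has_sum_inverse_int_squares:
  "((\<lambda>m::int. 1 / (of_int m :: complex)\<^sup>2) has_sum (of_real pi)\<^sup>2 / 3) (UNIV - {0})"
proof -
  have "((\<lambda>k::nat. 1 / (of_nat k + 1)\<^sup>2) has_sum (pi\<^sup>2 / 6)) UNIV"
    using sums_nonneg_imp_has_sum[OF inverse_squares_sums] by (simp add: add.commute)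
  hence "((\<lambda>k::nat. complex_of_real (1 / (of_nat k + 1)\<^sup>2)) has_sum of_real (pi\<^sup>2 / 6)) UNIV"
    by (rule has_sum_of_real)
  hence 0: "((\<lambda>k::nat. 1 / (of_nat k + 1 :: complex)\<^sup>2) has_sum (of_real pi)\<^sup>2 / 6) UNIV"
    by simp
  have 1: "((\<lambda>m::int. 1 / (of_int m :: complex)\<^sup>2) has_sum (of_real pi)\<^sup>2 / 6) (range (\<lambda>k::nat. 1 + int k))"
    using 0 by (subst has_sum_reindex) (auto simp: inj_on_def o_def add.commute)
  have "(- 1 - of_nat k :: complex)\<^sup>2 = (of_nat k + 1)\<^sup>2" for k
    by (simp add: power2_eq_square algebra_simps)
  hence 2: "((\<lambda>m::int. 1 / (of_int m :: complex)\<^sup>2) has_sum (of_real pi)\<^sup>2 / 6) (range (\<lambda>k::nat. - 1 - int k))"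
    using 0 by (subst has_sum_reindex) (auto simp: inj_on_def o_def)
  have "x \<in> (range (\<lambda>k::nat. 1 + int k)) \<union> (range (\<lambda>k::nat. - 1 - int k))" if "x \<noteq> 0" for x
  proof (cases "x > 0")
    case True
    thus ?thesis by (intro UnI1 image_eqI[of _ _ "nat (x - 1)"]) auto
  next
    case False
    thus ?thesis using that by (intro UnI2 image_eqI[of _ _ "nat (- 1 - x)"]) auto
  qed
  hence "UNIV - {0} = (range (\<lambda>k::nat. 1 + int k)) \<union> (range (\<lambda>k::nat. - 1 - int k))"
    by auto
  moreover have "(range (\<lambda>k::nat. 1 + int k)) \<inter> (range (\<lambda>k::nat. - 1 - int k)) = {}" by auto
  ultimately show ?thesis using has_sum_Un_disjoint[OF 1 2] by simp
qed

section \<open>Summing the Weierstrass function over the rows of the lattice\<close>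

text \<open>The exponent is half of the cubic decay of the lattice terms, so that the two indices
  can share that decay evenly; being below -1 it still gives convergence.\<close>

lemma summable_on_int_powr:
  "(\<lambda>m::int. (1 + \<bar>real_of_int m\<bar>) powr (-3/2)) summable_on UNIV"
proof -
  have "summable (\<lambda>k. real k powr (-3/2))" by (simp add: summable_real_powr_iff)
  hence s: "summable (\<lambda>k. real (Suc k) powr (-3/2))" by (subst summable_Suc_iff)
  have "(\<lambda>k. real (Suc k) powr (-3/2)) summable_on UNIV"
    by (rule norm_summable_imp_summable_on) (use s in simp)
  then obtain A where A: "((\<lambda>k. real (Suc k) powr (-3/2)) has_sum A) UNIV"
    by (auto simp: summable_on_def)
  have "summable (\<lambda>k. real (Suc (Suc k)) powr (-3/2))" using s by (subst summable_Suc_iff)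
  hence "(\<lambda>k. real (Suc (Suc k)) powr (-3/2)) summable_on UNIV"
    by (intro norm_summable_imp_summable_on) simp
  then obtain B where B: "((\<lambda>k. real (Suc (Suc k)) powr (-3/2)) has_sum B) UNIV"
    by (auto simp: summable_on_def)
  have "((\<lambda>m::int. (1 + \<bar>real_of_int m\<bar>) powr (-3/2)) has_sum (A + B)) UNIV"
    using A B by (intro has_sum_int_split) (simp_all add: add_ac)
  thus ?thesis by (auto simp: summable_on_def)
qed

lemma summable_on_int_prod_powr:
  "(\<lambda>(n::int, m::int). (1 + \<bar>real_of_int n\<bar>) powr (-3/2) * (1 + \<bar>real_of_int m\<bar>) powr (-3/2))
     summable_on UNIV"
proof -
  define f where "f = (\<lambda>m::int. (1 + \<bar>real_of_int m\<bar>) powr (-3/2))"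
  obtain A where A: "(f has_sum A) UNIV"
    using summable_on_int_powr by (auto simp: summable_on_def f_def)
  have "(\<lambda>(n, m). f n * f m) summable_on (UNIV \<times> UNIV)"
  proof (rule summable_on_SigmaI)
    show "((\<lambda>m. case (n, m) of (n, m) \<Rightarrow> f n * f m) has_sum (f n * A)) UNIV" for n
      using has_sum_cmult_right[OF A] by simp
    show "(\<lambda>n. f n * A) summable_on UNIV"
      using has_sum_cmult_left[OF A] by (auto simp: summable_on_def)
  qed (auto simp: f_def)
  thus ?thesis by (simp add: f_def)
qed

text \<open>The imaginary part of m + n \<tau> controls n; then m is the lattice point minus n
  \<tau>. The summands of \<open>K\<close> collect the resulting constants.\<close>

lemma lattice_norm_lower_bound:
  fixes \<tau> :: complex
  assumes "Im \<tau> > 0"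
  obtains K where "K > 0"
    "\<And>n m :: int. \<bar>real_of_int n\<bar> + \<bar>real_of_int m\<bar> \<le> K * norm (of_int m + of_int n * \<tau>)"
proof
  define K where "K = 1 + norm \<tau> / Im \<tau> + 1 / Im \<tau>"
  show "K > 0" using assms by (simp add: K_def add_pos_nonneg)
  fix n m :: int
  define L where "L = norm (of_int m + of_int n * \<tau>)"
  have "\<bar>Im (of_int m + of_int n * \<tau>)\<bar> \<le> L" unfolding L_def by (rule abs_Im_le_cmod)
  hence "\<bar>real_of_int n\<bar> * Im \<tau> \<le> L" using assms by (simp add: abs_mult)
  hence n: "\<bar>real_of_int n\<bar> \<le> L / Im \<tau>" using assms by (simp add: field_simps)
  have "\<bar>real_of_int m\<bar> = norm ((of_int m + of_int n * \<tau>) - of_int n * \<tau> :: complex)" by simp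
  also have "\<dots> \<le> L + \<bar>real_of_int n\<bar> * norm \<tau>"
    unfolding L_def by (rule order_trans[OF norm_triangle_ineq4]) (simp add: norm_mult)
  also have "\<dots> \<le> L + L / Im \<tau> * norm \<tau>"
    using n by (intro add_left_mono mult_right_mono) auto
  finally show "\<bar>real_of_int n\<bar> + \<bar>real_of_int m\<bar> \<le> K * L"
    using n by (simp add: K_def algebra_simps)
qed

text \<open>Over a common denominator the numerator is z (2 l - z), so one power of l cancels. With
  |2 l - z| <= 5/2 |l| and |z - l| >= |l|/2 the constant is (5/2) * 4 = 10.\<close>

lemma norm_inverse_square_diff_le:
  fixes z l :: complex
  assumes "2 * norm z \<le> norm l" "l \<noteq> 0"
  shows "norm (1 / (z - l)\<^sup>2 - 1 / l\<^sup>2) \<le> 10 * norm z / norm l ^ 3"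
proof -
  have lpos: "norm l > 0" using assms by simp
  have "norm l - norm z \<le> norm (z - l)"
    using norm_triangle_ineq2[of l z] by (simp add: norm_minus_commute)
  hence half: "norm l / 2 \<le> norm (z - l)" using assms by linarith
  hence nz: "z - l \<noteq> 0" using lpos by auto
  have "1 / (z - l)\<^sup>2 - 1 / l\<^sup>2 = z * (2 * l - z) / ((z - l)\<^sup>2 * l\<^sup>2)"
    using nz assms(2) by (simp add: divide_simps) (simp add: power2_eq_square algebra_simps)
  hence "norm (1 / (z - l)\<^sup>2 - 1 / l\<^sup>2)
      = norm z * norm (2 * l - z) / (norm (z - l) ^ 2 * norm l ^ 2)"
    by (simp add: norm_divide norm_mult norm_power)
  also have "\<dots> \<le> norm z * (5 / 2 * norm l) / ((norm l / 2) ^ 2 * norm l ^ 2)"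
  proof (rule frac_le)
    have "norm (2 * l - z) \<le> 2 * norm l + norm z"
      using norm_triangle_ineq4[of "2 * l" z] by (simp add: norm_mult)
    thus "norm z * norm (2 * l - z) \<le> norm z * (5 / 2 * norm l)"
      using assms by (intro mult_left_mono) auto
    show "(norm l / 2) ^ 2 * norm l ^ 2 \<le> norm (z - l) ^ 2 * norm l ^ 2"
      using half lpos by (intro mult_right_mono power_mono) auto
    show "0 < (norm l / 2) ^ 2 * norm l ^ 2" using lpos by simp
  qed auto
  also have "\<dots> = 10 * norm z / norm l ^ 3"
    using lpos by (simp add: field_simps power2_eq_square power3_eq_cube)
  finally show ?thesis .
qed

text \<open>For N = |n| + |m| >= 1 both 1 + |n| and 1 + |m| are at most 2 N; their product is raised
  to the power -3/2. The 8 is 2^3.\<close>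

lemma inverse_cube_le_prod_powr:
  fixes n m :: int
  assumes "(n, m) \<noteq> (0, 0)"
  shows "1 / (\<bar>real_of_int n\<bar> + \<bar>real_of_int m\<bar>) ^ 3
     \<le> 8 * ((1 + \<bar>real_of_int n\<bar>) powr (-3/2) * (1 + \<bar>real_of_int m\<bar>) powr (-3/2))"
proof -
  define N where "N = \<bar>real_of_int n\<bar> + \<bar>real_of_int m\<bar>"
  have "1 \<le> \<bar>n\<bar> + \<bar>m\<bar>" using assms by auto
  hence "real_of_int 1 \<le> real_of_int (\<bar>n\<bar> + \<bar>m\<bar>)" unfolding of_int_le_iff .
  hence N: "N \<ge> 1" by (simp add: N_def)
  have "(1 + \<bar>real_of_int n\<bar>) * (1 + \<bar>real_of_int m\<bar>) \<le> (2 * N) * (2 * N)"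
    using N by (intro mult_mono) (auto simp: N_def)
  hence "((2 * N) * (2 * N)) powr (-3/2) \<le> ((1 + \<bar>real_of_int n\<bar>) * (1 + \<bar>real_of_int m\<bar>)) powr (-3/2)"
    by (intro powr_mono2') auto
  also have "\<dots> = (1 + \<bar>real_of_int n\<bar>) powr (-3/2) * (1 + \<bar>real_of_int m\<bar>) powr (-3/2)"
    by (simp add: powr_mult)
  also have "((2 * N) * (2 * N)) powr (-3/2) = (2 * N) powr (-3)"
    using N powr_powr[of "2 * N" 2 "-3/2"] by (simp add: powr_numeral power2_eq_square)
  also have "(2 * N) powr (-3) = 1 / (2 * N) ^ 3"
    using N by (subst powr_neg_numeral) auto
  finally show ?thesis unfolding N_def [symmetric] using N by (simp add: power_mult_distrib field_simps)
qed

lemma lattice_sum_summable: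
  fixes \<zeta> \<tau> :: complex
  assumes "Im \<tau> > 0"
  shows "(\<lambda>(n::int, m::int). 1 / (\<zeta> - (of_int m + of_int n * \<tau>))\<^sup>2 - 1 / (of_int m + of_int n * \<tau>)\<^sup>2)
     summable_on (UNIV - {(0, 0)})"
proof -
  obtain K where K: "K > 0"
    "\<And>n m :: int. \<bar>real_of_int n\<bar> + \<bar>real_of_int m\<bar> \<le> K * norm (of_int m + of_int n * \<tau>)"
    using lattice_norm_lower_bound[OF assms] by blast
  define f where "f = (\<lambda>(n::int, m::int).
      1 / (\<zeta> - (of_int m + of_int n * \<tau>))\<^sup>2 - 1 / (of_int m + of_int n * \<tau>)\<^sup>2)"
  \<comment> \<open>Outside this box |n| + |m| >= 2 K |\<zeta>|, hence the lattice point has modulus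
    at least 2 |\<zeta>| and the cubic estimate applies; the box itself is finite. The 80 in
    \<open>C\<close> is 10 * 8.\<close>
  define R where "R = \<lceil>2 * K * norm \<zeta>\<rceil>"
  define T where "T = {-R..R} \<times> {-R..R} - {(0::int, 0::int)}"
  define C where "C = 80 * norm \<zeta> * K ^ 3"
  have "(\<lambda>p. norm (f p)) summable_on (UNIV - {(0, 0)} - T)"
  proof (rule Infinite_Sum.abs_summable_on_comparison_test')
    show "(\<lambda>p. C * (case p of (n::int, m::int) \<Rightarrow>
        (1 + \<bar>real_of_int n\<bar>) powr (-3/2) * (1 + \<bar>real_of_int m\<bar>) powr (-3/2)))
        summable_on (UNIV - {(0, 0)} - T)"
      by (rule summable_on_subset[OF summable_on_cmult_right[OF summable_on_int_prod_powr]]) auto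
    fix p assume p: "p \<in> UNIV - {(0, 0)} - T"
    obtain n m where nm: "p = (n, m)" by force
    define N where "N = \<bar>real_of_int n\<bar> + \<bar>real_of_int m\<bar>"
    define l where "l = of_int m + of_int n * \<tau>"
    have ne: "(n, m) \<noteq> (0, 0)" using p nm by auto
    have "1 \<le> \<bar>n\<bar> + \<bar>m\<bar>" using ne by auto
    hence "real_of_int 1 \<le> real_of_int (\<bar>n\<bar> + \<bar>m\<bar>)" unfolding of_int_le_iff .
    hence N1: "N \<ge> 1" by (simp add: N_def)
    have "\<bar>n\<bar> > R \<or> \<bar>m\<bar> > R" using p nm by (auto simp: T_def)
    hence "\<bar>n\<bar> + \<bar>m\<bar> \<ge> R" by linarith
    hence "real_of_int R \<le> real_of_int (\<bar>n\<bar> + \<bar>m\<bar>)" unfolding of_int_le_iff .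
    moreover have "2 * K * norm \<zeta> \<le> real_of_int R" unfolding R_def by linarith
    ultimately have "2 * K * norm \<zeta> \<le> N" by (simp add: N_def)
    also have Nl: "N \<le> K * norm l" using K(2)[of n m] by (simp add: N_def l_def)
    finally have l2: "2 * norm \<zeta> \<le> norm l" using K(1) by (simp add: mult.assoc)
    have "K * norm l > 0" using Nl N1 by linarith
    hence l0: "norm l > 0" "l \<noteq> 0" using K(1) by (auto simp: zero_less_mult_iff)
    have "norm (f p) \<le> 10 * norm \<zeta> / norm l ^ 3"
      unfolding f_def nm prod.case l_def [symmetric] by (rule norm_inverse_square_diff_le[OF l2 l0(2)])
    also have "\<dots> = 10 * norm \<zeta> * K ^ 3 / (K * norm l) ^ 3"
      using K(1) by (simp add: power_mult_distrib)
    also have "\<dots> \<le> 10 * norm \<zeta> * K ^ 3 / N ^ 3"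
      using Nl N1 K(1) by (intro divide_left_mono power_mono mult_pos_pos) (auto simp: l0)
    also have "\<dots> = 10 * norm \<zeta> * K ^ 3 * (1 / N ^ 3)" by simp
    also have "\<dots> \<le> 10 * norm \<zeta> * K ^ 3 *
       (8 * ((1 + \<bar>real_of_int n\<bar>) powr (-3/2) * (1 + \<bar>real_of_int m\<bar>) powr (-3/2)))"
      using inverse_cube_le_prod_powr[OF ne] K(1) unfolding N_def by (intro mult_left_mono) auto
    finally show "norm (f p) \<le> C * (case p of (n::int, m::int) \<Rightarrow>
        (1 + \<bar>real_of_int n\<bar>) powr (-3/2) * (1 + \<bar>real_of_int m\<bar>) powr (-3/2))"
      by (simp add: nm C_def)
  qed
  hence 1: "f summable_on (UNIV - {(0, 0)} - T)" by (rule abs_summable_summable)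
  have 2: "f summable_on T" by (rule summable_on_finite) (simp add: T_def)
  have "f summable_on ((UNIV - {(0, 0)} - T) \<union> T)"
    by (rule summable_on_Un_disjoint[OF 1 2]) auto
  also have "(UNIV - {(0, 0)} - T) \<union> T = UNIV - {(0, 0)}" by (auto simp: T_def)
  finally show ?thesis by (simp add: f_def)
qed

lemma has_sum_diff:
  fixes f g :: "'a \<Rightarrow> 'b :: topological_ab_group_add"
  assumes "(f has_sum A) S" "(g has_sum B) S"
  shows "((\<lambda>x. f x - g x) has_sum (A - B)) S"
  using has_sum_add[OF assms(1), of "\<lambda>x. - g x" "- B"] assms(2) by (simp add: has_sum_uminus)

text \<open>Unconditional summability permits summing row by row. In a row other than 0 both sums
  are squared cosecants. Row 0 lacks the origin: its shifted sum loses 1/\<zeta>^2 and its reference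
  sum is \<open>pi\<^sup>2 / 3\<close>; moving this row into the value of the sum leaves the index
  set without 0.\<close>

lemma lattice_sum_by_rows:
  fixes \<zeta> \<tau> :: complex
  assumes \<tau>: "Im \<tau> > 0" and \<zeta>: "\<And>n :: int. \<zeta> - of_int n * \<tau> \<notin> \<int>"
  defines "f \<equiv> (\<lambda>(n::int, m::int).
      1 / (\<zeta> - (of_int m + of_int n * \<tau>))\<^sup>2 - 1 / (of_int m + of_int n * \<tau>)\<^sup>2)"
  shows "((\<lambda>n::int. (of_real pi / sin (of_real pi * (\<zeta> - of_int n * \<tau>)))\<^sup>2
             - (of_real pi / sin (of_real pi * (of_int n * \<tau>)))\<^sup>2)
           has_sum (infsum f (UNIV - {(0, 0)}) + 1 / \<zeta>\<^sup>2
             - (of_real pi / sin (of_real pi * \<zeta>))\<^sup>2 + (of_real pi)\<^sup>2 / 3)) (UNIV - {0})"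
proof -
  define B where "B = (\<lambda>n::int. if n = 0 then UNIV - {0::int} else UNIV)"
  define g where "g = (\<lambda>n::int. if n = 0 then
      (of_real pi / sin (of_real pi * \<zeta>))\<^sup>2 - 1 / \<zeta>\<^sup>2 - (of_real pi)\<^sup>2 / 3
    else (of_real pi / sin (of_real pi * (\<zeta> - of_int n * \<tau>)))\<^sup>2
             - (of_real pi / sin (of_real pi * (of_int n * \<tau>)))\<^sup>2)"
  have sig: "Sigma UNIV B = UNIV - {(0, 0)}" by (auto simp: B_def split: if_splits)
  have sum: "(f has_sum infsum f (UNIV - {(0, 0)})) (Sigma UNIV B)"
    unfolding sig f_def by (rule has_sum_infsum[OF lattice_sum_summable[OF \<tau>]])
  have rows: "((\<lambda>m. f (n, m)) has_sum g n) (B n)" for n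
  proof (cases "n = 0")
    case True
    have "((\<lambda>m::int. 1 / (\<zeta> - of_int m)\<^sup>2) has_sum ((of_real pi / sin (of_real pi * \<zeta>))\<^sup>2 - 1 / \<zeta>\<^sup>2)) (UNIV - {0})"
      using has_sum_Diff[OF has_sum_inverse_sin_squared[of \<zeta>] has_sum_finite[of "{0}"]] \<zeta>[of 0]
      by simp
    from has_sum_diff[OF this has_sum_inverse_int_squares] show ?thesis
      using True by (simp add: f_def g_def B_def)
  next
    case False
    have nt: "of_int n * \<tau> \<notin> \<int>"
    proof
      assume "of_int n * \<tau> \<in> \<int>"
      then obtain k where "of_int n * \<tau> = of_int k" by (elim Ints_cases)
      hence "Im (of_int n * \<tau>) = Im (of_int k)" by simp
      thus False using False \<tau> by simp
    qed
    have "((\<lambda>m::int. 1 / (of_int n * \<tau> - of_int m)\<^sup>2) has_sum (of_real pi / sin (of_real pi * (of_int n * \<tau>)))\<^sup>2) UNIV"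
      by (rule has_sum_inverse_sin_squared[OF nt])
    also have "?this \<longleftrightarrow> ((\<lambda>m::int. 1 / (of_int m + of_int n * \<tau>)\<^sup>2) has_sum (of_real pi / sin (of_real pi * (of_int n * \<tau>)))\<^sup>2) UNIV"
      by (rule has_sum_reindex_bij_witness[of _ uminus uminus]) (auto simp: add.commute)
    finally have "((\<lambda>m::int. 1 / (\<zeta> - of_int n * \<tau> - of_int m)\<^sup>2 - 1 / (of_int m + of_int n * \<tau>)\<^sup>2) has_sum
        ((of_real pi / sin (of_real pi * (\<zeta> - of_int n * \<tau>)))\<^sup>2
             - (of_real pi / sin (of_real pi * (of_int n * \<tau>)))\<^sup>2)) UNIV"
      by (intro has_sum_diff has_sum_inverse_sin_squared \<zeta>)
    thus ?thesis using False by (simp add: f_def g_def B_def algebra_simps)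
  qed
  have "(g has_sum infsum f (UNIV - {(0, 0)})) UNIV"
    by (rule has_sum_SigmaD[OF sum rows])
  from has_sum_Diff[OF this has_sum_finite[of "{0}"]]
  have "(g has_sum (infsum f (UNIV - {(0, 0)}) - g 0)) (UNIV - {0})" by simp
  also have "?this \<longleftrightarrow> ((\<lambda>n::int. (of_real pi / sin (of_real pi * (\<zeta> - of_int n * \<tau>)))\<^sup>2
             - (of_real pi / sin (of_real pi * (of_int n * \<tau>)))\<^sup>2)
           has_sum (infsum f (UNIV - {(0, 0)}) - g 0)) (UNIV - {0})"
    by (rule has_sum_cong) (simp add: g_def)
  finally show ?thesis by (simp add: g_def algebra_simps)
qed

text \<open>Homogeneity of degree -2, with the full period 2 w1 scaled to 1. The indices are swapped
  so that the first one counts multiples of \<tau>, that is, rows.\<close>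

lemma weierstrass_p_eq_lattice_sum:
  fixes z w1 w2 :: complex
  assumes "w1 \<noteq> 0"
  defines "\<zeta> \<equiv> z / (2 * w1)" and "\<tau> \<equiv> w2 / w1"
  shows "weierstrass_p z w1 w2 = 1 / (2 * w1)\<^sup>2 * (1 / \<zeta>\<^sup>2 +
     infsum (\<lambda>(n::int, m::int). 1 / (\<zeta> - (of_int m + of_int n * \<tau>))\<^sup>2 - 1 / (of_int m + of_int n * \<tau>)\<^sup>2)
       (UNIV - {(0, 0)}))"
proof -
  have z: "z = 2 * w1 * \<zeta>" and w2: "w2 = w1 * \<tau>" using assms by simp_all
  have "(\<Sum>\<^sub>\<infinity>(m, n) \<in> UNIV - {(0::int, 0::int)}.
        1 / (z - (2 * of_int m * w1 + 2 * of_int n * w2))\<^sup>2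
        - 1 / (2 * of_int m * w1 + 2 * of_int n * w2)\<^sup>2)
     = (\<Sum>\<^sub>\<infinity>(m, n) \<in> UNIV - {(0::int, 0::int)}. 1 / (2 * w1)\<^sup>2 *
        (1 / (\<zeta> - (of_int m + of_int n * \<tau>))\<^sup>2 - 1 / (of_int m + of_int n * \<tau>)\<^sup>2))"
  proof (rule infsum_cong)
    fix x :: "int \<times> int"
    obtain m n where x: "x = (m, n)" by force
    have a: "z - (2 * of_int m * w1 + 2 * of_int n * w2) = (2 * w1) * (\<zeta> - (of_int m + of_int n * \<tau>))"
      and b: "2 * of_int m * w1 + 2 * of_int n * w2 = (2 * w1) * (of_int m + of_int n * \<tau>)"
      by (simp_all add: z w2 algebra_simps)
    have c: "1 / (c * A)\<^sup>2 - 1 / (c * B)\<^sup>2 = 1 / c\<^sup>2 * (1 / A\<^sup>2 - 1 / B\<^sup>2)" for A B c :: complex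
      by (simp add: power_mult_distrib right_diff_distrib)
    show "(case x of (m, n) \<Rightarrow> 1 / (z - (2 * of_int m * w1 + 2 * of_int n * w2))\<^sup>2
        - 1 / (2 * of_int m * w1 + 2 * of_int n * w2)\<^sup>2) = (case x of (m, n) \<Rightarrow> 1 / (2 * w1)\<^sup>2 *
        (1 / (\<zeta> - (of_int m + of_int n * \<tau>))\<^sup>2 - 1 / (of_int m + of_int n * \<tau>)\<^sup>2))"
      unfolding x prod.case by (subst a, subst b) (rule c)
  qed
  also have "\<dots> = 1 / (2 * w1)\<^sup>2 * (\<Sum>\<^sub>\<infinity>(m, n) \<in> UNIV - {(0::int, 0::int)}.
        (1 / (\<zeta> - (of_int m + of_int n * \<tau>))\<^sup>2 - 1 / (of_int m + of_int n * \<tau>)\<^sup>2))"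
    by (subst infsum_cmult_right' [symmetric]) (simp add: case_prod_unfold)
  also have "(\<Sum>\<^sub>\<infinity>(m, n) \<in> UNIV - {(0::int, 0::int)}.
        (1 / (\<zeta> - (of_int m + of_int n * \<tau>))\<^sup>2 - 1 / (of_int m + of_int n * \<tau>)\<^sup>2))
     = infsum (\<lambda>(n::int, m::int). 1 / (\<zeta> - (of_int m + of_int n * \<tau>))\<^sup>2 - 1 / (of_int m + of_int n * \<tau>)\<^sup>2)
       (UNIV - {(0, 0)})"
    by (rule infsum_reindex_bij_witness[of _ prod.swap prod.swap]) auto
  finally show ?thesis
    unfolding weierstrass_p_def by (simp add: z power_mult_distrib algebra_simps)
qed

section \<open>The expansion in the nome\<close>

text \<open>Equals -4 times the Koebe function: 1/sin^2 in the variable exp (2 i y), in which it is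
  regular at 0.\<close>

definition csc2_exp :: "complex \<Rightarrow> complex" where
  "csc2_exp t = - 4 * t / (1 - t)\<^sup>2"

lemma csc2_exp_eq: "1 / (sin y)\<^sup>2 = csc2_exp (exp (2 * \<i> * y))"
proof -
  define e where "e = exp (\<i> * y)"
  have e: "e \<noteq> 0" "exp (- (\<i> * y)) = inverse e" "exp (2 * \<i> * y) = e\<^sup>2"
    by (simp_all add: e_def exp_minus exp_of_nat_mult [symmetric] exp_double [symmetric] mult.assoc)
  have "(sin y)\<^sup>2 = (e - inverse e)\<^sup>2 / (2 * \<i>)\<^sup>2"
    by (simp add: sin_exp_eq' e_def [symmetric] e power_divide power_mult_distrib)
      (simp add: exp_minus e_def power2_eq_square algebra_simps)
  also have "\<dots> = - (1 - e\<^sup>2)\<^sup>2 / (4 * e\<^sup>2)"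
    using e(1) by (simp add: field_simps power2_eq_square)
  finally show ?thesis by (simp add: csc2_exp_def e)
qed

text \<open>Evenness of 1/sin^2. It replaces arguments that grow from row to row by arguments that
  decay.\<close>

lemma csc2_exp_inverse: "csc2_exp (inverse t) = csc2_exp t"
  by (cases "t = 0"; cases "t = 1") (auto simp: csc2_exp_def field_simps power2_eq_square)

lemma csc2_exp_0 [simp]: "csc2_exp 0 = 0"
  by (simp add: csc2_exp_def)

lemma norm_one_minus_ge:
  fixes t :: complex
  assumes "norm t \<le> 1/2"
  shows "1/2 \<le> norm (1 - t)" "t \<noteq> 1"
  using assms norm_triangle_ineq2[of 1 t] by auto

lemma norm_csc2_exp_le:
  assumes "norm t \<le> 1/2"
  shows "norm (csc2_exp t) \<le> 16 * norm t"
proof -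
  have "(1/2)\<^sup>2 \<le> (norm (1 - t))\<^sup>2"
    using norm_one_minus_ge[OF assms] by (intro power_mono) auto
  hence "4 * norm t / (norm (1 - t))\<^sup>2 \<le> 4 * norm t / (1/2)\<^sup>2"
    using norm_one_minus_ge[OF assms] by (intro divide_left_mono mult_pos_pos) auto
  thus ?thesis by (simp add: csc2_exp_def norm_divide norm_mult norm_power power2_eq_square)
qed

text \<open>The identity \<open>csc2_exp t + 4 * t = csc2_exp t * (1 - (1 - t)\<^sup>2)\<close>,
  with last factor t (2 - t), reduces this to the first-order bound; 16 * 4 = 64.\<close>

lemma norm_csc2_exp_linear_le:
  assumes "norm t \<le> 1/2"
  shows "norm (csc2_exp t + 4 * t) \<le> 64 * (norm t)\<^sup>2"
proof -
  have t1: "1 - t \<noteq> 0" using norm_one_minus_ge[OF assms] by auto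
  have eq: "t * (2 - t) = 1 - (1 - t)\<^sup>2" by (simp add: power2_eq_square algebra_simps)
  have "csc2_exp t + 4 * t = csc2_exp t * (t * (2 - t))"
    unfolding eq using t1 by (simp add: csc2_exp_def right_diff_distrib[of _ 1])
  also have "norm \<dots> \<le> (16 * norm t) * (norm t * 4)"
    unfolding norm_mult
  proof (intro mult_mono norm_csc2_exp_le assms)
    show "norm (2 - t) \<le> 4" using norm_triangle_ineq4[of 2 t] assms by simp
  qed auto
  finally show ?thesis by (simp add: power2_eq_square)
qed

text \<open>The numerator of the difference is -4 (t - u)(1 - t u), and the two squares in the
  denominator are at least 1/4 each; 4 * 2 * 16 = 128.\<close>

lemma norm_csc2_exp_diff_le:
  assumes "norm t \<le> 1/2" "norm u \<le> 1/2"
  shows "norm (csc2_exp t - csc2_exp u) \<le> 128 * norm (t - u)"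
proof -
  have nz: "1 - t \<noteq> 0" "1 - u \<noteq> 0" using norm_one_minus_ge assms by auto
  have "csc2_exp t - csc2_exp u = - 4 * (t - u) * (1 - t * u) / ((1 - t)\<^sup>2 * (1 - u)\<^sup>2)"
    using nz by (simp add: csc2_exp_def divide_simps) (simp add: power2_eq_square algebra_simps)
  also have "norm \<dots> = 4 * norm (t - u) * norm (1 - t * u) / ((norm (1 - t))\<^sup>2 * (norm (1 - u))\<^sup>2)"
    by (simp only: norm_divide norm_mult norm_power norm_minus_cancel norm_numeral)
  also have "\<dots> \<le> 4 * norm (t - u) * 2 / ((1/2)\<^sup>2 * (1/2)\<^sup>2)"
  proof (rule frac_le)
    have "norm t * norm u \<le> 1 * 1" using assms by (intro mult_mono) auto
    hence "norm (1 - t * u) \<le> 2"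
      using norm_triangle_ineq4[of 1 "t * u"] by (simp add: norm_mult)
    thus "4 * norm (t - u) * norm (1 - t * u) \<le> 4 * norm (t - u) * 2"
      by (intro mult_left_mono) auto
    show "(1/2)\<^sup>2 * (1/2)\<^sup>2 \<le> (norm (1 - t))\<^sup>2 * (norm (1 - u))\<^sup>2"
      using norm_one_minus_ge assms by (intro mult_mono power_mono) auto
  qed auto
  finally show ?thesis by (simp add: power2_eq_square)
qed

text \<open>With W = p / w the row n > 0 has argument w / p^n, equivalent to W p^(n-1) by inversion.
  These rows are shifted by one, so that \<open>csc2_exp W\<close> stands outside the series; each
  of the two half-lattices contributes one subtracted reference row.\<close>

definition nome_tail :: "complex \<Rightarrow> complex \<Rightarrow> complex \<Rightarrow> nat \<Rightarrow> complex" where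
  "nome_tail w W p k =
     csc2_exp (w * p ^ Suc k) + csc2_exp (W * p ^ Suc k) - 2 * csc2_exp (p ^ Suc k)"

lemma norm_nome_tail_le:
  assumes "norm w \<le> 1/2" "norm W \<le> 1/2" "norm p \<le> 1/2"
  shows "norm (nome_tail w W p k) \<le> 48 * norm p * norm p ^ k"
proof -
  have p: "norm p ^ Suc k \<le> norm p" "norm p ^ Suc k \<le> 1"
    using assms power_Suc_le_self[of "norm p" k] by auto
  have *: "norm (csc2_exp (t * p ^ Suc k)) \<le> 16 * norm t * norm p ^ Suc k" if "norm t \<le> 1" for t
  proof -
    have "norm t * norm p ^ Suc k \<le> 1 * (1/2)"
      using that p assms(3) by (intro mult_mono) auto
    hence "norm (t * p ^ Suc k) \<le> 1/2" by (simp add: norm_mult norm_power)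
    from norm_csc2_exp_le[OF this] show ?thesis by (simp add: norm_mult norm_power)
  qed
  have "norm (nome_tail w W p k) \<le> norm (csc2_exp (w * p ^ Suc k)) + norm (csc2_exp (W * p ^ Suc k))
      + norm (2 * csc2_exp (p ^ Suc k))"
    unfolding nome_tail_def by (intro norm_triangle_le_diff add_mono norm_triangle_ineq order_refl)
  also have "\<dots> \<le> 16 * (1/2) * norm p ^ Suc k + 16 * (1/2) * norm p ^ Suc k + 2 * (16 * 1 * norm p ^ Suc k)"
    using *[of 1] assms unfolding norm_mult[of 2]
    by (intro add_mono order_trans[OF *] mult_right_mono mult_left_mono mult_mono) auto
  finally show ?thesis by simp
qed

lemma summable_nome_tail:
  assumes "norm w \<le> 1/2" "norm W \<le> 1/2" "norm p \<le> 1/2"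
  shows "summable (nome_tail w W p)" "norm (suminf (nome_tail w W p)) \<le> 96 * norm p"
proof -
  have g: "(\<lambda>k. 48 * norm p * norm p ^ k) sums (48 * norm p * (1 / (1 - norm p)))"
    using assms by (intro sums_mult geometric_sums) auto
  hence s: "summable (\<lambda>k. 48 * norm p * norm p ^ k)" by (rule sums_summable)
  have le: "\<And>k. norm (nome_tail w W p k) \<le> 48 * norm p * norm p ^ k"
    by (rule norm_nome_tail_le[OF assms])
  show "summable (nome_tail w W p)"
    by (rule summable_comparison_test'[OF s le])
  have "norm (suminf (nome_tail w W p)) \<le> (\<Sum>k. 48 * norm p * norm p ^ k)"
    by (rule norm_suminf_le[OF le s])
  also have "\<dots> = 48 * norm p * (1 / (1 - norm p))" using g by (rule sums_unique [symmetric])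
  also have "\<dots> \<le> 48 * norm p * 2"
    using assms by (intro mult_left_mono) (auto simp: field_simps)
  finally show "norm (suminf (nome_tail w W p)) \<le> 96 * norm p" by simp
qed

lemma isCont_csc2_exp: "t \<noteq> 1 \<Longrightarrow> isCont csc2_exp t"
  unfolding csc2_exp_def [abs_def] by (intro continuous_intros) auto

theorem weierstrass_p_nome_series:
  fixes z w1 w2 :: complex
  assumes w1: "w1 \<noteq> 0"
  defines "w \<equiv> exp (\<i> * of_real pi * z / w1)" and "p \<equiv> exp (2 * \<i> * of_real pi * w2 / w1)"
  assumes small: "norm w \<le> 1/2" "norm (p / w) \<le> 1/2"
  shows "weierstrass_p z w1 w2 = (of_real pi / (2 * w1))\<^sup>2 *
     (- 1/3 + csc2_exp w + csc2_exp (p / w) + suminf (nome_tail w (p / w) p))"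
proof -
  define \<zeta> where "\<zeta> = z / (2 * w1)"
  define \<tau> where "\<tau> = w2 / w1"
  define W where "W = p / w"
  have w: "w \<noteq> 0" and W: "W \<noteq> 0" and p: "p \<noteq> 0" "p = w * W"
    by (auto simp: w_def p_def W_def)
  have we: "w = exp (2 * \<i> * (of_real pi * \<zeta>))" and pe: "p = exp (2 * \<i> * (of_real pi * \<tau>))"
    by (simp_all add: w_def p_def \<zeta>_def \<tau>_def field_simps)
  have "norm p \<le> 1/2 * (1/2)"
    unfolding p(2) norm_mult using small by (intro mult_mono) (auto simp: W_def)
  hence p12: "norm p \<le> 1/2" "norm p < 1" by auto
  have "norm p = exp (- 2 * pi * Im \<tau>)" unfolding pe by (simp add: norm_exp_eq_Re)
  hence \<tau>: "Im \<tau> > 0" using p12 by (simp add: zero_less_mult_iff)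
  have csc: "(of_real pi / sin (of_real pi * y))\<^sup>2 = (of_real pi)\<^sup>2 * csc2_exp (exp (2 * \<i> * (of_real pi * y)))" for y :: complex
    unfolding csc2_exp_eq [symmetric] by (simp add: power_divide)
  have wn: "exp (2 * \<i> * (of_real pi * (\<zeta> - of_int n * \<tau>))) = w * p powi (- n)"
    and pn: "exp (2 * \<i> * (of_real pi * (of_int n * \<tau>))) = p powi n" for n :: int
    by (simp_all add: we pe exp_power_int algebra_simps flip: exp_add)
  \<comment> \<open>If \<zeta> lay on row n, then w = p^n. For n <= 0 this reads w p^k = 1 with k =
    -n, for n >= 1 it reads W p^(n-1) = 1; both contradict the bound 1/2 on |w| and |W|.\<close>
  have \<zeta>: "\<zeta> - of_int n * \<tau> \<notin> \<int>" for n :: int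
  proof
    assume "\<zeta> - of_int n * \<tau> \<in> \<int>"
    hence "sin (of_real pi * (\<zeta> - of_int n * \<tau>)) = 0" using sin_pi_times_eq_0_iff by blast
    hence "(cos (of_real pi * (\<zeta> - of_int n * \<tau>)))\<^sup>2 = 1"
      using sin_cos_squared_add[of "of_real pi * (\<zeta> - of_int n * \<tau>)"] by simp
    hence one: "w * p powi (- n) = 1"
      unfolding wn [symmetric]
      using \<open>sin (of_real pi * (\<zeta> - of_int n * \<tau>)) = 0\<close>
      by (simp add: exp_Euler mult.assoc sin_double cos_double exp_double)
    show False
    proof (cases "n \<le> 0")
      case True
      define k where "k = nat (- n)"
      have "p powi (- n) = p ^ k" using True by (simp add: k_def power_int_def)
      hence "norm w * norm p ^ k = 1" using one by (metis norm_mult norm_one norm_power)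
      moreover have "norm w * norm p ^ k \<le> 1/2 * 1"
        using small p12 by (intro mult_mono power_le_one) auto
      ultimately show False by simp
    next
      case False
      define k where "k = nat (n - 1)"
      have "n = int (Suc k)" using False by (simp add: k_def)
      hence "p powi (- n) = inverse (p ^ Suc k)" by (simp add: power_int_minus del: power_Suc of_nat_Suc)
      hence "w = p ^ Suc k" using one p by (simp add: field_simps)
      hence "W * p ^ k = 1" using w by (simp add: W_def field_simps)
      hence "norm W * norm p ^ k = 1" by (metis norm_mult norm_one norm_power)
      moreover have "norm W * norm p ^ k \<le> 1/2 * 1"
        using small p12 by (intro mult_mono power_le_one) (auto simp: W_def)
      ultimately show False by simp
    qed
  qed
  define I where "I = infsum (\<lambda>(n::int, m::int). 1 / (\<zeta> - (of_int m + of_int n * \<tau>))\<^sup>2 - 1 / (of_int m + of_int n * \<tau>)\<^sup>2)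
       (UNIV - {(0, 0)})"
  define h where "h = (\<lambda>n::int. csc2_exp (w * p powi (- n)) - csc2_exp (p powi n))"
  have "((\<lambda>n. (of_real pi)\<^sup>2 * h n) has_sum (I + 1 / \<zeta>\<^sup>2 - (of_real pi)\<^sup>2 * csc2_exp w + (of_real pi)\<^sup>2 / 3)) (UNIV - {0})"
    using lattice_sum_by_rows[OF \<tau> \<zeta>] unfolding csc wn pn I_def [symmetric] we [symmetric] h_def
    by (simp only: right_diff_distrib[of "(of_real pi)\<^sup>2"])
  hence "((\<lambda>n. 1 / (of_real pi)\<^sup>2 * ((of_real pi)\<^sup>2 * h n)) has_sum
     (1 / (of_real pi)\<^sup>2 * (I + 1 / \<zeta>\<^sup>2 - (of_real pi)\<^sup>2 * csc2_exp w + (of_real pi)\<^sup>2 / 3))) (UNIV - {0})"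
    by (rule has_sum_cmult_right)
  moreover define H where "H = 1 / (of_real pi)\<^sup>2 * (I + 1 / \<zeta>\<^sup>2 - (of_real pi)\<^sup>2 * csc2_exp w + (of_real pi)\<^sup>2 / 3)"
  ultimately have H: "(h has_sum H) (UNIV - {0})" by simp
  have hs: "h summable_on (UNIV - {0})" using H by (auto simp: summable_on_def)
  define P where "P = range (\<lambda>k::nat. int (Suc k))"
  define N where "N = range (\<lambda>k::nat. - int (Suc k))"
  have "x \<in> P \<union> N" if "x \<noteq> 0" for x
  proof (cases "x > 0")
    case True
    thus ?thesis unfolding P_def by (intro UnI1 image_eqI[of _ _ "nat (x - 1)"]) auto
  next
    case False
    thus ?thesis using that unfolding N_def by (intro UnI2 image_eqI[of _ _ "nat (- 1 - x)"]) auto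
  qed
  hence PN: "UNIV - {0} = P \<union> N" "P \<inter> N = {}" by (auto simp: P_def N_def)
  obtain A B where A: "(h has_sum A) P" and B: "(h has_sum B) N"
    using summable_on_subset[OF hs, of P] summable_on_subset[OF hs, of N] PN
    by (auto simp: summable_on_def)
  have "H = A + B"
    using has_sum_unique[OF H] has_sum_Un_disjoint[OF A B PN(2)] PN(1) by simp
  have "((\<lambda>k. h (int (Suc k))) has_sum A) UNIV"
    using A unfolding P_def by (subst (asm) has_sum_reindex) (auto simp: inj_on_def o_def)
  hence "(\<lambda>k. h (int (Suc k))) sums A" by (rule has_sum_imp_sums)
  \<comment> \<open>From p = w W the argument w / p^(k+1) is the inverse of W p^k, which tends to
    0.\<close>
  also have "(\<lambda>k. h (int (Suc k))) = (\<lambda>k. csc2_exp (W * p ^ k) - csc2_exp (p ^ Suc k))"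
  proof
    fix k
    have "p ^ Suc k = w * (W * p ^ k)" using p(2) by (simp add: mult.assoc)
    hence "w * inverse (p ^ Suc k) = inverse (W * p ^ k)" using w by (simp del: power_Suc)
    thus "h (int (Suc k)) = csc2_exp (W * p ^ k) - csc2_exp (p ^ Suc k)"
      by (simp only: h_def csc2_exp_inverse power_int_minus power_int_of_nat)
  qed
  finally have A': "(\<lambda>k. csc2_exp (W * p ^ k) - csc2_exp (p ^ Suc k)) sums A" .
  \<comment> \<open>Telescoping replaces W p^k by W p^(k+1) at the cost of the single term
    \<open>csc2_exp W\<close>, because \<open>csc2_exp\<close> tends to 0 along W p^k.\<close>
  have "(\<lambda>k. W * p ^ k) \<longlonglongrightarrow> W * 0"
    using p12 by (intro tendsto_intros LIMSEQ_power_zero) auto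
  hence "(\<lambda>k. csc2_exp (W * p ^ k)) \<longlonglongrightarrow> csc2_exp 0"
    by (intro isCont_tendsto_compose[OF isCont_csc2_exp]) auto
  from telescope_sums'[OF this]
  have "(\<lambda>k. csc2_exp (W * p ^ k) - csc2_exp (W * p ^ Suc k)) sums (csc2_exp W)" by simp
  from sums_diff[OF A' this]
  have A'': "(\<lambda>k. csc2_exp (W * p ^ Suc k) - csc2_exp (p ^ Suc k)) sums (A - csc2_exp W)"
    by simp
  have "((\<lambda>k. h (- int (Suc k))) has_sum B) UNIV"
    using B unfolding N_def by (subst (asm) has_sum_reindex) (auto simp: inj_on_def o_def)
  hence "(\<lambda>k. h (- int (Suc k))) sums B" by (rule has_sum_imp_sums)
  also have "(\<lambda>k. h (- int (Suc k))) = (\<lambda>k. csc2_exp (w * p ^ Suc k) - csc2_exp (p ^ Suc k))"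
  proof
    fix k
    have "p powi (- int (Suc k)) = inverse (p ^ Suc k)" "p powi (- (- int (Suc k))) = p ^ Suc k"
      by (simp_all only: power_int_minus minus_minus power_int_of_nat)
    thus "h (- int (Suc k)) = csc2_exp (w * p ^ Suc k) - csc2_exp (p ^ Suc k)"
      by (simp only: h_def csc2_exp_inverse)
  qed
  finally have "(\<lambda>k. csc2_exp (w * p ^ Suc k) - csc2_exp (p ^ Suc k)) sums B" .
  from sums_add[OF this A'']
  have "nome_tail w W p sums (B + (A - csc2_exp W))"
    by (simp add: nome_tail_def [abs_def] algebra_simps)
  hence "H = csc2_exp W + suminf (nome_tail w W p)"
    using \<open>H = A + B\<close> by (simp add: sums_iff)
  hence "1 / \<zeta>\<^sup>2 + I = (of_real pi)\<^sup>2 * (- 1 / 3 + csc2_exp w + csc2_exp W + suminf (nome_tail w W p))"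
    unfolding H_def by (simp add: field_simps)
  thus ?thesis
    unfolding weierstrass_p_eq_lattice_sum[OF w1] \<zeta>_def [symmetric] \<tau>_def [symmetric]
      I_def [symmetric] W_def [symmetric]
    by (simp add: power_divide)
qed

section \<open>The hypergeometric half-periods near x = 0\<close>

definition hypF_coeff :: "nat \<Rightarrow> complex" where
  "hypF_coeff n = (pochhammer (1/2) n)\<^sup>2 / (fact n)\<^sup>2"

lemma norm_hypF_coeff_le: "norm (hypF_coeff n) \<le> 1"
proof -
  have "norm (pochhammer (1/2 :: complex) n) \<le> fact n"
  proof (induction n)
    case (Suc n)
    have "norm (1/2 + of_nat n :: complex) \<le> 1/2 + real n"
      using norm_triangle_ineq[of "1/2 :: complex" "of_nat n"] by simp
    also have "\<dots> \<le> real (Suc n)" by simp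
    finally have "norm (pochhammer (1/2 :: complex) n) * norm (1/2 + of_nat n :: complex)
        \<le> fact n * real (Suc n)"
      using Suc by (intro mult_mono) auto
    thus ?case by (simp add: pochhammer_Suc norm_mult mult.commute)
  qed auto
  hence "(norm (pochhammer (1/2 :: complex) n))\<^sup>2 \<le> (fact n)\<^sup>2" by (intro power_mono) auto
  thus ?thesis by (simp add: hypF_coeff_def norm_divide norm_power)
qed

text \<open>The recurrence of \<open>Digamma\<close> changes the difference by 1/z - 1/u, at most 2
  + 1 in modulus; the start value is -2 ln 2. Linear growth is crude but keeps the radius of
  convergence 1.\<close>

lemma norm_Digamma_diff_le:
  "norm (Digamma (of_nat n + 1/2) - Digamma (of_nat n + 1 :: complex)) \<le> 2 * ln 2 + 3 * real n"
proof (induction n)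
  case 0
  show ?case by (simp add: Digamma_one_half norm_mult)
next
  case (Suc n)
  define z :: complex where "z = of_nat n + 1/2"
  define u :: complex where "u = of_nat n + 1"
  have zr: "z = of_real (real n + 1/2)" and ur: "u = of_real (real n + 1)"
    by (simp_all add: z_def u_def)
  have z: "z \<noteq> 0" and u: "u \<noteq> 0" unfolding zr ur of_real_eq_0_iff by linarith+
  have nz: "norm (1 / z) \<le> 2" and nu: "norm (1 / u) \<le> 1"
    unfolding zr ur norm_divide norm_of_real by (auto simp: field_simps)
  have "Digamma (of_nat (Suc n) + 1/2) - Digamma (of_nat (Suc n) + 1 :: complex)
      = Digamma (z + 1) - Digamma (u + 1)" by (simp add: z_def u_def add_ac)
  also have "\<dots> = (Digamma z - Digamma u) + 1 / z - 1 / u"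
    by (simp add: Digamma_plus1 z u)
  also have "norm \<dots> \<le> norm (Digamma z - Digamma u) + norm (1 / z) + norm (1 / u)"
    by (intro norm_triangle_le_diff add_mono norm_triangle_ineq order_refl)
  also have "\<dots> \<le> 2 * ln 2 + 3 * real n + 2 + 1"
    using Suc nz nu unfolding z_def u_def by linarith
  finally show ?case by simp
qed

definition hypF1_coeff :: "nat \<Rightarrow> complex" where
  "hypF1_coeff n = hypF_coeff n * (2 * (Digamma (of_nat n + 1/2) - Digamma (of_nat n + 1)))"

lemma norm_hypF1_coeff_le: "norm (hypF1_coeff n) \<le> 4 + 6 * real n"
proof -
  have "norm (hypF1_coeff n) = norm (hypF_coeff n) * (2 * norm (Digamma (of_nat n + 1/2) - Digamma (of_nat n + 1 :: complex)))"
    unfolding hypF1_coeff_def norm_mult norm_numeral ..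
  also have "\<dots> \<le> 1 * (2 * (2 * ln 2 + 3 * real n))"
    using norm_hypF_coeff_le norm_Digamma_diff_le by (intro mult_mono mult_left_mono) auto
  also have "\<dots> \<le> 4 + 6 * real n" using ln_2_less_1 by simp
  finally show ?thesis .
qed

lemma sums_powser_linear_coeff:
  fixes a :: "nat \<Rightarrow> complex"
  assumes a: "\<And>n. norm (a n) \<le> A + B * real n" and x: "norm x < 1"
  shows "(\<lambda>n. a n * x ^ n) sums (\<Sum>n. a n * x ^ n)"
proof (rule summable_sums, rule summable_comparison_test')
  have "summable (\<lambda>n. A * norm x ^ n)" using x by (intro summable_mult summable_geometric) auto
  moreover have "summable (\<lambda>n. of_nat n * norm x ^ n)"
  proof (cases "x = 0")
    case False
    have "summable (\<lambda>n. norm x * (of_nat (Suc n) * norm x ^ n))"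
      using geometric_deriv_sums[of "norm x"] x by (intro summable_mult) (auto simp: sums_iff)
    hence "summable (\<lambda>n. of_nat (Suc n) * norm x ^ (Suc n))" by (simp add: mult_ac)
    thus ?thesis by (subst (asm) summable_Suc_iff)
  next
    case True
    have "(\<lambda>n. of_nat n * (0::real) ^ n) = (\<lambda>n. 0)" by (auto simp: fun_eq_iff power_0_left)
    thus ?thesis using True by simp
  qed
  hence "summable (\<lambda>n. B * (of_nat n * norm x ^ n))" by (rule summable_mult)
  ultimately show "summable (\<lambda>n. A * norm x ^ n + B * (of_nat n * norm x ^ n))"
    by (rule summable_add)
  show "norm (a n * x ^ n) \<le> A * norm x ^ n + B * (of_nat n * norm x ^ n)" for n
    using mult_right_mono[OF a[of n], of "norm x ^ n"] by (simp add: norm_mult norm_power algebra_simps)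
qed

lemma hypF_sums: "norm x < 1 \<Longrightarrow> (\<lambda>n. hypF_coeff n * x ^ n) sums hypF x"
  using sums_powser_linear_coeff[of hypF_coeff 1 0 x] norm_hypF_coeff_le
  by (simp add: hypF_def hypF_coeff_def)

lemma hypF1_sums: "norm x < 1 \<Longrightarrow> (\<lambda>n. hypF1_coeff n * x ^ n) sums hypF1 x"
  using sums_powser_linear_coeff[of hypF1_coeff 4 6 x] norm_hypF1_coeff_le
  by (simp add: hypF1_def hypF1_coeff_def hypF_coeff_def)

lemma holomorphic_on_hypF: "hypF holomorphic_on ball 0 1"
  by (rule power_series_holomorphic[where a = hypF_coeff]) (simp add: hypF_sums)

lemma holomorphic_on_hypF1: "hypF1 holomorphic_on ball 0 1"
  by (rule power_series_holomorphic[where a = hypF1_coeff]) (simp add: hypF1_sums)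

lemma hypF_0 [simp]: "hypF 0 = 1"
  using hypF_sums[of 0] powser_sums_zero[of hypF_coeff] sums_unique2
  by (fastforce simp: hypF_coeff_def)

text \<open>Origin of the number 16 in the monomials: the constant coefficient is twice the
  difference -2 ln 2 of the \<open>Digamma\<close> values at 1/2 and 1.\<close>

lemma hypF1_0: "hypF1 0 = - of_real (ln 16)"
proof -
  have "hypF1 0 = hypF1_coeff 0"
    using hypF1_sums[of 0] powser_sums_zero[of hypF1_coeff] sums_unique2 by fastforce
  also have "\<dots> = - of_real (4 * ln 2)"
    by (simp add: hypF1_coeff_def hypF_coeff_def Digamma_one_half)
  also have "4 * ln 2 = ln (2 ^ 4 :: real)" by (subst ln_realpow) auto
  finally show ?thesis by simp
qed

text \<open>The value 1/4 produces the leading coefficient 1/2 of x: in (1 + x)/3 - 1/(3 F^2) the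
  linear coefficient is 1/3 + (2/3)(1/4).\<close>

lemma deriv_hypF_0: "deriv hypF 0 = 1/4"
proof -
  have "(hypF has_field_derivative hypF_coeff 1) (at 0)"
  proof -
    have "((\<lambda>x. \<Sum>n. hypF_coeff n * x ^ n) has_field_derivative (\<Sum>n. diffs hypF_coeff n * 0 ^ n)) (at 0)"
    proof (rule termdiffs_strong')
      show "\<And>z. norm z < 1 \<Longrightarrow> summable (\<lambda>n. hypF_coeff n * z ^ n)"
        using hypF_sums by (blast intro: sums_summable)
    qed auto
    moreover have "(\<Sum>n. diffs hypF_coeff n * 0 ^ n) = diffs hypF_coeff 0"
      by (rule powser_zero)
    ultimately show ?thesis by (simp add: diffs_def hypF_def [abs_def] hypF_coeff_def)
  qed
  thus ?thesis by (simp add: DERIV_imp_deriv hypF_coeff_def power2_eq_square)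
qed

lemma holomorphic_first_order_bound:
  assumes f: "f holomorphic_on ball 0 R" and "f 0 = 0" and "r < R"
  obtains K where "K \<ge> 0" "\<And>x. norm x \<le> r \<Longrightarrow> norm (f x) \<le> K * norm x"
proof -
  have "continuous_on (cball 0 r) (deriv f)"
    by (rule holomorphic_on_imp_continuous_on, rule holomorphic_on_subset[OF holomorphic_deriv[OF f]])
      (use assms in auto)
  hence "bounded (deriv f ` cball 0 r)"
    by (intro compact_imp_bounded compact_continuous_image) auto
  then obtain K where "\<forall>y\<in>deriv f ` cball 0 r. norm y \<le> K"
    unfolding bounded_iff by blast
  hence K: "norm (deriv f x) \<le> K" if "norm x \<le> r" for x using that by simp
  show ?thesis
  proof
    show "0 \<le> max K 0" by simp
    fix x :: complex assume x: "norm x \<le> r"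
    have "norm (f x - f 0) \<le> max K 0 * norm (x - 0)"
    proof (rule field_differentiable_bound)
      show "convex (cball (0::complex) r)" by simp
      show "(f has_field_derivative deriv f z) (at z within cball 0 r)" if "z \<in> cball 0 r" for z
        by (rule has_field_derivative_at_within, rule holomorphic_derivI[OF f]) (use that assms in auto)
      show "norm (deriv f z) \<le> max K 0" if "z \<in> cball 0 r" for z
        using K[of z] that by auto
      show "0 \<in> cball (0::complex) r" using x order_trans[OF norm_ge_zero x] by simp
    qed (use x in auto)
    thus "norm (f x) \<le> max K 0 * norm x" using assms by simp
  qed
qed

text \<open>The mean value inequality on the disc of radius |x|, where the first-order bound makes
  the derivative O(|x|).\<close>

lemma holomorphic_second_order_bound:
  assumes f: "f holomorphic_on ball 0 R" and "f 0 = 0" "deriv f 0 = 0" and "r < R"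
  obtains K where "K \<ge> 0" "\<And>x. norm x \<le> r \<Longrightarrow> norm (f x) \<le> K * (norm x)\<^sup>2"
proof -
  obtain K where K: "K \<ge> 0" "\<And>x. norm x \<le> r \<Longrightarrow> norm (deriv f x) \<le> K * norm x"
    using holomorphic_first_order_bound[OF holomorphic_deriv[OF f]] assms by auto
  show ?thesis
  proof
    show "0 \<le> K" by fact
    fix x :: complex assume x: "norm x \<le> r"
    have "norm (f x - f 0) \<le> (K * norm x) * norm (x - 0)"
    proof (rule field_differentiable_bound)
      show "convex (cball (0::complex) (norm x))" by simp
      show "(f has_field_derivative deriv f z) (at z within cball 0 (norm x))" if "z \<in> cball 0 (norm x)" for z
        by (rule has_field_derivative_at_within, rule holomorphic_derivI[OF f]) (use that assms x in auto)
      show "norm (deriv f z) \<le> K * norm x" if "z \<in> cball 0 (norm x)" for z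
        using order_trans[OF K(2)[of z] mult_left_mono[OF _ K(1)], of "norm x"] that x by auto
    qed auto
    thus "norm (f x) \<le> K * (norm x)\<^sup>2" using assms by (simp add: power2_eq_square mult.assoc)
  qed
qed

text \<open>The holomorphic correction in the logarithm of the nome: i pi omega2 / omega1 = ln x -
  ln 16 + \<open>nome_rho x\<close>. Adding ln 16 makes it vanish at x = 0.\<close>

definition nome_rho :: "complex \<Rightarrow> complex" where
  "nome_rho x = hypF1 x / hypF x + of_real (ln 16)"

text \<open>The last assumption concerns the part of y free of w and W: the constant -1/3 of the
  nome series, scaled by 1/F^2, and (1 + x)/3 together leave x/2 up to second order.\<close>

locale hyp_bounds =
  fixes R K :: real
  assumes R: "0 < R" "R \<le> 1" and K: "0 \<le> K"
    and hypF_nonzero: "\<And>x. norm x < R \<Longrightarrow> hypF x \<noteq> 0"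
    and inverse_hypF: "\<And>x. norm x < R \<Longrightarrow> norm (1 / hypF x - 1) \<le> K * norm x"
    and rho_le: "\<And>x. norm x < R \<Longrightarrow> norm (nome_rho x) \<le> K * norm x"
    and const_term: "\<And>x. norm x < R \<Longrightarrow>
      norm ((1 + x) / 3 - 1 / (3 * (hypF x)\<^sup>2) - x / 2) \<le> K * (norm x)\<^sup>2"
begin

lemma holomorphic_hypF: "hypF holomorphic_on ball 0 R"
  using holomorphic_on_hypF by (rule holomorphic_on_subset) (use R in auto)

lemma holomorphic_rho: "nome_rho holomorphic_on ball 0 R"
  unfolding nome_rho_def
  by (intro holomorphic_intros holomorphic_hypF holomorphic_on_subset[OF holomorphic_on_hypF1])
    (use R hypF_nonzero in auto)

end

lemma hyp_bounds_exist: "\<exists>R K. hyp_bounds R K"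
proof -
  have "continuous_on (ball 0 1) hypF"
    by (rule holomorphic_on_imp_continuous_on[OF holomorphic_on_hypF])
  hence "isCont hypF 0" by (simp add: continuous_on_eq_continuous_at)
  from continuous_at_avoid[OF this, of 0]
  obtain e where e: "e > 0" "\<And>x. norm x < e \<Longrightarrow> hypF x \<noteq> 0"
    by (auto simp: dist_norm)
  define R where "R = min e 1"
  have R: "R > 0" "R \<le> 1" "\<And>x. norm x < R \<Longrightarrow> hypF x \<noteq> 0" using e by (auto simp: R_def)
  have hF: "hypF holomorphic_on ball 0 R" and hF1: "hypF1 holomorphic_on ball 0 R"
    by (rule holomorphic_on_subset[OF holomorphic_on_hypF], use R in force,
        rule holomorphic_on_subset[OF holomorphic_on_hypF1], use R in force)
  have h1: "(\<lambda>x. 1 / hypF x - 1) holomorphic_on ball 0 R"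
    by (intro holomorphic_intros hF) (use R in auto)
  have h2: "nome_rho holomorphic_on ball 0 R"
    unfolding nome_rho_def by (intro holomorphic_intros hF hF1) (use R in auto)
  have h3: "(\<lambda>x. (1 + x) / 3 - 1 / (3 * (hypF x)\<^sup>2) - x / 2) holomorphic_on ball 0 R"
    by (intro holomorphic_intros hF) (use R in auto)
  have "(hypF has_field_derivative 1/4) (at 0)"
    using holomorphic_derivI[OF hF, of 0] R(1) deriv_hypF_0 by simp
  hence "((\<lambda>x. (1 + x) / 3 - 1 / (3 * (hypF x)\<^sup>2) - x / 2) has_field_derivative 0) (at 0)"
    by (auto intro!: derivative_eq_intros)
  hence d3: "deriv (\<lambda>x. (1 + x) / 3 - 1 / (3 * (hypF x)\<^sup>2) - x / 2) 0 = 0"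
    by (rule DERIV_imp_deriv)
  \<comment> \<open>The bounds need a closed disc strictly inside the disc of holomorphy.\<close>
  have half: "R / 2 < R" using R by simp
  obtain K1 where K1: "K1 \<ge> 0" "\<And>x. norm x \<le> R / 2 \<Longrightarrow> norm (1 / hypF x - 1) \<le> K1 * norm x"
    using holomorphic_first_order_bound[OF h1 _ half] by auto
  obtain K2 where K2: "K2 \<ge> 0" "\<And>x. norm x \<le> R / 2 \<Longrightarrow> norm (nome_rho x) \<le> K2 * norm x"
    using holomorphic_first_order_bound[OF h2 _ half] by (auto simp: nome_rho_def hypF1_0)
  obtain K3 where K3: "K3 \<ge> 0" "\<And>x. norm x \<le> R / 2 \<Longrightarrow>
      norm ((1 + x) / 3 - 1 / (3 * (hypF x)\<^sup>2) - x / 2) \<le> K3 * (norm x)\<^sup>2"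
    using holomorphic_second_order_bound[OF h3 _ d3 half] by auto
  define K where "K = K1 + K2 + K3"
  have "hyp_bounds (R / 2) K"
  proof
    fix x :: complex assume x: "norm x < R / 2"
    show "hypF x \<noteq> 0" using x R by auto
    show "norm (1 / hypF x - 1) \<le> K * norm x"
      using K1 K2 K3 x by (intro order_trans[OF K1(2)] mult_right_mono) (auto simp: K_def)
    show "norm (nome_rho x) \<le> K * norm x"
      using K1 K2 K3 x by (intro order_trans[OF K2(2)] mult_right_mono) (auto simp: K_def)
    show "norm ((1 + x) / 3 - 1 / (3 * (hypF x)\<^sup>2) - x / 2) \<le> K * (norm x)\<^sup>2"
      using K1 K2 K3 x by (intro order_trans[OF K3(2)] mult_right_mono) (auto simp: K_def)
  qed (use R K1 K2 K3 in \<open>auto simp: K_def\<close>)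
  thus ?thesis by blast
qed

section \<open>The solution in terms of the nome variables\<close>

lemma norm_exp_minus_1_le:
  fixes t :: complex
  assumes "norm t \<le> 1/2"
  shows "norm (exp t - 1) \<le> 2 * norm t"
proof -
  have "norm (exp t - exp 0) \<le> 2 * norm (t - 0)"
  proof (rule field_differentiable_bound)
    show "convex (cball (0::complex) (norm t))" by simp
    show "(exp has_field_derivative exp z) (at z within cball 0 (norm t))" for z :: complex
      by (rule has_field_derivative_at_within[OF DERIV_exp])
    show "norm (exp z) \<le> 2" if "z \<in> cball 0 (norm t)" for z
      using that assms exp_bound_lemma[of z] by simp
  qed auto
  thus ?thesis by simp
qed

section \<open>The monomials in exponential form\<close>

lemma powr_16: "16 powr a = exp (a * complex_of_real (ln 16))"
proof -
  have "Ln 16 = complex_of_real (ln 16)" using Ln_of_real[of 16] by simp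
  thus ?thesis by (simp add: powr_def)
qed

lemma monC_exp: "monC \<nu>1 \<nu>2 s = exp (\<i> * of_real pi * \<nu>1 + \<nu>2 * (s - of_real (ln 16)))"
  by (simp add: monC_def xpow_def powr_16 exp_add exp_diff right_diff_distrib)

lemma monB_exp: "monB \<nu>1 \<nu>2 s = exp (- \<i> * of_real pi * \<nu>1 + (2 - \<nu>2) * (s - of_real (ln 16)))"
  unfolding monB_def xpow_def powr_16 exp_diff[symmetric] exp_add[symmetric]
  by (rule arg_cong[where f = exp]) (simp add: algebra_simps)

lemma monB_neq_0 [simp]: "monB \<nu>1 \<nu>2 s \<noteq> 0" and monC_neq_0 [simp]: "monC \<nu>1 \<nu>2 s \<noteq> 0"
  by (simp_all add: monB_exp monC_exp)

lemma exp_ln_16: "exp (complex_of_real (ln 16)) = 16"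
  by (simp add: exp_of_real)

text \<open>The exponents \<open>\<nu>2\<close> and \<open>2 - \<nu>2\<close> add up to 2 and
  \<open>\<nu>1\<close> cancels, which leaves (x/16)^2, the leading part of p. In particular a
  monomial of constant modulus forces the other one to be O(x^2).\<close>

lemma monB_mult_monC: "monB \<nu>1 \<nu>2 s * monC \<nu>1 \<nu>2 s = (exp s)\<^sup>2 / 256"
proof -
  have "monB \<nu>1 \<nu>2 s * monC \<nu>1 \<nu>2 s = (exp (s - of_real (ln 16)))\<^sup>2"
    unfolding monB_exp monC_exp exp_add[symmetric] power2_eq_square
    by (rule arg_cong[where f = exp]) (simp add: algebra_simps)
  thus ?thesis by (simp add: exp_diff exp_ln_16 power_divide)
qed

text \<open>The quantity multiplied by M in the bound for v; it is the single small parameter of the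
  interior estimates.\<close>

definition size_N :: "complex \<Rightarrow> complex \<Rightarrow> complex \<Rightarrow> real" where
  "size_N \<nu>1 \<nu>2 s = norm (exp s) + norm (monB \<nu>1 \<nu>2 s) + norm (monC \<nu>1 \<nu>2 s)"

lemma size_N_bounds:
  "norm (exp s) \<le> size_N \<nu>1 \<nu>2 s" "norm (monB \<nu>1 \<nu>2 s) \<le> size_N \<nu>1 \<nu>2 s"
  "norm (monC \<nu>1 \<nu>2 s) \<le> size_N \<nu>1 \<nu>2 s" "0 \<le> size_N \<nu>1 \<nu>2 s"
  unfolding size_N_def by (auto intro: add_nonneg_nonneg)

lemma term2_eq: "term2 \<nu>1 \<nu>2 s = - 4 * monC \<nu>1 \<nu>2 s"
proof -
  have "16 powr \<nu>2 = 16 * 16 powr (\<nu>2 - 1)"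
    by (simp add: powr_16 left_diff_distrib exp_diff exp_ln_16)
  thus ?thesis by (simp add: term2_def coefA_def monC_def)
qed

lemma term3_eq: "term3 \<nu>1 \<nu>2 s = - 4 * monB \<nu>1 \<nu>2 s"
proof -
  have "16 powr (\<nu>2 - 1) = 16 / 16 powr (2 - \<nu>2)"
    by (simp add: powr_16 left_diff_distrib exp_diff exp_ln_16 field_simps flip: exp_of_nat_mult exp_double)
      (simp add: exp_double exp_ln_16 power2_eq_square)
  thus ?thesis by (simp add: term3_def coefA_def monB_def exp_minus field_simps)
qed

lemma lead1_eq: "lead1 \<nu>1 \<nu>2 s = exp s / 2 - 4 * monC \<nu>1 \<nu>2 s - 4 * monB \<nu>1 \<nu>2 s"
  by (simp add: lead1_def term1_def term2_eq term3_eq)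

text \<open>\<open>nome_w\<close> is \<open>exp (\<i> \<pi> z / \<omega>1)\<close> at the argument \<open>z\<close> of the elliptic function, and \<open>nome_W\<close> is the
  same quantity at \<open>2 \<omega>2 - z\<close>; the argument \<open>u\<close> stands for the value \<open>v s\<close>.\<close>

definition nome_w :: "complex \<Rightarrow> complex \<Rightarrow> complex \<Rightarrow> complex \<Rightarrow> complex" where
  "nome_w \<nu>1 \<nu>2 u s = monC \<nu>1 \<nu>2 s * exp (\<nu>2 * nome_rho (exp s) + 2 * \<i> * u / hypF (exp s))"

definition nome_W :: "complex \<Rightarrow> complex \<Rightarrow> complex \<Rightarrow> complex \<Rightarrow> complex" where
  "nome_W \<nu>1 \<nu>2 u s = monB \<nu>1 \<nu>2 s * exp ((2 - \<nu>2) * nome_rho (exp s) - 2 * \<i> * u / hypF (exp s))"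

lemma nome_w_mult_nome_W:
  "nome_w \<nu>1 \<nu>2 u s * nome_W \<nu>1 \<nu>2 u s = (exp s)\<^sup>2 / 256 * exp (2 * nome_rho (exp s))"
proof -
  have "nome_w \<nu>1 \<nu>2 u s * nome_W \<nu>1 \<nu>2 u s = (monB \<nu>1 \<nu>2 s * monC \<nu>1 \<nu>2 s) *
      exp (\<nu>2 * nome_rho (exp s) + 2 * \<i> * u / hypF (exp s) + ((2 - \<nu>2) * nome_rho (exp s) - 2 * \<i> * u / hypF (exp s)))"
    unfolding nome_w_def nome_W_def exp_add[of "_ + _"] by (simp only: mult_ac)
  thus ?thesis unfolding monB_mult_monC by (simp add: algebra_simps)
qed

text \<open>Dividing by omega1 = pi F/2 turns the half-period ratio into ln x - ln 16 +
  \<open>nome_rho\<close>, up to the factor i pi, and u into 2 i u / F. As u enters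
  \<open>nome_w\<close> and \<open>nome_W\<close> with opposite signs, it drops out of p.\<close>

lemma half_period_exponentials:
  fixes s \<nu>1 \<nu>2 u :: complex
  assumes F: "hypF (exp s) \<noteq> 0"
  shows "exp (\<i> * of_real pi * (\<nu>1 * omega1 s + \<nu>2 * omega2 s + u) / omega1 s) = nome_w \<nu>1 \<nu>2 u s"
    and "exp (2 * \<i> * of_real pi * omega2 s / omega1 s) = nome_w \<nu>1 \<nu>2 u s * nome_W \<nu>1 \<nu>2 u s"
    and "omega1 s \<noteq> 0"
proof -
  show o1: "omega1 s \<noteq> 0" using F by (simp add: omega1_def)
  have tau: "\<i> * of_real pi * omega2 s / omega1 s = s - of_real (ln 16) + nome_rho (exp s)"
    using F by (simp add: omega1_def omega2_def nome_rho_def field_simps)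
  have "\<i> * of_real pi * (\<nu>1 * omega1 s + \<nu>2 * omega2 s + u) / omega1 s
      = \<i> * of_real pi * \<nu>1 + \<nu>2 * (\<i> * of_real pi * omega2 s / omega1 s) + \<i> * of_real pi * u / omega1 s"
    using o1 by (simp add: field_simps)
  also have "\<i> * of_real pi * u / omega1 s = 2 * \<i> * u / hypF (exp s)"
    using F by (simp add: omega1_def field_simps)
  finally have "\<i> * of_real pi * (\<nu>1 * omega1 s + \<nu>2 * omega2 s + u) / omega1 s
     = (\<i> * of_real pi * \<nu>1 + \<nu>2 * (s - of_real (ln 16))) + (\<nu>2 * nome_rho (exp s) + 2 * \<i> * u / hypF (exp s))"
    unfolding tau by (simp add: algebra_simps)
  thus "exp (\<i> * of_real pi * (\<nu>1 * omega1 s + \<nu>2 * omega2 s + u) / omega1 s) = nome_w \<nu>1 \<nu>2 u s"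
    unfolding nome_w_def monC_exp exp_add[symmetric] by simp
  have "2 * \<i> * of_real pi * omega2 s / omega1 s = 2 * (\<i> * of_real pi * omega2 s / omega1 s)"
    by (simp add: mult.assoc)
  also have "\<dots> = 2 * (s - of_real (ln 16)) + 2 * nome_rho (exp s)"
    unfolding tau by (simp add: algebra_simps)
  finally have "exp (2 * \<i> * of_real pi * omega2 s / omega1 s)
     = (exp (s - of_real (ln 16)))\<^sup>2 * exp (2 * nome_rho (exp s))"
    by (simp only: exp_add exp_double)
  thus "exp (2 * \<i> * of_real pi * omega2 s / omega1 s) = nome_w \<nu>1 \<nu>2 u s * nome_W \<nu>1 \<nu>2 u s"
    unfolding nome_w_mult_nome_W by (simp add: exp_diff exp_ln_16 power_divide)
qed

context hyp_bounds
begin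

lemma ellip_y_nome_series:
  assumes x: "norm (exp s) < R"
    and small: "norm (nome_w \<nu>1 \<nu>2 (v s) s) \<le> 1/2" "norm (nome_W \<nu>1 \<nu>2 (v s) s) \<le> 1/2"
  shows "ellip_y \<nu>1 \<nu>2 v s = (1 / hypF (exp s))\<^sup>2 *
     (- 1/3 + csc2_exp (nome_w \<nu>1 \<nu>2 (v s) s) + csc2_exp (nome_W \<nu>1 \<nu>2 (v s) s)
       + suminf (nome_tail (nome_w \<nu>1 \<nu>2 (v s) s) (nome_W \<nu>1 \<nu>2 (v s) s)
           (nome_w \<nu>1 \<nu>2 (v s) s * nome_W \<nu>1 \<nu>2 (v s) s))) + (1 + exp s) / 3"
proof -
  define w where "w = nome_w \<nu>1 \<nu>2 (v s) s"
  define W where "W = nome_W \<nu>1 \<nu>2 (v s) s"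
  have F: "hypF (exp s) \<noteq> 0" using hypF_nonzero x by simp
  have "w \<noteq> 0" by (simp add: w_def nome_w_def)
  hence WW: "w * W / w = W" by simp
  note e = half_period_exponentials(1,2)[OF F, of \<nu>1 \<nu>2 "v s", folded w_def W_def]
    half_period_exponentials(3)[OF F]
  have pi: "of_real pi / (2 * omega1 s) = 1 / hypF (exp s)"
    using F by (simp add: omega1_def)
  from weierstrass_p_nome_series[OF e(3), of "\<nu>1 * omega1 s + \<nu>2 * omega2 s + v s" "omega2 s",
      unfolded e(1) e(2) WW pi] small
  show ?thesis unfolding ellip_y_def w_def [symmetric] W_def [symmetric] by simp
qed

text \<open>One summand per source of error: the part free of w and W; the factor 1/F^2 - 1 before
  the two cosecant terms, with 16 from the bound on \<open>csc2_exp\<close>; the tail, with 96 from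
  the sum of the series and exp (2 K) from p = O(x^2).\<close>

definition est_const :: real where
  "est_const = K + 16 * K * (2 + K) + 96 * (1 + K)\<^sup>2 * exp (2 * K)"

lemma est_const_nonneg: "0 \<le> est_const"
  using K by (simp add: est_const_def)

lemma norm_inverse_hypF_le: "norm x < R \<Longrightarrow> norm (1 / hypF x) \<le> 1 + K"
proof -
  assume x: "norm x < R"
  have "norm (1 / hypF x) \<le> 1 + norm (1 / hypF x - 1)"
    using norm_triangle_ineq[of 1 "1 / hypF x - 1"] by simp
  also have "\<dots> \<le> 1 + K * norm x" using inverse_hypF[OF x] by simp
  also have "\<dots> \<le> 1 + K * 1" using K x R by (intro add_left_mono mult_left_mono) auto
  finally show ?thesis by simp
qed

text \<open>The factor |x| in front matters on the boundary spirals, where w or W does not tend to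
  0. For the tail it comes from p = w W = O(x^2), for the cosecant terms from 1/F^2 - 1 =
  O(x).\<close>

lemma ellip_y_estimate:
  assumes x: "norm (exp s) < R"
    and small: "norm (nome_w \<nu>1 \<nu>2 (v s) s) \<le> 1/2" "norm (nome_W \<nu>1 \<nu>2 (v s) s) \<le> 1/2"
  shows "norm (ellip_y \<nu>1 \<nu>2 v s - (exp s / 2 + csc2_exp (nome_w \<nu>1 \<nu>2 (v s) s) + csc2_exp (nome_W \<nu>1 \<nu>2 (v s) s)))
     \<le> est_const * norm (exp s) * (norm (exp s) + norm (nome_w \<nu>1 \<nu>2 (v s) s) + norm (nome_W \<nu>1 \<nu>2 (v s) s))"
proof -
  define w where "w = nome_w \<nu>1 \<nu>2 (v s) s"
  define W where "W = nome_W \<nu>1 \<nu>2 (v s) s"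
  define x where "x = exp s"
  define f where "f = 1 / hypF x"
  define T where "T = suminf (nome_tail w W (w * W))"
  have xR: "norm x < R" using assms by (simp add: x_def)
  have x1: "norm x \<le> 1" using xR R by simp
  have w: "norm w \<le> 1/2" and W: "norm W \<le> 1/2" using small by (simp_all add: w_def W_def)
  have f1: "norm (f - 1) \<le> K * norm x" using inverse_hypF[OF xR] by (simp add: f_def)
  have f2: "norm f \<le> 1 + K" using norm_inverse_hypF_le[OF xR] by (simp add: f_def)
  have ff: "norm (f\<^sup>2 - 1) \<le> K * norm x * (2 + K)"
  proof -
    have "f\<^sup>2 - 1 = (f - 1) * (f + 1)" by (simp add: power2_eq_square algebra_simps)
    moreover have "norm (f + 1) \<le> 2 + K" using norm_triangle_ineq[of f 1] f2 by simp
    ultimately show ?thesis using f1 K by (simp add: norm_mult mult_mono)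
  qed
  have p: "norm (w * W) \<le> exp (2 * K) * (norm x)\<^sup>2"
  proof -
    have "norm (exp (2 * nome_rho x)) \<le> exp (norm (2 * nome_rho x))" by (rule norm_exp)
    also have "norm (2 * nome_rho x) \<le> 2 * (K * norm x)"
      using rho_le[OF xR] by (simp add: norm_mult)
    also have "2 * (K * norm x) \<le> 2 * K" using K x1 mult_left_mono[of "norm x" 1 K] by simp
    finally have "norm (exp (2 * nome_rho x)) \<le> exp (2 * K)" by simp
    moreover have "norm (w * W) = (norm x)\<^sup>2 / 256 * norm (exp (2 * nome_rho x))"
      unfolding w_def W_def nome_w_mult_nome_W by (simp add: norm_mult norm_divide norm_power x_def)
    ultimately have "norm (w * W) \<le> (norm x)\<^sup>2 / 256 * exp (2 * K)"
      by (simp add: mult_left_mono)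
    also have "\<dots> \<le> exp (2 * K) * (norm x)\<^sup>2" by simp
    finally show ?thesis .
  qed
  have "norm w * norm W \<le> 1/2 * 1" using w W by (intro mult_mono) auto
  hence T: "norm T \<le> 96 * norm (w * W)"
    unfolding T_def by (intro summable_nome_tail w W) (simp add: norm_mult)
  have y: "ellip_y \<nu>1 \<nu>2 v s = f\<^sup>2 * (- 1/3 + csc2_exp w + csc2_exp W + T) + (1 + x) / 3"
    using ellip_y_nome_series[of s \<nu>1 \<nu>2 v, OF assms] by (simp add: w_def W_def x_def f_def T_def)
  have F2: "1 / (3 * (hypF x)\<^sup>2) = f\<^sup>2 / 3" by (simp add: f_def power_divide)
  have "ellip_y \<nu>1 \<nu>2 v s - (x / 2 + csc2_exp w + csc2_exp W)
     = ((1 + x) / 3 - 1 / (3 * (hypF x)\<^sup>2) - x / 2) + (f\<^sup>2 - 1) * (csc2_exp w + csc2_exp W) + f\<^sup>2 * T"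
    unfolding y F2 by (simp add: algebra_simps)
  also have "norm \<dots> \<le> norm ((1 + x) / 3 - 1 / (3 * (hypF x)\<^sup>2) - x / 2)
      + norm ((f\<^sup>2 - 1) * (csc2_exp w + csc2_exp W)) + norm (f\<^sup>2 * T)"
    by (intro order_trans[OF norm_triangle_ineq] add_right_mono norm_triangle_ineq)
  also have "\<dots> \<le> K * (norm x)\<^sup>2 + (K * norm x * (2 + K)) * (16 * norm w + 16 * norm W)
      + (1 + K)\<^sup>2 * (96 * (exp (2 * K) * (norm x)\<^sup>2))"
  proof (intro add_mono)
    show "norm ((1 + x) / 3 - 1 / (3 * (hypF x)\<^sup>2) - x / 2) \<le> K * (norm x)\<^sup>2"
      by (rule const_term[OF xR])
    have "norm (csc2_exp w + csc2_exp W) \<le> 16 * norm w + 16 * norm W"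
      by (rule order_trans[OF norm_triangle_ineq add_mono]) (intro norm_csc2_exp_le w W)+
    thus "norm ((f\<^sup>2 - 1) * (csc2_exp w + csc2_exp W)) \<le> (K * norm x * (2 + K)) * (16 * norm w + 16 * norm W)"
      unfolding norm_mult using ff by (intro mult_mono) (use K in auto)
    show "norm (f\<^sup>2 * T) \<le> (1 + K)\<^sup>2 * (96 * (exp (2 * K) * (norm x)\<^sup>2))"
      unfolding norm_mult norm_power using f2 order_trans[OF T mult_left_mono[OF p]]
      by (intro mult_mono power_mono) auto
  qed
  also have "\<dots> \<le> est_const * norm x * (norm x + norm w + norm W)"
  proof -
    define c where "c = 96 * (1 + K)\<^sup>2 * exp (2 * K)"
    have c: "c \<ge> 0" by (simp add: c_def)
    have E: "est_const = K + 16 * K * (2 + K) + c" by (simp add: est_const_def c_def)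
    have "est_const * norm x * (norm x + norm w + norm W)
      - (K * (norm x)\<^sup>2 + (K * norm x * (2 + K)) * (16 * norm w + 16 * norm W) + c * (norm x)\<^sup>2)
      = 16 * K * (2 + K) * norm x * norm x + (K + c) * norm x * (norm w + norm W)"
      unfolding E by (simp add: power2_eq_square algebra_simps)
    also have "\<dots> \<ge> 0" using K c by (intro add_nonneg_nonneg mult_nonneg_nonneg) auto
    finally show ?thesis by (simp add: c_def mult_ac)
  qed
  finally show ?thesis by (simp add: x_def w_def W_def)
qed

end

text \<open>The closeness assumption is about an arbitrary value u instead of \<open>v s\<close>,
  because \<open>r0\<close> has to be found before v is given. If |x|, |B|, |C| are below
  \<open>r0\<close>, then N < 3 \<open>r0\<close>; the bound 1/12 makes N < 1/4 and |w|, |W| at most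
  2/12 = 1/6.\<close>

locale small_regime = hyp_bounds +
  fixes \<nu>1 \<nu>2 :: complex and M r0 K2 :: real
  assumes r0: "0 < r0" "r0 \<le> 1/12" "r0 \<le> R" and K2: "0 \<le> K2"
    and nome_close: "\<And>s u. norm (exp s) < r0 \<Longrightarrow> size_N \<nu>1 \<nu>2 s < 3 * r0 \<Longrightarrow>
       norm u \<le> M * size_N \<nu>1 \<nu>2 s \<Longrightarrow>
       norm (nome_w \<nu>1 \<nu>2 u s - monC \<nu>1 \<nu>2 s) \<le> K2 * size_N \<nu>1 \<nu>2 s * norm (monC \<nu>1 \<nu>2 s) \<and>
       norm (nome_W \<nu>1 \<nu>2 u s - monB \<nu>1 \<nu>2 s) \<le> K2 * size_N \<nu>1 \<nu>2 s * norm (monB \<nu>1 \<nu>2 s) \<and>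
       norm (nome_w \<nu>1 \<nu>2 u s) \<le> 2 * norm (monC \<nu>1 \<nu>2 s) \<and>
       norm (nome_W \<nu>1 \<nu>2 u s) \<le> 2 * norm (monB \<nu>1 \<nu>2 s)"

lemma (in hyp_bounds) small_regime_exists:
  fixes M :: real
  shows "\<exists>r0 K2. small_regime R K \<nu>1 \<nu>2 M r0 K2"
proof -
  \<comment> \<open>The exponents in \<open>nome_w\<close> and \<open>nome_W\<close> will both have
    modulus at most k N. The choice of \<open>r0\<close> gives k N <= 1/2, where |exp t - 1| <= 2
    |t|; hence the witness 2 k for \<open>K2\<close>.\<close>
  define k where "k = (norm \<nu>2 + norm (2 - \<nu>2)) * K + 2 * \<bar>M\<bar> * (1 + K)"
  have k: "k \<ge> 0" using K by (simp add: k_def)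
  define r0 where "r0 = min R (min (1/12) (1 / (6 * (k + 1))))"
  have r0: "0 < r0" "r0 \<le> 1/12" "r0 \<le> R" "r0 \<le> 1 / (6 * (k + 1))"
    using R k by (auto simp: r0_def)
  have "small_regime R K \<nu>1 \<nu>2 M r0 (2 * k)"
  proof
    show "0 < r0" "r0 \<le> 1/12" "r0 \<le> R" "0 \<le> 2 * k" using r0 k by auto
    fix s u :: complex
    define N where "N = size_N \<nu>1 \<nu>2 s"
    assume x: "norm (exp s) < r0" and "size_N \<nu>1 \<nu>2 s < 3 * r0" and "norm u \<le> M * size_N \<nu>1 \<nu>2 s"
    hence N: "N < 3 * r0" and v: "norm u \<le> M * N" by (simp_all add: N_def)
    have N0: "0 \<le> N" "norm (exp s) \<le> N" using size_N_bounds by (simp_all add: N_def)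
    have kN: "k * N \<le> 1/2"
    proof -
      have "k * N \<le> (k + 1) * (3 * (1 / (6 * (k + 1))))"
        using k N N0 r0 by (intro mult_mono) auto
      also have "\<dots> = 1/2" using k by (simp add: field_simps)
      finally show ?thesis .
    qed
    have xR: "norm (exp s) < R" using x r0 by simp
    have rho: "norm (nome_rho (exp s)) \<le> K * N"
      using rho_le[OF xR] mult_left_mono[OF N0(2) K] by simp
    have "norm u \<le> \<bar>M\<bar> * N" using v N0 mult_right_mono[of M "\<bar>M\<bar>" N] by linarith
    hence u: "norm (2 * \<i> * u / hypF (exp s)) \<le> 2 * (\<bar>M\<bar> * N) * (1 + K)"
      using mult_mono[of "norm u" "\<bar>M\<bar> * N" "norm (1 / hypF (exp s))" "1 + K"]
        norm_inverse_hypF_le[OF xR] N0 K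
      by (simp add: norm_mult norm_divide)
    have th1: "norm (\<nu>2 * nome_rho (exp s) + 2 * \<i> * u / hypF (exp s)) \<le> k * N"
    proof -
      have "norm (\<nu>2 * nome_rho (exp s)) \<le> (norm \<nu>2 + norm (2 - \<nu>2)) * (K * N)"
        unfolding norm_mult using rho by (intro mult_mono) auto
      from norm_triangle_mono[OF this u] show ?thesis by (simp add: k_def algebra_simps)
    qed
    have th2: "norm ((2 - \<nu>2) * nome_rho (exp s) - 2 * \<i> * u / hypF (exp s)) \<le> k * N"
    proof -
      have "norm ((2 - \<nu>2) * nome_rho (exp s)) \<le> (norm \<nu>2 + norm (2 - \<nu>2)) * (K * N)"
        unfolding norm_mult using rho by (intro mult_mono) auto
      hence "norm ((2 - \<nu>2) * nome_rho (exp s)) + norm (2 * \<i> * u / hypF (exp s))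
         \<le> (norm \<nu>2 + norm (2 - \<nu>2)) * (K * N) + 2 * (\<bar>M\<bar> * N) * (1 + K)"
        using u by (rule add_mono)
      from order_trans[OF norm_triangle_ineq4 this] show ?thesis by (simp add: k_def algebra_simps)
    qed
    have gen: "norm (m * exp t - m) \<le> 2 * k * N * norm m \<and> norm (m * exp t) \<le> 2 * norm m"
      if "norm t \<le> k * N" for m t :: complex
    proof -
      have t: "norm (exp t - 1) \<le> 2 * (k * N)"
        using norm_exp_minus_1_le[of t] that kN by simp
      have "m * exp t - m = m * (exp t - 1)" by (simp add: algebra_simps)
      hence 1: "norm (m * exp t - m) \<le> norm m * (2 * (k * N))"
        using t by (simp add: norm_mult mult_left_mono)
      have "norm (exp t) \<le> 2" using norm_triangle_ineq[of "exp t - 1" 1] t kN by simp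
      hence "norm (m * exp t) \<le> norm m * 2" unfolding norm_mult by (intro mult_left_mono) auto
      with 1 show ?thesis by (simp add: mult_ac)
    qed
    show "norm (nome_w \<nu>1 \<nu>2 u s - monC \<nu>1 \<nu>2 s) \<le> 2 * k * size_N \<nu>1 \<nu>2 s * norm (monC \<nu>1 \<nu>2 s) \<and>
       norm (nome_W \<nu>1 \<nu>2 u s - monB \<nu>1 \<nu>2 s) \<le> 2 * k * size_N \<nu>1 \<nu>2 s * norm (monB \<nu>1 \<nu>2 s) \<and>
       norm (nome_w \<nu>1 \<nu>2 u s) \<le> 2 * norm (monC \<nu>1 \<nu>2 s) \<and>
       norm (nome_W \<nu>1 \<nu>2 u s) \<le> 2 * norm (monB \<nu>1 \<nu>2 s)"
      using gen[OF th1] gen[OF th2] unfolding nome_w_def nome_W_def N_def by blast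
  qed
  thus ?thesis by blast
qed

section \<open>Asymptotics along paths with power-law monomials\<close>

text \<open>Three errors add up: the remainder of the nome series (2 \<open>est_const\<close>),
  linearisation of the two cosecant terms (2 * 64 * 4 = 512), and replacing w and W by the monomials
  (2 * 4 \<open>K2\<close>).\<close>

lemma (in small_regime) ellip_y_near_lead1:
  assumes x: "norm (exp s) < r0" and N': "size_N \<nu>1 \<nu>2 s < 3 * r0" and v: "norm (v s) \<le> M * size_N \<nu>1 \<nu>2 s"
  shows "norm (ellip_y \<nu>1 \<nu>2 v s - lead1 \<nu>1 \<nu>2 s) \<le> (2 * est_const + 512 + 8 * K2) * (size_N \<nu>1 \<nu>2 s)\<^sup>2"
proof -
  define N where "N = size_N \<nu>1 \<nu>2 s"
  define w where "w = nome_w \<nu>1 \<nu>2 (v s) s"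
  define W where "W = nome_W \<nu>1 \<nu>2 (v s) s"
  define B where "B = monB \<nu>1 \<nu>2 s"
  define C where "C = monC \<nu>1 \<nu>2 s"
  note defs = N_def w_def W_def B_def C_def
  have NB: "norm (exp s) \<le> N" "norm B \<le> N" "norm C \<le> N" "0 \<le> N"
    using size_N_bounds by (auto simp: defs)
  have N: "N < 1/4" using N' r0 by (simp add: N_def)
  have e: "norm (w - C) \<le> K2 * N * norm C" "norm (W - B) \<le> K2 * N * norm B"
    "norm w \<le> 2 * norm C" "norm W \<le> 2 * norm B"
    using nome_close[OF x N' v] by (simp_all add: defs)
  have w: "norm w \<le> 1/2" "norm w \<le> 2 * N" and W: "norm W \<le> 1/2" "norm W \<le> 2 * N"
    using e NB N by linarith+
  have xR: "norm (exp s) < R" using x r0 by simp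
  have sq: "(norm t)\<^sup>2 \<le> 4 * N\<^sup>2" if "norm t \<le> 2 * N" for t :: complex
    using power_mono[OF that, of 2] by (simp add: power_mult_distrib)
  have sum: "norm (exp s) + norm B + norm C = N" by (simp add: size_N_def defs)
  have "ellip_y \<nu>1 \<nu>2 v s - lead1 \<nu>1 \<nu>2 s
     = (ellip_y \<nu>1 \<nu>2 v s - (exp s / 2 + csc2_exp w + csc2_exp W))
       + ((csc2_exp w + 4 * w) + (csc2_exp W + 4 * W)) + ((- 4) * (w - C) + (- 4) * (W - B))"
    by (simp add: lead1_eq defs algebra_simps)
  also have "norm \<dots> \<le> norm (ellip_y \<nu>1 \<nu>2 v s - (exp s / 2 + csc2_exp w + csc2_exp W))
       + (norm (csc2_exp w + 4 * w) + norm (csc2_exp W + 4 * W)) + (norm ((- 4) * (w - C)) + norm ((- 4) * (W - B)))"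
    by (intro order_trans[OF norm_triangle_ineq] add_mono norm_triangle_ineq order_refl)
  also have "\<dots> \<le> est_const * N * (2 * N) + (64 * (4 * N\<^sup>2) + 64 * (4 * N\<^sup>2)) + (4 * (K2 * N * N) + 4 * (K2 * N * N))"
  proof (intro add_mono)
    have "norm (exp s) + norm w + norm W \<le> 2 * N" using e sum by (smt (verit) norm_ge_zero)
    hence "est_const * norm (exp s) * (norm (exp s) + norm w + norm W) \<le> est_const * N * (2 * N)"
      using est_const_nonneg NB by (intro mult_mono) auto
    with ellip_y_estimate[of s \<nu>1 \<nu>2 v, OF xR] w W
    show "norm (ellip_y \<nu>1 \<nu>2 v s - (exp s / 2 + csc2_exp w + csc2_exp W)) \<le> est_const * N * (2 * N)"
      unfolding w_def W_def by linarith
    show "norm (csc2_exp w + 4 * w) \<le> 64 * (4 * N\<^sup>2)" "norm (csc2_exp W + 4 * W) \<le> 64 * (4 * N\<^sup>2)"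
      using norm_csc2_exp_linear_le[OF w(1)] norm_csc2_exp_linear_le[OF W(1)] sq[OF w(2)] sq[OF W(2)]
      by linarith+
    have "K2 * N * norm C \<le> K2 * N * N" "K2 * N * norm B \<le> K2 * N * N"
      using NB K2 by (auto intro!: mult_left_mono)
    thus "norm ((- 4) * (w - C)) \<le> 4 * (K2 * N * N)" "norm ((- 4) * (W - B)) \<le> 4 * (K2 * N * N)"
      using e unfolding norm_mult norm_minus_cancel norm_numeral by linarith+
  qed
  also have "\<dots> = (2 * est_const + 512 + 8 * K2) * N\<^sup>2"
    by (simp add: power2_eq_square algebra_simps)
  finally show ?thesis by (simp add: N_def)
qed

text \<open>The error is (y - g) / g. Where g vanishes the hypothesis forces y = 0, and division by
  zero gives the harmless value 0.\<close>

lemma asymp_along_intro: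
  assumes "\<forall>\<^sub>F t in at_right 0. norm (y (\<sigma> t) - g (\<sigma> t)) \<le> k * norm (xpow (of_real \<delta>) (\<sigma> t)) * norm (g (\<sigma> t))"
  shows "asymp_along \<sigma> \<delta> y g"
  unfolding asymp_along_def
proof (intro exI conjI)
  define e where "e = (\<lambda>t. (y (\<sigma> t) - g (\<sigma> t)) / g (\<sigma> t))"
  show "e \<in> O[at_right 0](\<lambda>t. xpow (of_real \<delta>) (\<sigma> t))"
  proof (rule bigoI[where c = "max k 0"])
    show "\<forall>\<^sub>F t in at_right 0. norm (e t) \<le> max k 0 * norm (xpow (of_real \<delta>) (\<sigma> t))"
      using assms
    proof eventually_elim
      case (elim t)
      show ?case
      proof (cases "g (\<sigma> t) = 0")
        case False
        hence "norm (e t) \<le> k * norm (xpow (of_real \<delta>) (\<sigma> t))"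
          using elim by (simp add: e_def norm_divide divide_le_eq)
        also have "\<dots> \<le> max k 0 * norm (xpow (of_real \<delta>) (\<sigma> t))" by (intro mult_right_mono) auto
        finally show ?thesis .
      qed (simp add: e_def)
    qed
  qed
  show "\<forall>\<^sub>F t in at_right 0. y (\<sigma> t) = g (\<sigma> t) * (1 + e t)"
    using assms
  proof eventually_elim
    case (elim t)
    thus ?case by (cases "g (\<sigma> t) = 0") (auto simp: e_def field_simps)
  qed
qed

text \<open>The total error D is divided among the terms in proportion to their moduli, so that each
  error factor has modulus at most |D| / N, even at points where the sum of the terms
  vanishes.\<close>

lemma asymp_along3_intro:
  assumes "\<forall>\<^sub>F t in at_right 0. norm (y (\<sigma> t) - (g1 (\<sigma> t) + g2 (\<sigma> t) + g3 (\<sigma> t)))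
     \<le> k * norm (xpow (of_real \<delta>) (\<sigma> t)) * (norm (g1 (\<sigma> t)) + norm (g2 (\<sigma> t)) + norm (g3 (\<sigma> t)))"
  shows "asymp_along3 \<sigma> \<delta> y g1 g2 g3"
  unfolding asymp_along3_def
proof (intro exI conjI)
  define D where "D = (\<lambda>t. y (\<sigma> t) - (g1 (\<sigma> t) + g2 (\<sigma> t) + g3 (\<sigma> t)))"
  define N where "N = (\<lambda>t. norm (g1 (\<sigma> t)) + norm (g2 (\<sigma> t)) + norm (g3 (\<sigma> t)))"
  define e where "e = (\<lambda>g t. D t * of_real (norm (g (\<sigma> t)) / N t) / g (\<sigma> t))"
  have N0: "N t \<ge> 0" for t by (simp add: N_def)
  have O: "e g \<in> O[at_right 0](\<lambda>t. xpow (of_real \<delta>) (\<sigma> t))" for g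
  proof (rule bigoI[where c = "max k 0"])
    show "\<forall>\<^sub>F t in at_right 0. norm (e g t) \<le> max k 0 * norm (xpow (of_real \<delta>) (\<sigma> t))"
      using assms
    proof eventually_elim
      case (elim t)
      show ?case
      proof (cases "g (\<sigma> t) = 0 \<or> N t = 0")
        case False
        hence "norm (e g t) = norm (D t) / N t" using N0[of t] by (simp add: e_def norm_mult norm_divide)
        also have "\<dots> \<le> k * norm (xpow (of_real \<delta>) (\<sigma> t))"
        proof -
          have "N t > 0" using False N0[of t] by simp
          moreover have "norm (D t) \<le> k * norm (xpow (of_real \<delta>) (\<sigma> t)) * N t"
            using elim by (simp add: D_def N_def)
          ultimately show ?thesis by (simp add: divide_le_eq)
        qed
        also have "\<dots> \<le> max k 0 * norm (xpow (of_real \<delta>) (\<sigma> t))" by (intro mult_right_mono) auto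
        finally show ?thesis .
      qed (auto simp: e_def)
    qed
  qed
  show "e g1 \<in> O[at_right 0](\<lambda>t. xpow (of_real \<delta>) (\<sigma> t))"
    "e g2 \<in> O[at_right 0](\<lambda>t. xpow (of_real \<delta>) (\<sigma> t))"
    "e g3 \<in> O[at_right 0](\<lambda>t. xpow (of_real \<delta>) (\<sigma> t))" by (rule O)+
  show "\<forall>\<^sub>F t in at_right 0. y (\<sigma> t) =
      g1 (\<sigma> t) * (1 + e g1 t) + g2 (\<sigma> t) * (1 + e g2 t) + g3 (\<sigma> t) * (1 + e g3 t)"
    using assms
  proof eventually_elim
    case (elim t)
    have ge: "g (\<sigma> t) * e g t = D t * of_real (norm (g (\<sigma> t)) / N t)" for g
      by (cases "g (\<sigma> t) = 0") (auto simp: e_def)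
    have "g1 (\<sigma> t) * e g1 t + g2 (\<sigma> t) * e g2 t + g3 (\<sigma> t) * e g3 t
       = D t * of_real (norm (g1 (\<sigma> t)) / N t + norm (g2 (\<sigma> t)) / N t + norm (g3 (\<sigma> t)) / N t)"
      unfolding ge by (simp add: algebra_simps)
    also have "\<dots> = D t * of_real (N t / N t)"
      by (simp only: N_def add_divide_distrib)
    also have "\<dots> = D t"
    proof (cases "N t = 0")
      case True
      hence "D t = 0" using elim by (simp add: D_def N_def)
      thus ?thesis by simp
    qed simp
    finally show ?case by (simp add: D_def algebra_simps)
  qed
qed

section \<open>Lower bounds for the leading sum through the ratio E\<close>

lemma norm_xpow_of_real: "norm (xpow (of_real \<delta>) s) = norm (exp s) powr \<delta>"
  by (simp add: xpow_def powr_def)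

lemma ratio_E:
  "exp s * (coefA \<nu>1 \<nu>2 * xpow (\<nu>2 - 1) s) = 16 * monC \<nu>1 \<nu>2 s"
  "exp s = 16 * (coefA \<nu>1 \<nu>2 * xpow (\<nu>2 - 1) s) * monB \<nu>1 \<nu>2 s"
  "coefA \<nu>1 \<nu>2 * xpow (\<nu>2 - 1) s \<noteq> 0"
proof -
  show 0: "coefA \<nu>1 \<nu>2 * xpow (\<nu>2 - 1) s \<noteq> 0" by (simp add: coefA_def xpow_def)
  have "xpow \<nu>2 s = exp s * xpow (\<nu>2 - 1) s" by (simp add: xpow_def algebra_simps flip: exp_add)
  thus 1: "exp s * (coefA \<nu>1 \<nu>2 * xpow (\<nu>2 - 1) s) = 16 * monC \<nu>1 \<nu>2 s"
    using term2_eq[of \<nu>1 \<nu>2 s] by (simp add: term2_def mult_ac)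
  have "exp s * exp s = 256 * (monB \<nu>1 \<nu>2 s * monC \<nu>1 \<nu>2 s)"
    unfolding monB_mult_monC by (simp add: power2_eq_square)
  also have "\<dots> = 16 * monB \<nu>1 \<nu>2 s * (16 * monC \<nu>1 \<nu>2 s)" by simp
  also have "\<dots> = exp s * (16 * (coefA \<nu>1 \<nu>2 * xpow (\<nu>2 - 1) s) * monB \<nu>1 \<nu>2 s)"
    unfolding 1 [symmetric] by (simp add: mult_ac)
  finally show "exp s = 16 * (coefA \<nu>1 \<nu>2 * xpow (\<nu>2 - 1) s) * monB \<nu>1 \<nu>2 s" by simp
qed

text \<open>With \<open>E = coefA \<nu>1 \<nu>2 * xpow (\<nu>2 - 1) s\<close> the leading term is \<open>- (x / 4) (E - 1)\<^sup>2 / E\<close>.\<close>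

lemma lead1_lower_bound:
  assumes \<eta>: "0 < \<eta>"
    and E: "\<eta> * (1 + norm (coefA \<nu>1 \<nu>2 * xpow (\<nu>2 - 1) s)) \<le> norm (coefA \<nu>1 \<nu>2 * xpow (\<nu>2 - 1) s - 1)"
  shows "size_N \<nu>1 \<nu>2 s \<le> 4 / \<eta>\<^sup>2 * norm (lead1 \<nu>1 \<nu>2 s)"
proof -
  define E where "E = coefA \<nu>1 \<nu>2 * xpow (\<nu>2 - 1) s"
  define x where "x = exp s"
  have E0: "E \<noteq> 0" using ratio_E(3) by (simp add: E_def)
  have C: "monC \<nu>1 \<nu>2 s = x * E / 16" using ratio_E(1)[of s \<nu>1 \<nu>2] by (simp add: E_def x_def)
  have B: "monB \<nu>1 \<nu>2 s = x / (16 * E)" using ratio_E(2)[of s \<nu>1 \<nu>2] E0 by (simp add: E_def x_def field_simps)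
  have l: "lead1 \<nu>1 \<nu>2 s = - (x / 4) * ((E - 1)\<^sup>2 / E)"
    unfolding lead1_eq B C x_def [symmetric] using E0 by (simp add: field_simps power2_eq_square)
  have "size_N \<nu>1 \<nu>2 s = norm x * (1 + norm E / 16 + 1 / (16 * norm E))"
    unfolding size_N_def B C x_def [symmetric] by (simp add: norm_mult norm_divide algebra_simps)
  \<comment> \<open>The three summands are compared with (1 + |E|)^2 / |E| = 1/|E| + 2 +
    |E|.\<close>
  also have "\<dots> \<le> norm x * ((1 + norm E)\<^sup>2 / norm E)"
    using E0 by (intro mult_left_mono) (auto simp: field_simps power2_eq_square)
  also have "\<dots> = 4 / \<eta>\<^sup>2 * (norm x / 4 * ((\<eta> * (1 + norm E))\<^sup>2 / norm E))"
    using \<eta> by (simp add: power_mult_distrib)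
  also have "\<dots> \<le> 4 / \<eta>\<^sup>2 * (norm x / 4 * ((norm (E - 1))\<^sup>2 / norm E))"
    using E \<eta> unfolding E_def [symmetric]
    by (intro mult_left_mono divide_right_mono power_mono) auto
  also have "norm x / 4 * ((norm (E - 1))\<^sup>2 / norm E) = norm (lead1 \<nu>1 \<nu>2 s)"
    unfolding l by (simp add: norm_mult norm_divide norm_power)
  finally show ?thesis .
qed

text \<open>By the sign of a, E tends to 0, has constant modulus c, or tends to infinity. The value
  1/2 works once |E| <= 1/3 or |E| >= 3; for a = 0 the reverse triangle inequality gives |c - 1| /
  (1 + c).\<close>

lemma power_law_away_from_1:
  fixes E x :: "real \<Rightarrow> complex"
  assumes lim: "((\<lambda>t. norm (x t)) \<longlongrightarrow> 0) F" and nz: "\<And>t. x t \<noteq> 0" and c: "0 < c"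
    and E: "\<forall>\<^sub>F t in F. norm (E t) = c * norm (x t) powr a"
    and ac: "a \<noteq> 0 \<or> c \<noteq> 1"
  shows "\<exists>\<eta>>0. \<forall>\<^sub>F t in F. \<eta> * (1 + norm (E t)) \<le> norm (E t - 1)"
proof -
  have pl: "((\<lambda>t. norm (x t) powr b) \<longlongrightarrow> 0) F" if "b > 0" for b
    using that by (intro tendsto_zero_powrI[OF lim tendsto_const]) auto
  consider "a = 0" | "a > 0" | "a < 0" by linarith
  thus ?thesis
  proof cases
    case 1
    hence "c \<noteq> 1" using ac by simp
    define \<eta> where "\<eta> = \<bar>c - 1\<bar> / (1 + c)"
    have "\<eta> > 0" using \<open>c \<noteq> 1\<close> c by (simp add: \<eta>_def)
    moreover have "\<forall>\<^sub>F t in F. \<eta> * (1 + norm (E t)) \<le> norm (E t - 1)"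
      using E
    proof eventually_elim
      case (elim t)
      hence "norm (E t) = c" using nz[of t] 1 by simp
      thus ?case using norm_triangle_ineq3[of "E t" 1] c by (simp add: \<eta>_def)
    qed
    ultimately show ?thesis by blast
  next
    case 2
    have "\<forall>\<^sub>F t in F. norm (x t) powr a < 1 / (3 * c)"
      using pl[OF 2] c by (intro order_tendstoD) auto
    hence "\<forall>\<^sub>F t in F. 1/2 * (1 + norm (E t)) \<le> norm (E t - 1)"
      using E
    proof eventually_elim
      case (elim t)
      hence "norm (E t) \<le> 1/3" using c by (simp add: field_simps)
      thus ?case using norm_triangle_ineq2[of 1 "E t"] by (simp add: norm_minus_commute)
    qed
    thus ?thesis by (intro exI[of _ "1/2"]) auto
  next
    case 3
    have "\<forall>\<^sub>F t in F. norm (x t) powr (- a) < c / 3"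
      using pl[of "- a"] 3 c by (intro order_tendstoD) auto
    hence "\<forall>\<^sub>F t in F. 1/2 * (1 + norm (E t)) \<le> norm (E t - 1)"
      using E
    proof eventually_elim
      case (elim t)
      have "norm (E t) * norm (x t) powr (- a) = c"
        using elim(2) nz[of t] by (simp add: mult.assoc flip: powr_add)
      moreover have "norm (E t) * norm (x t) powr (- a) \<le> norm (E t) * (c / 3)"
        using elim(1) by (intro mult_left_mono) auto
      ultimately have "c * 1 \<le> c * (norm (E t) / 3)" by (simp add: mult.commute)
      hence "3 \<le> norm (E t)" using c by (subst (asm) mult_le_cancel_left_pos) auto
      thus ?case using norm_triangle_ineq2[of "E t" 1] by simp
    qed
    thus ?thesis by (intro exI[of _ "1/2"]) auto
  qed
qed

text \<open>One factor of N^2 is spent on the power x^\<delta>, the other is compared with the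
  leading terms. Here \<delta> lies below the exponents 1, V and 2 - V of the three summands of N;
  halving the minimum ensures \<delta> < 1.\<close>

lemma power_law_asymptotics:
  fixes \<sigma> :: "real \<Rightarrow> complex"
  assumes V: "0 < V" "V < 2"
    and lim: "((\<lambda>t. norm (exp (\<sigma> t))) \<longlongrightarrow> 0) (at_right 0)"
    and near: "\<forall>\<^sub>F t in at_right 0. norm (y (\<sigma> t) - lead1 \<nu>1 \<nu>2 (\<sigma> t)) \<le> k * (size_N \<nu>1 \<nu>2 (\<sigma> t))\<^sup>2"
    and k: "k \<ge> 0"
    and C: "\<forall>\<^sub>F t in at_right 0. norm (monC \<nu>1 \<nu>2 (\<sigma> t)) = c1 * norm (exp (\<sigma> t)) powr V"
    and B: "\<forall>\<^sub>F t in at_right 0. norm (monB \<nu>1 \<nu>2 (\<sigma> t)) = c2 * norm (exp (\<sigma> t)) powr (2 - V)"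
    and c: "c1 > 0" "c2 > 0"
  defines "\<delta> \<equiv> min V (min (2 - V) 1) / 2"
  shows "asymp_along3 \<sigma> \<delta> y term1 (term2 \<nu>1 \<nu>2) (term3 \<nu>1 \<nu>2)"
    and "\<lbrakk>0 < \<eta>; \<forall>\<^sub>F t in at_right 0. \<eta> * (1 + norm (coefA \<nu>1 \<nu>2 * xpow (\<nu>2 - 1) (\<sigma> t)))
              \<le> norm (coefA \<nu>1 \<nu>2 * xpow (\<nu>2 - 1) (\<sigma> t) - 1)\<rbrakk>
      \<Longrightarrow> asymp_along \<sigma> \<delta> y (lead1 \<nu>1 \<nu>2)"
proof -
  have "\<forall>\<^sub>F t in at_right 0. norm (exp (\<sigma> t)) < 1"
    using lim by (intro order_tendstoD) auto
  hence N: "\<forall>\<^sub>F t in at_right 0. size_N \<nu>1 \<nu>2 (\<sigma> t) \<le> (1 + c2 + c1) * norm (xpow (of_real \<delta>) (\<sigma> t))"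
    using C B
  proof eventually_elim
    case (elim t)
    define X where "X = norm (exp (\<sigma> t))"
    have X: "0 < X" "X \<le> 1" using elim by (simp_all add: X_def)
    have d: "\<delta> \<le> 1" "\<delta> \<le> V" "\<delta> \<le> 2 - V" using V by (auto simp: \<delta>_def)
    have "X powr 1 \<le> X powr \<delta>" "X powr V \<le> X powr \<delta>" "X powr (2 - V) \<le> X powr \<delta>"
      using X d by (intro powr_mono'; simp)+
    hence "X + c2 * X powr (2 - V) + c1 * X powr V \<le> X powr \<delta> + c2 * X powr \<delta> + c1 * X powr \<delta>"
      using X c by (intro add_mono mult_left_mono) auto
    thus ?case using elim unfolding size_N_def norm_xpow_of_real X_def [symmetric]
      by (simp add: algebra_simps)
  qed
  have near': "\<forall>\<^sub>F t in at_right 0. norm (y (\<sigma> t) - lead1 \<nu>1 \<nu>2 (\<sigma> t))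
      \<le> k * (1 + c2 + c1) * norm (xpow (of_real \<delta>) (\<sigma> t)) * size_N \<nu>1 \<nu>2 (\<sigma> t)"
    using near N
  proof eventually_elim
    case (elim t)
    have "k * (size_N \<nu>1 \<nu>2 (\<sigma> t))\<^sup>2 \<le> k * ((1 + c2 + c1) * norm (xpow (of_real \<delta>) (\<sigma> t)) * size_N \<nu>1 \<nu>2 (\<sigma> t))"
      unfolding power2_eq_square using elim(2) k size_N_bounds(4)
      by (intro mult_left_mono mult_right_mono) auto
    with elim(1) show ?case by (simp add: mult.assoc)
  qed
  have k': "k * (1 + c2 + c1) \<ge> 0" using k c by simp
  show "asymp_along3 \<sigma> \<delta> y term1 (term2 \<nu>1 \<nu>2) (term3 \<nu>1 \<nu>2)"
  proof (rule asymp_along3_intro)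
    show "\<forall>\<^sub>F t in at_right 0. norm (y (\<sigma> t) - (term1 (\<sigma> t) + term2 \<nu>1 \<nu>2 (\<sigma> t) + term3 \<nu>1 \<nu>2 (\<sigma> t)))
      \<le> (2 * (k * (1 + c2 + c1))) * norm (xpow (of_real \<delta>) (\<sigma> t)) *
        (norm (term1 (\<sigma> t)) + norm (term2 \<nu>1 \<nu>2 (\<sigma> t)) + norm (term3 \<nu>1 \<nu>2 (\<sigma> t)))"
      using near'
    proof eventually_elim
      case (elim t)
      have "size_N \<nu>1 \<nu>2 (\<sigma> t) \<le> 2 * (norm (term1 (\<sigma> t)) + norm (term2 \<nu>1 \<nu>2 (\<sigma> t)) + norm (term3 \<nu>1 \<nu>2 (\<sigma> t)))"
        by (simp add: size_N_def term1_def term2_eq term3_eq norm_mult)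
      hence "k * (1 + c2 + c1) * norm (xpow (of_real \<delta>) (\<sigma> t)) * size_N \<nu>1 \<nu>2 (\<sigma> t) \<le>
        k * (1 + c2 + c1) * norm (xpow (of_real \<delta>) (\<sigma> t)) *
        (2 * (norm (term1 (\<sigma> t)) + norm (term2 \<nu>1 \<nu>2 (\<sigma> t)) + norm (term3 \<nu>1 \<nu>2 (\<sigma> t))))"
        using k' by (intro mult_left_mono) auto
      from order_trans[OF elim this] show ?case by (simp only: lead1_def mult_ac)
    qed
  qed
  assume \<eta>: "0 < \<eta>" and E: "\<forall>\<^sub>F t in at_right 0. \<eta> * (1 + norm (coefA \<nu>1 \<nu>2 * xpow (\<nu>2 - 1) (\<sigma> t)))
              \<le> norm (coefA \<nu>1 \<nu>2 * xpow (\<nu>2 - 1) (\<sigma> t) - 1)"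
  show "asymp_along \<sigma> \<delta> y (lead1 \<nu>1 \<nu>2)"
  proof (rule asymp_along_intro)
    show "\<forall>\<^sub>F t in at_right 0. norm (y (\<sigma> t) - lead1 \<nu>1 \<nu>2 (\<sigma> t))
       \<le> (k * (1 + c2 + c1) * (4 / \<eta>\<^sup>2)) * norm (xpow (of_real \<delta>) (\<sigma> t)) * norm (lead1 \<nu>1 \<nu>2 (\<sigma> t))"
      using near' E
    proof eventually_elim
      case (elim t)
      have "k * (1 + c2 + c1) * norm (xpow (of_real \<delta>) (\<sigma> t)) * size_N \<nu>1 \<nu>2 (\<sigma> t) \<le>
        k * (1 + c2 + c1) * norm (xpow (of_real \<delta>) (\<sigma> t)) * (4 / \<eta>\<^sup>2 * norm (lead1 \<nu>1 \<nu>2 (\<sigma> t)))"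
        using k' lead1_lower_bound[OF \<eta> elim(2)] by (intro mult_left_mono) auto
      from order_trans[OF elim(1) this] show ?case by (simp only: mult_ac)
    qed
  qed
qed

text \<open>The slope of the spiral is made for this: the real part of the product is
  \<open>Re \<nu>2\<close> times the radial increment minus \<open>Im \<nu>2\<close> times the
  angular one, and the latter is \<open>(Re \<nu>2 - V) / Im \<nu>2\<close> times the radial
  one.\<close>

lemma Re_mult_spiral_diff:
  assumes "Im \<nu>2 \<noteq> 0" "t > 0"
  shows "Re (\<nu>2 * (spiral \<nu>2 V s0 t - s0)) = V * ln (t / norm (exp s0))"
proof -
  have "ln (t / norm (exp s0)) = ln t - Re s0" using assms by (simp add: ln_div)
  thus ?thesis using assms by (simp add: spiral_def) (simp add: algebra_simps)
qed

lemma spiral_norms: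
  assumes "Im \<nu>2 \<noteq> 0" "t > 0"
  shows "norm (exp (spiral \<nu>2 V s0 t)) = t"
    "norm (monC \<nu>1 \<nu>2 (spiral \<nu>2 V s0 t)) = norm (monC \<nu>1 \<nu>2 s0) * (t / norm (exp s0)) powr V"
    "norm (monB \<nu>1 \<nu>2 (spiral \<nu>2 V s0 t)) = norm (monB \<nu>1 \<nu>2 s0) * (t / norm (exp s0)) powr (2 - V)"
proof -
  show 1: "norm (exp (spiral \<nu>2 V s0 t)) = t" using assms by (simp add: spiral_def)
  have "monC \<nu>1 \<nu>2 (spiral \<nu>2 V s0 t) = monC \<nu>1 \<nu>2 s0 * exp (\<nu>2 * (spiral \<nu>2 V s0 t - s0))"
    unfolding monC_exp exp_add [symmetric] by (rule arg_cong[where f = exp]) (simp add: algebra_simps)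
  hence C: "norm (monC \<nu>1 \<nu>2 (spiral \<nu>2 V s0 t)) = norm (monC \<nu>1 \<nu>2 s0) * exp (V * ln (t / norm (exp s0)))"
    using Re_mult_spiral_diff[OF assms, of V s0] by (simp only: norm_mult norm_exp_eq_Re)
  thus "norm (monC \<nu>1 \<nu>2 (spiral \<nu>2 V s0 t)) = norm (monC \<nu>1 \<nu>2 s0) * (t / norm (exp s0)) powr V"
    using assms by (simp add: powr_def)
  have "monB \<nu>1 \<nu>2 (spiral \<nu>2 V s0 t) = monB \<nu>1 \<nu>2 s0 * exp ((2 - \<nu>2) * (spiral \<nu>2 V s0 t - s0))"
    unfolding monB_exp exp_add [symmetric] by (rule arg_cong[where f = exp]) (simp add: algebra_simps)
  moreover have "Re ((2 - \<nu>2) * (spiral \<nu>2 V s0 t - s0)) = (2 - V) * ln (t / norm (exp s0))"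
  proof -
    have "Re ((2 - \<nu>2) * (spiral \<nu>2 V s0 t - s0)) = 2 * Re (spiral \<nu>2 V s0 t - s0) - Re (\<nu>2 * (spiral \<nu>2 V s0 t - s0))"
      by (simp add: algebra_simps)
    moreover have "Re (spiral \<nu>2 V s0 t - s0) = ln (t / norm (exp s0))"
      using assms by (simp add: spiral_def ln_div)
    ultimately show ?thesis unfolding Re_mult_spiral_diff[OF assms] by (simp add: algebra_simps)
  qed
  ultimately show "norm (monB \<nu>1 \<nu>2 (spiral \<nu>2 V s0 t)) = norm (monB \<nu>1 \<nu>2 s0) * (t / norm (exp s0)) powr (2 - V)"
    using assms by (simp add: norm_mult powr_def)
qed

lemma spiral_in_domD:
  assumes "Im \<nu>2 \<noteq> 0" "0 < t" "t \<le> norm (exp s0)" "0 \<le> V" "V \<le> 2" "s0 \<in> domD r \<nu>1 \<nu>2"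
  shows "spiral \<nu>2 V s0 t \<in> domD r \<nu>1 \<nu>2"
proof -
  have *: "norm a * (t / norm (exp s0)) powr U < r" if "norm a < r" "0 \<le> U" for a :: complex and U
  proof -
    have "(t / norm (exp s0)) powr U \<le> 1"
      using assms that by (intro powr_le1) (auto simp: field_simps)
    hence "norm a * (t / norm (exp s0)) powr U \<le> norm a * 1" by (intro mult_left_mono) auto
    thus ?thesis using that by simp
  qed
  show ?thesis using assms(6) * assms(3-5)
    unfolding domD_def mem_Collect_eq spiral_norms[OF assms(1,2)] by auto
qed

lemma eventually_spiral:
  fixes s0 :: complex
  assumes "\<And>t. 0 < t \<Longrightarrow> t \<le> norm (exp s0) \<Longrightarrow> P t"
  shows "\<forall>\<^sub>F t in at_right (0::real). P t"
  unfolding eventually_at_right_field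
  by (rule exI[of _ "norm (exp s0)"]) (use assms in auto)

section \<open>The boundary spirals\<close>

text \<open>For complex families summability is absolute, so termwise domination passes to the sums
  of moduli.\<close>

lemma has_sum_norm_le_scaled:
  fixes f g :: "'a \<Rightarrow> complex"
  assumes f: "(f has_sum A) I" and g: "g summable_on I"
    and le: "\<And>i. i \<in> I \<Longrightarrow> norm (f i) \<le> q * norm (g i)"
  shows "norm A \<le> q * (\<Sum>\<^sub>\<infinity>i\<in>I. norm (g i))"
proof -
  have ga: "(\<lambda>i. norm (g i)) summable_on I"
    using g summable_on_iff_abs_summable_on_complex by blast
  hence "((\<lambda>i. q * norm (g i)) has_sum (q * (\<Sum>\<^sub>\<infinity>i\<in>I. norm (g i)))) I"
    by (intro has_sum_cmult_right has_sum_infsum)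
  moreover have "((\<lambda>i. norm (f i)) has_sum (\<Sum>\<^sub>\<infinity>i\<in>I. norm (f i))) I"
    using f summable_on_iff_abs_summable_on_complex has_sum_imp_summable by (blast intro: has_sum_infsum)
  ultimately show ?thesis
    using norm_has_sum_bound[OF _ f] has_sum_mono le by (meson order_trans)
qed

lemma power_scaled_le:
  fixes x x0 q :: real
  assumes "0 \<le> x" "x \<le> q * x0" "0 \<le> q" "q \<le> 1" "n \<ge> 1" "0 \<le> x0"
  shows "x ^ n \<le> q * x0 ^ n"
proof -
  have "x ^ n \<le> (q * x0) ^ n" using assms by (intro power_mono) auto
  also have "\<dots> = q ^ n * x0 ^ n" by (simp add: power_mult_distrib)
  also have "\<dots> \<le> q * x0 ^ n"
    using assms power_decreasing[of 1 n q] by (intro mult_right_mono) auto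
  finally show ?thesis .
qed

text \<open>Every monomial other than the pure powers of \<open>z\<close> gains a factor \<open>q\<close> over its value at the base
  point \<open>(x0, y0, z0)\<close>.\<close>

lemma expansion_leading_part:
  fixes a :: "nat \<Rightarrow> complex" and b c :: "nat \<Rightarrow> nat \<Rightarrow> complex"
  assumes A: "((\<lambda>n. a n * x ^ n) has_sum A) {1..}"
    and B: "((\<lambda>(n, m). b n m * x ^ n * y ^ m) has_sum B) (UNIV \<times> {1..})"
    and C: "((\<lambda>(n, m). c n m * x ^ n * z ^ m) has_sum C) (UNIV \<times> {1..})"
    and A0: "(\<lambda>n. a n * x0 ^ n) summable_on {1..}"
    and B0: "(\<lambda>(n, m). b n m * x0 ^ n * y0 ^ m) summable_on (UNIV \<times> {1..})"
    and C0: "(\<lambda>(n, m). c n m * x0 ^ n * z0 ^ m) summable_on (UNIV \<times> {1..})"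
    and q: "0 \<le> q" "q \<le> 1"
    and x: "norm x \<le> q * norm x0" and y: "norm y \<le> q * norm y0" and z: "norm z \<le> norm z0"
  shows "norm (A + B + C - (\<Sum>\<^sub>\<infinity>m\<in>{1..}. c 0 m * z ^ m)) \<le> q *
    ((\<Sum>\<^sub>\<infinity>n\<in>{1..}. norm (a n * x0 ^ n))
     + (\<Sum>\<^sub>\<infinity>p\<in>UNIV \<times> {1..}. norm (case p of (n, m) \<Rightarrow> b n m * x0 ^ n * y0 ^ m))
     + (\<Sum>\<^sub>\<infinity>p\<in>{1..} \<times> {1..}. norm (case p of (n, m) \<Rightarrow> c n m * x0 ^ n * z0 ^ m)))"
proof -
  have x1: "norm x \<le> norm x0" using x q mult_right_mono[of q 1 "norm x0"] by simp
  have xn: "norm x ^ n \<le> norm x0 ^ n" for n using x1 by (intro power_mono) auto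
  have "norm A \<le> q * (\<Sum>\<^sub>\<infinity>n\<in>{1..}. norm (a n * x0 ^ n))"
  proof (rule has_sum_norm_le_scaled[OF A A0])
    fix n :: nat assume "n \<in> {1..}"
    hence "norm x ^ n \<le> q * norm x0 ^ n" using x q by (intro power_scaled_le) auto
    hence "norm (a n) * norm x ^ n \<le> norm (a n) * (q * norm x0 ^ n)" by (intro mult_left_mono) auto
    thus "norm (a n * x ^ n) \<le> q * norm (a n * x0 ^ n)" by (simp add: norm_mult norm_power mult_ac)
  qed
  moreover have "norm B \<le> q * (\<Sum>\<^sub>\<infinity>p\<in>UNIV \<times> {1..}. norm (case p of (n, m) \<Rightarrow> b n m * x0 ^ n * y0 ^ m))"
  proof (rule has_sum_norm_le_scaled[OF B B0])
    fix p :: "nat \<times> nat" assume p: "p \<in> UNIV \<times> {1..}"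
    obtain n m where nm: "p = (n, m)" by force
    have "norm y ^ m \<le> q * norm y0 ^ m" using y q p nm by (intro power_scaled_le) auto
    hence "norm (b n m) * (norm x ^ n * norm y ^ m) \<le> norm (b n m) * (norm x0 ^ n * (q * norm y0 ^ m))"
      using xn by (intro mult_left_mono mult_mono) auto
    thus "norm (case p of (n, m) \<Rightarrow> b n m * x ^ n * y ^ m) \<le> q * norm (case p of (n, m) \<Rightarrow> b n m * x0 ^ n * y0 ^ m)"
      by (simp add: nm norm_mult norm_power mult_ac)
  qed
  moreover have "norm (C - (\<Sum>\<^sub>\<infinity>m\<in>{1..}. c 0 m * z ^ m))
     \<le> q * (\<Sum>\<^sub>\<infinity>p\<in>{1..} \<times> {1..}. norm (case p of (n, m) \<Rightarrow> c n m * x0 ^ n * z0 ^ m))"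
  proof -
    define f where "f = (\<lambda>(n, m). c n m * x ^ n * z ^ m)"
    have f: "(f has_sum C) (UNIV \<times> {1..})" using C by (simp add: f_def)
    \<comment> \<open>Row n = 0 of the family c consists of the pure powers of z, which gain no
      factor. Removing it leaves n >= 1, where x^n supplies the q.\<close>
    have "f summable_on {0} \<times> {1..}"
      by (rule summable_on_subset[OF has_sum_imp_summable[OF f]]) auto
    then obtain G where G: "(f has_sum G) ({0} \<times> {1..})" by (auto simp: summable_on_def)
    hence "((\<lambda>m. c 0 m * z ^ m) has_sum G) {1..}"
      by (subst has_sum_reindex_bij_witness[where S = "{1..}" and T = "{0} \<times> {1..}"
          and i = snd and j = "\<lambda>m. (0, m)" and h = f]) (auto simp: f_def)
    hence Geq: "(\<Sum>\<^sub>\<infinity>m\<in>{1..}. c 0 m * z ^ m) = G" by (rule infsumI)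
    have "(f has_sum (C - G)) (UNIV \<times> {1..} - {0} \<times> {1..})"
      by (rule has_sum_Diff[OF f G]) auto
    also have "UNIV \<times> {1..} - {0} \<times> {1..} = {1::nat..} \<times> {1::nat..}" by auto
    finally have "(f has_sum (C - G)) ({1..} \<times> {1..})" .
    moreover have "(\<lambda>(n, m). c n m * x0 ^ n * z0 ^ m) summable_on ({1..} \<times> {1..})"
      by (rule summable_on_subset[OF C0]) auto
    ultimately have "norm (C - G) \<le> q * (\<Sum>\<^sub>\<infinity>p\<in>{1..} \<times> {1..}. norm (case p of (n, m) \<Rightarrow> c n m * x0 ^ n * z0 ^ m))"
    proof (rule has_sum_norm_le_scaled)
      fix p :: "nat \<times> nat" assume p: "p \<in> {1..} \<times> {1..}"
      obtain n m where nm: "p = (n, m)" by force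
      have "norm x ^ n \<le> q * norm x0 ^ n" using x q p nm by (intro power_scaled_le) auto
      moreover have "norm z ^ m \<le> norm z0 ^ m" using z by (intro power_mono) auto
      ultimately have "norm (c n m) * (norm x ^ n * norm z ^ m) \<le> norm (c n m) * ((q * norm x0 ^ n) * norm z0 ^ m)"
        using q by (intro mult_left_mono mult_mono) auto
      thus "norm (f p) \<le> q * norm (case p of (n, m) \<Rightarrow> c n m * x0 ^ n * z0 ^ m)"
        by (simp add: nm f_def norm_mult norm_power mult_ac)
    qed
    thus ?thesis unfolding Geq .
  qed
  moreover have "norm (A + B + (C - (\<Sum>\<^sub>\<infinity>m\<in>{1..}. c 0 m * z ^ m)))
      \<le> norm A + norm B + norm (C - (\<Sum>\<^sub>\<infinity>m\<in>{1..}. c 0 m * z ^ m))"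
    by (intro order_trans[OF norm_triangle_ineq] add_right_mono norm_triangle_ineq)
  ultimately have "norm (A + B + (C - (\<Sum>\<^sub>\<infinity>m\<in>{1..}. c 0 m * z ^ m))) \<le> q *
    (\<Sum>\<^sub>\<infinity>n\<in>{1..}. norm (a n * x0 ^ n))
     + q * (\<Sum>\<^sub>\<infinity>p\<in>UNIV \<times> {1..}. norm (case p of (n, m) \<Rightarrow> b n m * x0 ^ n * y0 ^ m))
     + q * (\<Sum>\<^sub>\<infinity>p\<in>{1..} \<times> {1..}. norm (case p of (n, m) \<Rightarrow> c n m * x0 ^ n * z0 ^ m))"
    by linarith
  thus ?thesis by (simp add: algebra_simps)
qed

lemma norm_csc2_exp_ge:
  assumes "norm t \<le> 1/2"
  shows "norm t \<le> norm (csc2_exp t)"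
proof -
  have n: "0 < norm (1 - t)" "norm (1 - t) \<le> 2"
    using norm_one_minus_ge[OF assms] norm_triangle_ineq4[of 1 t] assms by auto
  have "norm t * (norm (1 - t))\<^sup>2 \<le> norm t * 2\<^sup>2"
    using n by (intro mult_left_mono power_mono) auto
  hence "norm t \<le> 4 * norm t / (norm (1 - t))\<^sup>2" using n by (simp add: field_simps)
  thus ?thesis by (simp add: csc2_exp_def norm_divide norm_mult norm_power)
qed

text \<open>An O(t) error is relative here because the modulus of \<open>csc2_exp (w0 t)\<close> is
  at least that of \<open>w0 t\<close>, hence at least \<kappa>. Passing from w to w0 costs O(t) by
  the Lipschitz bound on the disc of radius 1/2.\<close>

lemma csc2_exp_asymptotics:
  fixes \<sigma> :: "real \<Rightarrow> complex"
  assumes x: "\<forall>\<^sub>F t in at_right 0. norm (exp (\<sigma> t)) = t"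
    and y: "\<forall>\<^sub>F t in at_right 0. norm (y (\<sigma> t) - csc2_exp (w t)) \<le> k1 * t"
    and w: "\<forall>\<^sub>F t in at_right 0. w t = w0 t * exp (\<theta> t)"
    and \<theta>: "\<forall>\<^sub>F t in at_right 0. norm (\<theta> t) \<le> k2 * t"
    and small: "\<forall>\<^sub>F t in at_right 0. norm (w t) \<le> 1/6"
    and low: "\<forall>\<^sub>F t in at_right 0. \<kappa> \<le> norm (w0 t)" and \<kappa>: "0 < \<kappa>"
    and g: "\<forall>\<^sub>F t in at_right 0. g (\<sigma> t) = csc2_exp (w0 t)"
  shows "asymp_along \<sigma> 1 y g"
proof (rule asymp_along_intro)
  define k3 where "k3 = \<bar>k1\<bar> + 128 * \<bar>k2\<bar>"
  have tpos: "\<forall>\<^sub>F t in at_right (0::real). 0 < t" by (simp add: eventually_at_right_less)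
  have "((\<lambda>t::real. k2 * t) \<longlongrightarrow> k2 * 0) (at_right 0)" by (intro tendsto_intros)
  hence "\<forall>\<^sub>F t in at_right 0. k2 * t < 1/4" by (intro order_tendstoD) auto
  thus "\<forall>\<^sub>F t in at_right 0. norm (y (\<sigma> t) - g (\<sigma> t)) \<le> (k3 / \<kappa>) * norm (xpow (of_real 1) (\<sigma> t)) * norm (g (\<sigma> t))"
    using tpos x y w \<theta> small low g
  proof eventually_elim
    case (elim t)
    have th: "norm (\<theta> t) \<le> 1/4" using elim by linarith
    \<comment> \<open>On |\<theta>| <= 1/4 the exponential is at most 1 + 2/4 = 3/2, so w0 stays in
      the disc of the Lipschitz bound.\<close>
    have "w0 t = w t * exp (- \<theta> t)" using elim by (simp add: exp_minus)
    hence "norm (w0 t) = norm (w t) * norm (exp (- \<theta> t))" by (simp only: norm_mult)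
    also have "\<dots> \<le> 1/6 * (3/2)"
    proof (rule mult_mono)
      show "norm (exp (- \<theta> t)) \<le> 3/2" using exp_bound_lemma[of "- \<theta> t"] th by simp
    qed (use elim in auto)
    finally have "norm (w0 t) \<le> 1/6 * (3/2)" .
    hence w0: "norm (w0 t) \<le> 1/2" by simp
    have "w t - w0 t = w0 t * (exp (\<theta> t) - 1)" using elim by (simp add: algebra_simps)
    hence "norm (w t - w0 t) = norm (w0 t) * norm (exp (\<theta> t) - 1)" by (simp only: norm_mult)
    also have "\<dots> \<le> 1/2 * (2 * (k2 * t))"
    proof (rule mult_mono)
      show "norm (exp (\<theta> t) - 1) \<le> 2 * (k2 * t)"
        using norm_exp_minus_1_le[of "\<theta> t"] th elim by simp
    qed (use w0 in auto)
    finally have "norm (w t - w0 t) \<le> 1/2 * (2 * (k2 * t))" .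
    hence wd: "norm (w t - w0 t) \<le> k2 * t" by simp
    have "norm (csc2_exp (w t) - csc2_exp (w0 t)) \<le> 128 * norm (w t - w0 t)"
      using elim w0 by (intro norm_csc2_exp_diff_le) auto
    hence cd: "norm (csc2_exp (w t) - csc2_exp (w0 t)) \<le> 128 * (k2 * t)" using wd by linarith
    have "norm (y (\<sigma> t) - g (\<sigma> t)) \<le> norm (y (\<sigma> t) - csc2_exp (w t)) + norm (csc2_exp (w t) - csc2_exp (w0 t))"
      using norm_triangle_ineq[of "y (\<sigma> t) - csc2_exp (w t)" "csc2_exp (w t) - csc2_exp (w0 t)"] elim by simp
    also have "\<dots> \<le> k1 * t + 128 * (k2 * t)" using cd elim by linarith
    also have "\<dots> \<le> \<bar>k1\<bar> * t + 128 * (\<bar>k2\<bar> * t)"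
      using elim by (intro add_mono mult_left_mono mult_right_mono) auto
    also have "\<dots> = k3 * t" by (simp add: k3_def algebra_simps)
    also have "\<dots> = (k3 * t / \<kappa>) * \<kappa>" using \<kappa> by simp
    also have "\<dots> \<le> (k3 * t / \<kappa>) * norm (g (\<sigma> t))"
    proof (rule mult_left_mono)
      show "\<kappa> \<le> norm (g (\<sigma> t))" using elim norm_csc2_exp_ge[OF w0] by simp
      show "0 \<le> k3 * t / \<kappa>" using \<kappa> elim by (simp add: k3_def)
    qed
    also have "\<dots> = (k3 / \<kappa>) * norm (xpow (of_real 1) (\<sigma> t)) * norm (g (\<sigma> t))"
      using elim unfolding norm_xpow_of_real by simp
    finally show ?case .
  qed
qed

lemma lead2_csc2_exp:
  "lead2 c0 \<nu>1 \<nu>2 s = csc2_exp (monC \<nu>1 \<nu>2 s * exp (2 * \<i> * (\<Sum>\<^sub>\<infinity>m\<in>{1..}. c0 m * monC \<nu>1 \<nu>2 s ^ m)))"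
proof -
  define g where "g = (\<Sum>\<^sub>\<infinity>m\<in>{1..}. c0 m * monC \<nu>1 \<nu>2 s ^ m)"
  have "2 * \<i> * (- \<i> * (\<nu>2 / 2) * s + (\<i> * (\<nu>2 / 2) * of_real (ln 16) + of_real pi * \<nu>1 / 2) + g)
     = (\<i> * of_real pi * \<nu>1 + \<nu>2 * (s - of_real (ln 16))) + 2 * \<i> * g"
    by (simp add: algebra_simps)
  thus ?thesis
    unfolding lead2_def csc2_exp_eq g_def [symmetric] by (simp only: exp_add monC_exp)
qed

text \<open>With g the sum, 2 i times the argument of the sine is a logarithm of the inverse of B
  exp (- 2 i g). The symmetry of \<open>csc2_exp\<close> removes the inverse; hence the sign that
  differs from \<open>lead2\<close>.\<close>

lemma lead3_csc2_exp:
  "lead3 b0 \<nu>1 \<nu>2 s = csc2_exp (monB \<nu>1 \<nu>2 s * exp (- 2 * \<i> * (\<Sum>\<^sub>\<infinity>m\<in>{1..}. b0 m * monB \<nu>1 \<nu>2 s ^ m)))"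
proof -
  define g where "g = (\<Sum>\<^sub>\<infinity>m\<in>{1..}. b0 m * monB \<nu>1 \<nu>2 s ^ m)"
  have "2 * \<i> * (\<i> * ((2 - \<nu>2) / 2) * s + (\<i> * ((\<nu>2 - 2) / 2) * of_real (ln 16) + of_real pi * \<nu>1 / 2) + g)
     = - ((- \<i> * of_real pi * \<nu>1 + (2 - \<nu>2) * (s - of_real (ln 16))) + (- 2 * \<i> * g))"
    by (simp add: field_simps)
  hence "exp (2 * \<i> * (\<i> * ((2 - \<nu>2) / 2) * s + (\<i> * ((\<nu>2 - 2) / 2) * of_real (ln 16) + of_real pi * \<nu>1 / 2) + g))
     = inverse (monB \<nu>1 \<nu>2 s * exp (- 2 * \<i> * g))"
    by (simp only: exp_minus exp_add monB_exp)
  thus ?thesis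
    unfolding lead3_def csc2_exp_eq g_def [symmetric] by (simp only: csc2_exp_inverse)
qed

lemma exp_norm_lower: "exp (- norm z) \<le> norm (exp (z :: complex))"
  using abs_Re_le_cmod[of z] by simp

text \<open>The two boundary values \<open>V = 0\<close> and \<open>V = 2\<close> differ by exchanging the monomials; \<open>\<epsilon> = 1\<close>, \<open>\<alpha> = \<nu>2\<close>
  for the former and \<open>\<epsilon> = -1\<close>, \<open>\<alpha> = 2 - \<nu>2\<close> for the latter.\<close>

lemma (in hyp_bounds) boundary_spiral_asymptotics:
  fixes \<sigma> :: "real \<Rightarrow> complex" and m w W g v y lead :: "complex \<Rightarrow> complex" and \<alpha> \<epsilon> :: complex
    and X k L \<mu> :: real
  assumes X: "0 < X" "X < R" and \<epsilon>: "norm \<epsilon> = 1" and \<mu>: "0 < \<mu>" and k: "0 \<le> k" and L: "0 \<le> L"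
    and x: "\<And>t. 0 < t \<Longrightarrow> t \<le> X \<Longrightarrow> norm (exp (\<sigma> t)) = t"
    and m: "\<And>t. 0 < t \<Longrightarrow> t \<le> X \<Longrightarrow> norm (m (\<sigma> t)) = \<mu>"
    and v: "\<And>t. 0 < t \<Longrightarrow> t \<le> X \<Longrightarrow> norm (v (\<sigma> t)) \<le> L"
    and vg: "\<And>t. 0 < t \<Longrightarrow> t \<le> X \<Longrightarrow> norm (v (\<sigma> t) - g (\<sigma> t)) \<le> t / X * k"
    and w: "\<And>s. w s = m s * exp (\<alpha> * nome_rho (exp s) + 2 * \<epsilon> * \<i> * v s / hypF (exp s))"
    and w6: "\<And>t. 0 < t \<Longrightarrow> t \<le> X \<Longrightarrow> norm (w (\<sigma> t)) \<le> 1/6"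
    and W6: "\<And>t. 0 < t \<Longrightarrow> t \<le> X \<Longrightarrow> norm (W (\<sigma> t)) \<le> t / X / 6"
    and y: "\<And>t. 0 < t \<Longrightarrow> t \<le> X \<Longrightarrow>
      norm (y (\<sigma> t) - (exp (\<sigma> t) / 2 + csc2_exp (w (\<sigma> t)) + csc2_exp (W (\<sigma> t))))
        \<le> est_const * norm (exp (\<sigma> t)) * (norm (exp (\<sigma> t)) + norm (w (\<sigma> t)) + norm (W (\<sigma> t)))"
    and lead: "\<And>s. lead s = csc2_exp (m s * exp (2 * \<epsilon> * \<i> * g s))"
  shows "asymp_along \<sigma> 1 y lead"
proof -
  \<comment> \<open>What remains of the exponent of w after splitting off 2 \<epsilon> i g, by v / F
    = g + v (1/F - 1) + (v - g). Each part is O(t).\<close>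
  define \<theta> where "\<theta> = (\<lambda>t. \<alpha> * nome_rho (exp (\<sigma> t))
      + 2 * \<epsilon> * \<i> * (v (\<sigma> t) * (1 / hypF (exp (\<sigma> t)) - 1) + (v (\<sigma> t) - g (\<sigma> t))))"
  have ev: "\<forall>\<^sub>F t in at_right (0::real). P t" if "\<And>t. 0 < t \<Longrightarrow> t \<le> X \<Longrightarrow> P t" for P
    unfolding eventually_at_right_field by (rule exI[of _ X]) (use that X in auto)
  have XR: "norm (exp (\<sigma> t)) < R" if "0 < t" "t \<le> X" for t using x that X by simp
  show ?thesis
  proof (rule csc2_exp_asymptotics)
    show "\<forall>\<^sub>F t in at_right 0. norm (exp (\<sigma> t)) = t" by (rule ev[OF x])
    show "\<forall>\<^sub>F t in at_right 0. norm (y (\<sigma> t) - csc2_exp (w (\<sigma> t))) \<le> (est_const * 2 + 1/2 + 16 / (6 * X)) * t"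
    proof (rule ev)
      fix t assume t: "0 < t" "t \<le> X"
      define s where "s = \<sigma> t"
      have xs: "norm (exp s) = t" using x[OF t] by (simp add: s_def)
      have t1: "t \<le> 1" and q1: "t / X \<le> 1" using t X R by auto
      have W1: "norm (W s) \<le> 1/6" using W6[OF t] q1 by (simp add: s_def)
      have ws: "norm (w s) \<le> 1/6" using w6[OF t] by (simp add: s_def)
      have "y s - csc2_exp (w s) = (y s - (exp s / 2 + csc2_exp (w s) + csc2_exp (W s))) + (exp s / 2 + csc2_exp (W s))"
        by (simp add: algebra_simps)
      also have "norm \<dots> \<le> norm (y s - (exp s / 2 + csc2_exp (w s) + csc2_exp (W s))) + (norm (exp s / 2) + norm (csc2_exp (W s)))"
        by (intro order_trans[OF norm_triangle_ineq] add_left_mono norm_triangle_ineq)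
      also have "\<dots> \<le> est_const * t * 2 + (t / 2 + 16 * (t / X / 6))"
      proof (intro add_mono)
        have "est_const * t * (t + norm (w s) + norm (W s)) \<le> est_const * t * 2"
          using t1 W1 ws t est_const_nonneg by (intro mult_left_mono) auto
        thus "norm (y s - (exp s / 2 + csc2_exp (w s) + csc2_exp (W s))) \<le> est_const * t * 2"
          using y[OF t] xs unfolding s_def [symmetric] by simp
        show "norm (exp s / 2) \<le> t / 2" using xs by (simp add: norm_divide)
        have "norm (csc2_exp (W s)) \<le> 16 * norm (W s)" using W1 by (intro norm_csc2_exp_le) simp
        also have "\<dots> \<le> 16 * (t / X / 6)" using W6[OF t] by (simp add: s_def)
        finally show "norm (csc2_exp (W s)) \<le> 16 * (t / X / 6)" .
      qed
      also have "\<dots> = (est_const * 2 + 1/2 + 16 / (6 * X)) * t" using X by (simp add: field_simps)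
      finally show "norm (y (\<sigma> t) - csc2_exp (w (\<sigma> t))) \<le> (est_const * 2 + 1/2 + 16 / (6 * X)) * t"
        by (simp add: s_def)
    qed
    show "\<forall>\<^sub>F t in at_right 0. w (\<sigma> t) = m (\<sigma> t) * exp (2 * \<epsilon> * \<i> * g (\<sigma> t)) * exp (\<theta> t)"
    proof (rule ev)
      fix t assume t: "0 < t" "t \<le> X"
      have "2 * \<epsilon> * \<i> * g (\<sigma> t) + \<theta> t = \<alpha> * nome_rho (exp (\<sigma> t)) + 2 * \<epsilon> * \<i> * v (\<sigma> t) / hypF (exp (\<sigma> t))"
        by (simp add: \<theta>_def algebra_simps)
      thus "w (\<sigma> t) = m (\<sigma> t) * exp (2 * \<epsilon> * \<i> * g (\<sigma> t)) * exp (\<theta> t)"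
        unfolding w mult.assoc exp_add [symmetric] by (simp only: mult.assoc)
    qed
    show "\<forall>\<^sub>F t in at_right 0. norm (\<theta> t) \<le> (norm \<alpha> * K + 2 * (L * K + k / X)) * t"
    proof (rule ev)
      fix t assume t: "0 < t" "t \<le> X"
      have 1: "norm (\<alpha> * nome_rho (exp (\<sigma> t))) \<le> norm \<alpha> * (K * t)"
        unfolding norm_mult using rho_le[OF XR[OF t]] x[OF t] by (intro mult_left_mono) auto
      have "norm (v (\<sigma> t) * (1 / hypF (exp (\<sigma> t)) - 1)) \<le> L * (K * t)"
        unfolding norm_mult using inverse_hypF[OF XR[OF t]] x[OF t] v[OF t] L by (intro mult_mono) auto
      from norm_triangle_mono[OF this vg[OF t]]
      have "norm (2 * \<epsilon> * \<i> * (v (\<sigma> t) * (1 / hypF (exp (\<sigma> t)) - 1) + (v (\<sigma> t) - g (\<sigma> t)))) \<le> 2 * (L * (K * t) + t / X * k)"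
        by (simp add: norm_mult \<epsilon>)
      from norm_triangle_mono[OF 1 this]
      show "norm (\<theta> t) \<le> (norm \<alpha> * K + 2 * (L * K + k / X)) * t"
        unfolding \<theta>_def by (simp add: algebra_simps)
    qed
    show "\<forall>\<^sub>F t in at_right 0. norm (w (\<sigma> t)) \<le> 1/6" by (rule ev[OF w6])
    \<comment> \<open>As |m| = \<mu> and |g| <= L + k, the point at which \<open>csc2_exp\<close> is
      taken stays away from its zero 0.\<close>
    show "\<forall>\<^sub>F t in at_right 0. \<mu> * exp (- (2 * (L + k))) \<le> norm (m (\<sigma> t) * exp (2 * \<epsilon> * \<i> * g (\<sigma> t)))"
    proof (rule ev)
      fix t assume t: "0 < t" "t \<le> X"
      have "t / X * k \<le> 1 * k" using t X k by (intro mult_right_mono) auto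
      hence "norm (g (\<sigma> t)) \<le> L + k"
        using norm_triangle_ineq2[of "g (\<sigma> t)" "v (\<sigma> t)"] vg[OF t] v[OF t] by (simp add: norm_minus_commute)
      hence "norm (2 * \<epsilon> * \<i> * g (\<sigma> t)) \<le> 2 * (L + k)" by (simp add: norm_mult \<epsilon>)
      hence "exp (- (2 * (L + k))) \<le> exp (- norm (2 * \<epsilon> * \<i> * g (\<sigma> t)))" by simp
      also have "\<dots> \<le> norm (exp (2 * \<epsilon> * \<i> * g (\<sigma> t)))" by (rule exp_norm_lower)
      finally show "\<mu> * exp (- (2 * (L + k))) \<le> norm (m (\<sigma> t) * exp (2 * \<epsilon> * \<i> * g (\<sigma> t)))"
        unfolding norm_mult m[OF t] using \<mu> by (intro mult_left_mono) auto
    qed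
    show "0 < \<mu> * exp (- (2 * (L + k)))" using \<mu> by simp
    show "\<forall>\<^sub>F t in at_right 0. lead (\<sigma> t) = csc2_exp (m (\<sigma> t) * exp (2 * \<epsilon> * \<i> * g (\<sigma> t)))"
      by (simp add: lead)
  qed
qed

locale elliptic_solution = small_regime +
  fixes r :: real and v :: "complex \<Rightarrow> complex"
  assumes r: "0 < r" "r \<le> r0"
    and v_bound: "\<And>s. s \<in> domD r \<nu>1 \<nu>2 \<Longrightarrow> norm (v s) \<le> M * size_N \<nu>1 \<nu>2 s"
begin

lemma domD_estimates:
  assumes s: "s \<in> domD r \<nu>1 \<nu>2"
  shows "norm (v s) \<le> \<bar>M\<bar>"
    "norm (nome_w \<nu>1 \<nu>2 (v s) s) \<le> 2 * norm (monC \<nu>1 \<nu>2 s)" "norm (nome_w \<nu>1 \<nu>2 (v s) s) \<le> 1/6"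
    "norm (nome_W \<nu>1 \<nu>2 (v s) s) \<le> 2 * norm (monB \<nu>1 \<nu>2 s)" "norm (nome_W \<nu>1 \<nu>2 (v s) s) \<le> 1/6"
    "norm (ellip_y \<nu>1 \<nu>2 v s - (exp s / 2 + csc2_exp (nome_w \<nu>1 \<nu>2 (v s) s) + csc2_exp (nome_W \<nu>1 \<nu>2 (v s) s)))
      \<le> est_const * norm (exp s) * (norm (exp s) + norm (nome_w \<nu>1 \<nu>2 (v s) s) + norm (nome_W \<nu>1 \<nu>2 (v s) s))"
    "norm (ellip_y \<nu>1 \<nu>2 v s - lead1 \<nu>1 \<nu>2 s) \<le> (2 * est_const + 512 + 8 * K2) * (size_N \<nu>1 \<nu>2 s)\<^sup>2"
    "norm (exp s) < R"
proof -
  have d: "norm (exp s) < r" "norm (monB \<nu>1 \<nu>2 s) < r" "norm (monC \<nu>1 \<nu>2 s) < r"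
    using s by (auto simp: domD_def)
  have N: "size_N \<nu>1 \<nu>2 s < 3 * r0" using d r by (simp add: size_N_def)
  have x: "norm (exp s) < r0" using d r by simp
  note c = nome_close[OF x N v_bound[OF s]]
  have "M * size_N \<nu>1 \<nu>2 s \<le> \<bar>M\<bar> * 1"
    using N r0 size_N_bounds(4) by (intro mult_mono) auto
  thus "norm (v s) \<le> \<bar>M\<bar>" using v_bound[OF s] by simp
  show cw: "norm (nome_w \<nu>1 \<nu>2 (v s) s) \<le> 2 * norm (monC \<nu>1 \<nu>2 s)"
    and cW: "norm (nome_W \<nu>1 \<nu>2 (v s) s) \<le> 2 * norm (monB \<nu>1 \<nu>2 s)" using c by auto
  show w: "norm (nome_w \<nu>1 \<nu>2 (v s) s) \<le> 1/6" and W: "norm (nome_W \<nu>1 \<nu>2 (v s) s) \<le> 1/6"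
    using cw cW d r r0 by linarith+
  show xR: "norm (exp s) < R" using x r0 by simp
  show "norm (ellip_y \<nu>1 \<nu>2 v s - (exp s / 2 + csc2_exp (nome_w \<nu>1 \<nu>2 (v s) s) + csc2_exp (nome_W \<nu>1 \<nu>2 (v s) s)))
      \<le> est_const * norm (exp s) * (norm (exp s) + norm (nome_w \<nu>1 \<nu>2 (v s) s) + norm (nome_W \<nu>1 \<nu>2 (v s) s))"
    using w W by (intro ellip_y_estimate xR) auto
  show "norm (ellip_y \<nu>1 \<nu>2 v s - lead1 \<nu>1 \<nu>2 s) \<le> (2 * est_const + 512 + 8 * K2) * (size_N \<nu>1 \<nu>2 s)\<^sup>2"
    by (rule ellip_y_near_lead1[of s v, OF x N v_bound[OF s]])
qed

text \<open>Along V = 0 the monomial C keeps its modulus, whereas B shrinks like (t/X0)^2. With q =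
  t/X0, every monomial of v other than a pure power of C is at most q times its modulus at
  \<open>s0\<close>, and convergence of the expansion at \<open>s0\<close> supplies the constant
  \<open>k0\<close>.\<close>

lemma asymptotics_V0:
  assumes \<nu>: "Im \<nu>2 \<noteq> 0" and s0: "s0 \<in> domD r \<nu>1 \<nu>2"
    and expansion: "has_v_expansion a b c \<nu>1 \<nu>2 (domD r \<nu>1 \<nu>2) v"
  shows "asymp_along (spiral \<nu>2 0 s0) 1 (ellip_y \<nu>1 \<nu>2 v) (lead2 (c 0) \<nu>1 \<nu>2)"
proof -
  define X0 where "X0 = norm (exp s0)"
  define g where "g = (\<lambda>s. \<Sum>\<^sub>\<infinity>m\<in>{1..}. c 0 m * monC \<nu>1 \<nu>2 s ^ m)"
  define k0 where "k0 = ((\<Sum>\<^sub>\<infinity>n\<in>{1..}. norm (a n * exp s0 ^ n))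
     + (\<Sum>\<^sub>\<infinity>p\<in>UNIV \<times> {1..}. norm (case p of (n, m) \<Rightarrow> b n m * exp s0 ^ n * monB \<nu>1 \<nu>2 s0 ^ m))
     + (\<Sum>\<^sub>\<infinity>p\<in>{1..} \<times> {1..}. norm (case p of (n, m) \<Rightarrow> c n m * exp s0 ^ n * monC \<nu>1 \<nu>2 s0 ^ m)))"
  have k0: "0 \<le> k0" unfolding k0_def by (intro add_nonneg_nonneg infsum_nonneg) auto
  have X0: "0 < X0" "X0 < R" using domD_estimates(8)[OF s0] by (simp_all add: X0_def)
  have dom: "spiral \<nu>2 0 s0 t \<in> domD r \<nu>1 \<nu>2" if "0 < t" "t \<le> X0" for t
    by (rule spiral_in_domD) (use that \<nu> s0 in \<open>auto simp: X0_def\<close>)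
  have B: "norm (monB \<nu>1 \<nu>2 (spiral \<nu>2 0 s0 t)) \<le> t / X0 * norm (monB \<nu>1 \<nu>2 s0)" if "0 < t" "t \<le> X0" for t
  proof -
    have "(t / X0)\<^sup>2 \<le> t / X0" using that X0 by (simp add: power2_eq_square mult_le_cancel_right1 field_simps)
    hence "norm (monB \<nu>1 \<nu>2 s0) * (t / X0)\<^sup>2 \<le> norm (monB \<nu>1 \<nu>2 s0) * (t / X0)"
      by (intro mult_left_mono) auto
    thus ?thesis using spiral_norms(3)[OF \<nu> that(1), of \<nu>1 0 s0, folded X0_def] that X0
      by (simp add: powr_numeral mult.commute)
  qed
  have C: "norm (monC \<nu>1 \<nu>2 (spiral \<nu>2 0 s0 t)) = norm (monC \<nu>1 \<nu>2 s0)" if "0 < t" for t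
    using spiral_norms(2)[OF \<nu> that, of \<nu>1 0 s0] that by simp
  have x: "norm (exp (spiral \<nu>2 0 s0 t)) = t" if "0 < t" for t by (rule spiral_norms(1)[OF \<nu> that])
  show ?thesis
  proof (rule boundary_spiral_asymptotics[where X = X0 and k = k0 and L = "\<bar>M\<bar>" and \<epsilon> = 1 and \<alpha> = \<nu>2
        and \<mu> = "norm (monC \<nu>1 \<nu>2 s0)" and m = "monC \<nu>1 \<nu>2" and v = v and g = g
        and w = "\<lambda>s. nome_w \<nu>1 \<nu>2 (v s) s" and W = "\<lambda>s. nome_W \<nu>1 \<nu>2 (v s) s"])
    show "norm (v (spiral \<nu>2 0 s0 t) - g (spiral \<nu>2 0 s0 t)) \<le> t / X0 * k0" if t: "0 < t" "t \<le> X0" for t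
    proof -
      define s where "s = spiral \<nu>2 0 s0 t"
      obtain A0 B0 C0 where 0: "((\<lambda>n. a n * exp s0 ^ n) has_sum A0) {1..}"
        "((\<lambda>(n, m). b n m * exp s0 ^ n * monB \<nu>1 \<nu>2 s0 ^ m) has_sum B0) (UNIV \<times> {1..})"
        "((\<lambda>(n, m). c n m * exp s0 ^ n * monC \<nu>1 \<nu>2 s0 ^ m) has_sum C0) (UNIV \<times> {1..})"
        using expansion s0 unfolding has_v_expansion_def by blast
      obtain A1 B1 C1 where 1: "((\<lambda>n. a n * exp s ^ n) has_sum A1) {1..}"
        "((\<lambda>(n, m). b n m * exp s ^ n * monB \<nu>1 \<nu>2 s ^ m) has_sum B1) (UNIV \<times> {1..})"
        "((\<lambda>(n, m). c n m * exp s ^ n * monC \<nu>1 \<nu>2 s ^ m) has_sum C1) (UNIV \<times> {1..})"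
        "v s = A1 + B1 + C1"
        using expansion dom[OF t] unfolding has_v_expansion_def s_def by blast
      have "norm (A1 + B1 + C1 - g s) \<le> t / X0 * k0"
        unfolding g_def k0_def
      proof (rule expansion_leading_part[OF 1(1-3) has_sum_imp_summable[OF 0(1)]
            has_sum_imp_summable[OF 0(2)] has_sum_imp_summable[OF 0(3)]])
        show "norm (exp s) \<le> t / X0 * norm (exp s0)" using x[OF t(1)] X0 by (simp add: s_def X0_def)
        show "norm (monB \<nu>1 \<nu>2 s) \<le> t / X0 * norm (monB \<nu>1 \<nu>2 s0)" unfolding s_def by (rule B[OF t])
        show "norm (monC \<nu>1 \<nu>2 s) \<le> norm (monC \<nu>1 \<nu>2 s0)" using C[OF t(1)] by (simp add: s_def)
      qed (use t X0 in auto)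
      thus ?thesis by (simp add: 1(4) s_def [symmetric])
    qed
    show "norm (nome_W \<nu>1 \<nu>2 (v (spiral \<nu>2 0 s0 t)) (spiral \<nu>2 0 s0 t)) \<le> t / X0 / 6" if t: "0 < t" "t \<le> X0" for t
    proof -
      have "norm (monB \<nu>1 \<nu>2 s0) \<le> 1/12" using s0 r r0 by (simp add: domD_def)
      hence "t / X0 * norm (monB \<nu>1 \<nu>2 s0) \<le> t / X0 * (1/12)" using t X0 by (intro mult_left_mono) auto
      with B[OF t] have "2 * norm (monB \<nu>1 \<nu>2 (spiral \<nu>2 0 s0 t)) \<le> 2 * (t / X0 * (1/12))"
        by (intro mult_left_mono) auto
      from order_trans[OF domD_estimates(4)[OF dom[OF t]] this] show ?thesis by simp
    qed
    show "norm (ellip_y \<nu>1 \<nu>2 v (spiral \<nu>2 0 s0 t) - (exp (spiral \<nu>2 0 s0 t) / 2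
        + csc2_exp (nome_w \<nu>1 \<nu>2 (v (spiral \<nu>2 0 s0 t)) (spiral \<nu>2 0 s0 t))
        + csc2_exp (nome_W \<nu>1 \<nu>2 (v (spiral \<nu>2 0 s0 t)) (spiral \<nu>2 0 s0 t))))
      \<le> est_const * norm (exp (spiral \<nu>2 0 s0 t)) * (norm (exp (spiral \<nu>2 0 s0 t))
        + norm (nome_w \<nu>1 \<nu>2 (v (spiral \<nu>2 0 s0 t)) (spiral \<nu>2 0 s0 t))
        + norm (nome_W \<nu>1 \<nu>2 (v (spiral \<nu>2 0 s0 t)) (spiral \<nu>2 0 s0 t)))" if t: "0 < t" "t \<le> X0" for t
      by (rule domD_estimates(6)[OF dom[OF t]])
    show "lead2 (c 0) \<nu>1 \<nu>2 s = csc2_exp (monC \<nu>1 \<nu>2 s * exp (2 * 1 * \<i> * g s))" for s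
      unfolding lead2_csc2_exp g_def by simp
    show "norm (monC \<nu>1 \<nu>2 (spiral \<nu>2 0 s0 t)) = norm (monC \<nu>1 \<nu>2 s0)" if "0 < t" for t by (rule C[OF that])
    show "nome_w \<nu>1 \<nu>2 (v s) s = monC \<nu>1 \<nu>2 s * exp (\<nu>2 * nome_rho (exp s) + 2 * 1 * \<i> * v s / hypF (exp s))" for s
      by (simp add: nome_w_def)
  qed (use X0 k0 x domD_estimates dom in auto)
qed

text \<open>Mirror image of V = 0: B keeps its modulus, C decays, and the families b and c exchange
  roles. The sign \<epsilon> = -1 reflects that v enters \<open>nome_W\<close> with a minus.\<close>

lemma asymptotics_V2:
  assumes \<nu>: "Im \<nu>2 \<noteq> 0" and s0: "s0 \<in> domD r \<nu>1 \<nu>2"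
    and expansion: "has_v_expansion a b c \<nu>1 \<nu>2 (domD r \<nu>1 \<nu>2) v"
  shows "asymp_along (spiral \<nu>2 2 s0) 1 (ellip_y \<nu>1 \<nu>2 v) (lead3 (b 0) \<nu>1 \<nu>2)"
proof -
  define X0 where "X0 = norm (exp s0)"
  define g where "g = (\<lambda>s. \<Sum>\<^sub>\<infinity>m\<in>{1..}. b 0 m * monB \<nu>1 \<nu>2 s ^ m)"
  define k0 where "k0 = ((\<Sum>\<^sub>\<infinity>n\<in>{1..}. norm (a n * exp s0 ^ n))
     + (\<Sum>\<^sub>\<infinity>p\<in>UNIV \<times> {1..}. norm (case p of (n, m) \<Rightarrow> c n m * exp s0 ^ n * monC \<nu>1 \<nu>2 s0 ^ m))
     + (\<Sum>\<^sub>\<infinity>p\<in>{1..} \<times> {1..}. norm (case p of (n, m) \<Rightarrow> b n m * exp s0 ^ n * monB \<nu>1 \<nu>2 s0 ^ m)))"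
  have k0: "0 \<le> k0" unfolding k0_def by (intro add_nonneg_nonneg infsum_nonneg) auto
  have X0: "0 < X0" "X0 < R" using domD_estimates(8)[OF s0] by (simp_all add: X0_def)
  have dom: "spiral \<nu>2 2 s0 t \<in> domD r \<nu>1 \<nu>2" if "0 < t" "t \<le> X0" for t
    by (rule spiral_in_domD) (use that \<nu> s0 in \<open>auto simp: X0_def\<close>)
  have C: "norm (monC \<nu>1 \<nu>2 (spiral \<nu>2 2 s0 t)) \<le> t / X0 * norm (monC \<nu>1 \<nu>2 s0)" if "0 < t" "t \<le> X0" for t
  proof -
    have "(t / X0)\<^sup>2 \<le> t / X0" using that X0 by (simp add: power2_eq_square mult_le_cancel_right1 field_simps)
    hence "norm (monC \<nu>1 \<nu>2 s0) * (t / X0)\<^sup>2 \<le> norm (monC \<nu>1 \<nu>2 s0) * (t / X0)"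
      by (intro mult_left_mono) auto
    thus ?thesis using spiral_norms(2)[OF \<nu> that(1), of \<nu>1 2 s0, folded X0_def] that X0
      by (simp add: powr_numeral mult.commute)
  qed
  have B: "norm (monB \<nu>1 \<nu>2 (spiral \<nu>2 2 s0 t)) = norm (monB \<nu>1 \<nu>2 s0)" if "0 < t" for t
    using spiral_norms(3)[OF \<nu> that, of \<nu>1 2 s0] that by simp
  have x: "norm (exp (spiral \<nu>2 2 s0 t)) = t" if "0 < t" for t by (rule spiral_norms(1)[OF \<nu> that])
  show ?thesis
  proof (rule boundary_spiral_asymptotics[where X = X0 and k = k0 and L = "\<bar>M\<bar>" and \<epsilon> = "-1" and \<alpha> = "2 - \<nu>2"
        and \<mu> = "norm (monB \<nu>1 \<nu>2 s0)" and m = "monB \<nu>1 \<nu>2" and v = v and g = g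
        and w = "\<lambda>s. nome_W \<nu>1 \<nu>2 (v s) s" and W = "\<lambda>s. nome_w \<nu>1 \<nu>2 (v s) s"])
    show "norm (v (spiral \<nu>2 2 s0 t) - g (spiral \<nu>2 2 s0 t)) \<le> t / X0 * k0" if t: "0 < t" "t \<le> X0" for t
    proof -
      define s where "s = spiral \<nu>2 2 s0 t"
      obtain A0 B0 C0 where 0: "((\<lambda>n. a n * exp s0 ^ n) has_sum A0) {1..}"
        "((\<lambda>(n, m). b n m * exp s0 ^ n * monB \<nu>1 \<nu>2 s0 ^ m) has_sum B0) (UNIV \<times> {1..})"
        "((\<lambda>(n, m). c n m * exp s0 ^ n * monC \<nu>1 \<nu>2 s0 ^ m) has_sum C0) (UNIV \<times> {1..})"
        using expansion s0 unfolding has_v_expansion_def by blast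
      obtain A1 B1 C1 where 1: "((\<lambda>n. a n * exp s ^ n) has_sum A1) {1..}"
        "((\<lambda>(n, m). b n m * exp s ^ n * monB \<nu>1 \<nu>2 s ^ m) has_sum B1) (UNIV \<times> {1..})"
        "((\<lambda>(n, m). c n m * exp s ^ n * monC \<nu>1 \<nu>2 s ^ m) has_sum C1) (UNIV \<times> {1..})"
        "v s = A1 + B1 + C1"
        using expansion dom[OF t] unfolding has_v_expansion_def s_def by blast
      have "norm (A1 + C1 + B1 - g s) \<le> t / X0 * k0"
        unfolding g_def k0_def
      proof (rule expansion_leading_part[OF 1(1,3,2) has_sum_imp_summable[OF 0(1)]
            has_sum_imp_summable[OF 0(3)] has_sum_imp_summable[OF 0(2)]])
        show "norm (exp s) \<le> t / X0 * norm (exp s0)" using x[OF t(1)] X0 by (simp add: s_def X0_def)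
        show "norm (monC \<nu>1 \<nu>2 s) \<le> t / X0 * norm (monC \<nu>1 \<nu>2 s0)" unfolding s_def by (rule C[OF t])
        show "norm (monB \<nu>1 \<nu>2 s) \<le> norm (monB \<nu>1 \<nu>2 s0)" using B[OF t(1)] by (simp add: s_def)
      qed (use t X0 in auto)
      thus ?thesis by (simp add: 1(4) s_def [symmetric] algebra_simps)
    qed
    show "norm (nome_w \<nu>1 \<nu>2 (v (spiral \<nu>2 2 s0 t)) (spiral \<nu>2 2 s0 t)) \<le> t / X0 / 6" if t: "0 < t" "t \<le> X0" for t
    proof -
      have "norm (monC \<nu>1 \<nu>2 s0) \<le> 1/12" using s0 r r0 by (simp add: domD_def)
      hence "t / X0 * norm (monC \<nu>1 \<nu>2 s0) \<le> t / X0 * (1/12)" using t X0 by (intro mult_left_mono) auto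
      with C[OF t] have "2 * norm (monC \<nu>1 \<nu>2 (spiral \<nu>2 2 s0 t)) \<le> 2 * (t / X0 * (1/12))"
        by (intro mult_left_mono) auto
      from order_trans[OF domD_estimates(2)[OF dom[OF t]] this] show ?thesis by simp
    qed
    show "norm (ellip_y \<nu>1 \<nu>2 v (spiral \<nu>2 2 s0 t) - (exp (spiral \<nu>2 2 s0 t) / 2
        + csc2_exp (nome_W \<nu>1 \<nu>2 (v (spiral \<nu>2 2 s0 t)) (spiral \<nu>2 2 s0 t))
        + csc2_exp (nome_w \<nu>1 \<nu>2 (v (spiral \<nu>2 2 s0 t)) (spiral \<nu>2 2 s0 t))))
      \<le> est_const * norm (exp (spiral \<nu>2 2 s0 t)) * (norm (exp (spiral \<nu>2 2 s0 t))
        + norm (nome_W \<nu>1 \<nu>2 (v (spiral \<nu>2 2 s0 t)) (spiral \<nu>2 2 s0 t))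
        + norm (nome_w \<nu>1 \<nu>2 (v (spiral \<nu>2 2 s0 t)) (spiral \<nu>2 2 s0 t)))" if t: "0 < t" "t \<le> X0" for t
      using domD_estimates(6)[OF dom[OF t]] by (simp only: add_ac)
    show "lead3 (b 0) \<nu>1 \<nu>2 s = csc2_exp (monB \<nu>1 \<nu>2 s * exp (2 * (- 1) * \<i> * g s))" for s
      unfolding lead3_csc2_exp g_def by simp
    show "norm (monB \<nu>1 \<nu>2 (spiral \<nu>2 2 s0 t)) = norm (monB \<nu>1 \<nu>2 s0)" if "0 < t" for t by (rule B[OF that])
    show "nome_W \<nu>1 \<nu>2 (v s) s = monB \<nu>1 \<nu>2 s * exp ((2 - \<nu>2) * nome_rho (exp s) + 2 * (- 1) * \<i> * v s / hypF (exp s))" for s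
      by (simp add: nome_W_def)
  qed (use X0 k0 x domD_estimates dom in auto)
qed

end

section \<open>The degenerate exponent\<close>

text \<open>X stands for x^m, and the equation for Y = x^(m+2) g is divided by it. As Y - x = x
  \<open>d2\<close>, where \<open>d2\<close> will tend to -1, the poles at x = 0 cancel and the
  right-hand side becomes continuous there.\<close>

lemma PVI_scaled_identity:
  fixes x X g P Q d1 d2 \<kappa> Y Y' Y'' :: complex
  assumes nz: "x \<noteq> 0" "X \<noteq> 0" "x \<noteq> 1" "g \<noteq> 0"
    and Y: "Y = x\<^sup>2 * X * g" "Y' = x * X * P" "Y'' = X * Q"
    and d1: "d1 = Y - 1" "d1 \<noteq> 0" and d2: "d2 = x * X * g - 1" "d2 \<noteq> 0"
    and eq: "Y'' = 1/2 * (1/Y + 1/(Y - 1) + 1/(Y - x)) * Y'\<^sup>2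
            - (1/x + 1/(x - 1) + 1/(Y - x)) * Y'
            + 1/2 * (Y * (Y - 1) * (Y - x)) / (x\<^sup>2 * (x - 1)\<^sup>2)
              * (\<kappa> + x * (x - 1) / (Y - x)\<^sup>2)"
  shows "Q = (1/2 * P\<^sup>2 / g + 1/2 * (x\<^sup>2 * X * P\<^sup>2) / d1 + 1/2 * (x * X * P\<^sup>2) / d2)
     - (x * X * g * P / d2 + x * P / (x - 1))
     + 1/2 * g * d1 * d2 / (x - 1)\<^sup>2 * (\<kappa> * x + (x - 1) / d2\<^sup>2)"
proof -
  have Yx: "Y - x = x * d2" unfolding Y(1) d2(1) by (simp add: power2_eq_square algebra_simps)
  have x1: "x - 1 \<noteq> 0" using nz by simp
  have t1: "1/2 * (1/Y + 1/(Y - 1) + 1/(Y - x)) * Y'\<^sup>2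
     = X * (1/2 * P\<^sup>2 / g + 1/2 * (x\<^sup>2 * X * P\<^sup>2) / d1 + 1/2 * (x * X * P\<^sup>2) / d2)"
    unfolding Yx d1(1) [symmetric] unfolding Y using nz d1(2) d2(2)
    by (simp add: field_simps power2_eq_square)
  \<comment> \<open>The pole of 1/x is compensated by 1/(Y - x), because Y has higher order than
    x.\<close>
  have "1/x + 1/(Y - x) = X * g / d2"
    unfolding Yx using nz d2(2) by (simp add: field_simps) (simp add: d2(1) algebra_simps)
  hence e: "1/x + 1/(x - 1) + 1/(Y - x) = X * g / d2 + 1/(x - 1)" by (simp add: algebra_simps)
  have t2: "(1/x + 1/(x - 1) + 1/(Y - x)) * Y' = X * (x * X * g * P / d2 + x * P / (x - 1))"
    unfolding e Y(2) by (simp add: algebra_simps)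
  have t3a: "\<kappa> + x * (x - 1) / (Y - x)\<^sup>2 = (\<kappa> * x + (x - 1) / d2\<^sup>2) / x"
    unfolding Yx using nz d2(2) by (simp add: field_simps power2_eq_square)
  have t3b: "1/2 * (Y * (Y - 1) * (Y - x)) / (x\<^sup>2 * (x - 1)\<^sup>2) = x * X * (1/2 * g * d1 * d2 / (x - 1)\<^sup>2)"
  proof -
    have "1/2 * (Y * d1 * (x * d2)) / (x\<^sup>2 * (x - 1)\<^sup>2) = (x\<^sup>2 * (x * X * (1/2 * g * d1 * d2))) / (x\<^sup>2 * (x - 1)\<^sup>2)"
      unfolding Y(1) by (simp add: mult_ac)
    also have "\<dots> = x * X * (1/2 * g * d1 * d2) / (x - 1)\<^sup>2" using nz(1) by (intro mult_divide_mult_cancel_left) simp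
    finally show ?thesis unfolding Yx d1(1) [symmetric] by simp
  qed
  have t3: "1/2 * (Y * (Y - 1) * (Y - x)) / (x\<^sup>2 * (x - 1)\<^sup>2) * (\<kappa> + x * (x - 1) / (Y - x)\<^sup>2)
     = X * (1/2 * g * d1 * d2 / (x - 1)\<^sup>2 * (\<kappa> * x + (x - 1) / d2\<^sup>2))"
    unfolding t3a t3b using nz by simp
  have "X * Q = X * ((1/2 * P\<^sup>2 / g + 1/2 * (x\<^sup>2 * X * P\<^sup>2) / d1 + 1/2 * (x * X * P\<^sup>2) / d2)
     - (x * X * g * P / d2 + x * P / (x - 1))
     + 1/2 * g * d1 * d2 / (x - 1)\<^sup>2 * (\<kappa> * x + (x - 1) / d2\<^sup>2))"
    using eq unfolding t1 t2 t3 Y(3) by (simp only: distrib_left right_diff_distrib)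
  thus ?thesis using nz by (simp only: mult_cancel_left) blast
qed

text \<open>Comparing the coefficients of \<open>x\<^sup>m\<close> for a solution \<open>y = x\<^sup>m\<^sup>+\<^sup>2 g\<close> gives \<open>p (p - 1) = (p\<^sup>2 - 1) / 2\<close> with
  \<open>p = m + 2\<close>, whose only root is \<open>p = 1\<close>.\<close>

lemma PVI_no_high_order_zero:
  fixes g :: "complex \<Rightarrow> complex" and \<kappa> :: complex
  assumes \<rho>: "0 < \<rho>" and g: "g holomorphic_on ball 0 \<rho>" and g0: "g 0 \<noteq> 0"
    and Y: "\<And>x. x \<in> ball 0 \<rho> \<Longrightarrow> Y x = x ^ (m + 2) * g x"
    and PVI: "\<forall>\<^sub>F x in at 0. Y x \<noteq> 0 \<and> Y x \<noteq> 1 \<and> Y x \<noteq> x \<longrightarrow>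
      deriv (deriv Y) x = 1/2 * (1/Y x + 1/(Y x - 1) + 1/(Y x - x)) * (deriv Y x)\<^sup>2
            - (1/x + 1/(x - 1) + 1/(Y x - x)) * deriv Y x
            + 1/2 * (Y x * (Y x - 1) * (Y x - x)) / (x\<^sup>2 * (x - 1)\<^sup>2)
              * (\<kappa> + x * (x - 1) / (Y x - x)\<^sup>2)"
  shows False
proof -
  define p :: complex where "p = of_nat (m + 2)"
  define g1 where "g1 = deriv g"
  define g2 where "g2 = deriv g1"
  define P where "P = (\<lambda>x. p * g x + x * g1 x)"
  define Q where "Q = (\<lambda>x. (p - 1) * P x + x * (p * g1 x + g1 x + x * g2 x))"
  define d1 where "d1 = (\<lambda>x. x\<^sup>2 * x ^ m * g x - 1)"
  define d2 where "d2 = (\<lambda>x. x * x ^ m * g x - 1)"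
  have dg: "(g has_field_derivative g1 x) (at x)" if "x \<in> ball 0 \<rho>" for x
    unfolding g1_def by (rule holomorphic_derivI[OF g]) (use that in auto)
  have hg1: "g1 holomorphic_on ball 0 \<rho>" unfolding g1_def by (intro holomorphic_deriv g) auto
  have dg1: "(g1 has_field_derivative g2 x) (at x)" if "x \<in> ball 0 \<rho>" for x
    unfolding g2_def by (rule holomorphic_derivI[OF hg1]) (use that in auto)
  have hg2: "g2 holomorphic_on ball 0 \<rho>" unfolding g2_def by (intro holomorphic_deriv hg1) auto
  have cg: "isCont g 0" "isCont g1 0" "isCont g2 0"
    using holomorphic_on_imp_continuous_on[OF g] holomorphic_on_imp_continuous_on[OF hg1]
      holomorphic_on_imp_continuous_on[OF hg2] \<rho>
    by (auto simp: continuous_on_eq_continuous_at)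
  have Y1: "deriv Y x = x * x ^ m * P x" if x: "x \<in> ball 0 \<rho>" for x
  proof (rule DERIV_imp_deriv, rule has_field_derivative_transform_within_open)
    show "((\<lambda>x. x ^ (m + 2) * g x) has_field_derivative x * x ^ m * P x) (at x)"
      by (rule derivative_eq_intros dg[OF x] refl)+ (simp add: P_def p_def algebra_simps)
    show "open (ball (0::complex) \<rho>)" by simp
  qed (use x Y in auto)
  have Y2: "deriv (deriv Y) x = x ^ m * Q x" if x: "x \<in> ball 0 \<rho>" for x
  proof (rule DERIV_imp_deriv, rule has_field_derivative_transform_within_open)
    show "((\<lambda>x. x ^ (Suc m) * P x) has_field_derivative x ^ m * Q x) (at x)"
      unfolding P_def
      by (rule derivative_eq_intros dg[OF x] dg1[OF x] refl)+ (simp add: Q_def P_def p_def algebra_simps)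
    show "open (ball (0::complex) \<rho>)" by simp
  qed (use x Y1 in auto)
  define \<Phi> where "\<Phi> = (\<lambda>x. (1/2 * (P x)\<^sup>2 / g x + 1/2 * (x\<^sup>2 * x ^ m * (P x)\<^sup>2) / d1 x + 1/2 * (x * x ^ m * (P x)\<^sup>2) / d2 x)
     - (x * x ^ m * g x * P x / d2 x + x * P x / (x - 1))
     + 1/2 * g x * d1 x * d2 x / (x - 1)\<^sup>2 * (\<kappa> * x + (x - 1) / (d2 x)\<^sup>2))"
  have cP: "isCont P 0" and cQ: "isCont Q 0" and cd: "isCont d1 0" "isCont d2 0"
    unfolding P_def Q_def d1_def d2_def using cg by (auto intro!: continuous_intros)
  have d0: "d1 0 = -1" "d2 0 = -1" by (simp_all add: d1_def d2_def)
  have c\<Phi>: "isCont \<Phi> 0"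
    unfolding \<Phi>_def using cg cP cd g0 d0 by (intro continuous_intros) auto
  have "\<forall>\<^sub>F x in at 0. g x \<noteq> 0" "\<forall>\<^sub>F x in at 0. d1 x \<noteq> 0" "\<forall>\<^sub>F x in at 0. d2 x \<noteq> 0"
    using cg(1) cd g0 d0 by (auto intro!: tendsto_imp_eventually_ne simp: isCont_def)
  moreover have "\<forall>\<^sub>F x in at (0::complex). x \<in> ball 0 \<rho> - {0}"
    by (rule eventually_at_in_open) (use \<rho> in auto)
  moreover have "\<forall>\<^sub>F x in at (0::complex). x \<in> ball 0 1 - {0}"
    by (rule eventually_at_in_open) auto
  ultimately have "\<forall>\<^sub>F x in at 0. Q x = \<Phi> x"
    using PVI
  proof eventually_elim
    case (elim x)
    have x: "x \<noteq> 0" "x \<in> ball 0 \<rho>" "x \<noteq> 1" "x ^ m \<noteq> 0" using elim by auto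
    have Yx: "Y x = x\<^sup>2 * x ^ m * g x" using Y[OF x(2)] by (simp add: power2_eq_square mult_ac)
    have ne: "Y x \<noteq> 0" "Y x \<noteq> 1" "Y x \<noteq> x"
      using elim x unfolding Yx by (auto simp: d1_def d2_def power2_eq_square mult.assoc)
    show ?case
      unfolding \<Phi>_def
    proof (rule PVI_scaled_identity[OF x(1,4,3) elim(1) Yx Y1[OF x(2)] Y2[OF x(2)]])
      show "d1 x = Y x - 1" by (simp add: d1_def Yx)
      show "d2 x = x * x ^ m * g x - 1" by (simp add: d2_def)
    qed (use elim ne in auto)
  qed
  hence "\<forall>\<^sub>F x in at 0. \<Phi> x = Q x" by (rule eventually_mono) simp
  moreover have "(\<Phi> \<longlongrightarrow> \<Phi> 0) (at 0)" using c\<Phi> by (simp add: isCont_def)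
  ultimately have "(Q \<longlongrightarrow> \<Phi> 0) (at 0)" by (rule Lim_transform_eventually[rotated])
  moreover have "(Q \<longlongrightarrow> Q 0) (at 0)" using cQ by (simp add: isCont_def)
  ultimately have "\<Phi> 0 = Q 0" by (intro tendsto_unique[of "at (0::complex)"]) auto
  \<comment> \<open>At x = 0 the right-hand side reduces to P^2/(2 g) - g/2. The second term stems
    from x (x - 1)/(Y - x)^2, while \<kappa> is multiplied by x.\<close>
  hence "(p - 1) * (p * g 0) = 1/2 * (p * g 0)\<^sup>2 / g 0 - 1/2 * g 0"
    by (simp add: \<Phi>_def Q_def d0 P_def)
  also have "\<dots> = (1/2 * p\<^sup>2 - 1/2) * g 0" using g0 by (simp add: power2_eq_square field_simps)
  finally have "((p - 1) * p - (1/2 * p\<^sup>2 - 1/2)) * g 0 = 0"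
    unfolding left_diff_distrib[of "(p - 1) * p"] by (simp only: mult.assoc diff_self)
  hence z: "(p - 1) * p - (1/2 * p\<^sup>2 - 1/2) = 0" using g0 by simp
  \<comment> \<open>The quadratic has the double root p = 1, while p = m + 2 >= 2.\<close>
  have "(p - 1)\<^sup>2 = 2 * ((p - 1) * p - (1/2 * p\<^sup>2 - 1/2))" by (simp add: power2_eq_square algebra_simps)
  hence "(p - 1)\<^sup>2 = 0" unfolding z by simp
  hence "p = 1" by simp
  hence "of_nat (m + 2) = (of_nat 1 :: complex)" by (simp only: p_def of_nat_1)
  thus False unfolding of_nat_eq_iff by simp
qed

section \<open>Holomorphy of the solution and descent to the punctured disc\<close>

lemma holomorphic_csc2_exp:
  assumes "f holomorphic_on S" "\<And>s. s \<in> S \<Longrightarrow> f s \<noteq> 1"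
  shows "(\<lambda>s. csc2_exp (f s)) holomorphic_on S"
  unfolding csc2_exp_def by (intro holomorphic_intros assms) (use assms in auto)

text \<open>Weierstrass M-test with majorant 24 * 2^(-n). The arguments of \<open>csc2_exp\<close>
  have modulus at most 1/2, which keeps them off its pole 1.\<close>

lemma holomorphic_nome_tail_sum:
  assumes S: "open S" and hol: "w holomorphic_on S" "W holomorphic_on S" "p holomorphic_on S"
    and small: "\<And>s. s \<in> S \<Longrightarrow> norm (w s) \<le> 1/2" "\<And>s. s \<in> S \<Longrightarrow> norm (W s) \<le> 1/2"
      "\<And>s. s \<in> S \<Longrightarrow> norm (p s) \<le> 1/2"
  shows "(\<lambda>s. suminf (nome_tail (w s) (W s) (p s))) holomorphic_on S"
proof (rule holomorphic_uniform_sequence[OF S])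
  have ne: "t * q ^ k \<noteq> 1" if "norm t \<le> 1/2" "norm q \<le> 1/2" for t q :: complex and k
  proof
    assume "t * q ^ k = 1"
    hence "norm t * norm q ^ k = 1" by (metis norm_mult norm_one norm_power)
    moreover have "norm t * norm q ^ k \<le> 1/2 * 1"
      using that by (intro mult_mono power_le_one) auto
    ultimately show False by simp
  qed
  show "(\<lambda>s. \<Sum>k<n. nome_tail (w s) (W s) (p s) k) holomorphic_on S" for n
    unfolding nome_tail_def
  proof (intro holomorphic_intros holomorphic_csc2_exp hol)
    fix s k assume s: "s \<in> S"
    show "w s * p s ^ Suc k \<noteq> 1" "W s * p s ^ Suc k \<noteq> 1" using small[OF s] ne by blast+
    show "p s ^ Suc k \<noteq> 1" using small(3)[OF s] ne[of "p s" "p s" k] by simp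
  qed
  fix s assume "s \<in> S"
  then obtain d where d: "d > 0" "cball s d \<subseteq> S" using S open_contains_cball by blast
  have "uniform_limit (cball s d) (\<lambda>n s. \<Sum>k<n. nome_tail (w s) (W s) (p s) k)
      (\<lambda>s. suminf (nome_tail (w s) (W s) (p s))) sequentially"
  proof (rule Weierstrass_m_test)
    fix n u assume "u \<in> cball s d"
    hence u: "u \<in> S" using d by auto
    have "norm (nome_tail (w u) (W u) (p u) n) \<le> 48 * norm (p u) * norm (p u) ^ n"
      by (rule norm_nome_tail_le) (use small[OF u] in auto)
    also have "\<dots> \<le> 48 * (1/2) * (1/2) ^ n"
      using small(3)[OF u] by (intro mult_mono power_mono) auto
    finally show "norm (nome_tail (w u) (W u) (p u) n) \<le> 24 * (1/2) ^ n" by simp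
  next
    show "summable (\<lambda>n. 24 * (1/2 :: real) ^ n)" by (intro summable_mult summable_geometric) auto
  qed
  thus "\<exists>d>0. cball s d \<subseteq> S \<and> uniform_limit (cball s d)
      (\<lambda>n s. \<Sum>k<n. nome_tail (w s) (W s) (p s) k) (\<lambda>s. suminf (nome_tail (w s) (W s) (p s))) sequentially"
    using d by blast
qed

lemma open_domD: "open (domD r \<nu>1 \<nu>2)"
proof -
  have "domD r \<nu>1 \<nu>2 = {s. norm (exp s) < r} \<inter> {s. norm (monB \<nu>1 \<nu>2 s) < r} \<inter> {s. norm (monC \<nu>1 \<nu>2 s) < r}"
    by (auto simp: domD_def)
  thus ?thesis unfolding monB_exp monC_exp
    by (auto intro!: open_Int open_Collect_less continuous_intros)
qed

text \<open>Since |w| and |W| are at most 1/6, the nome series represents y on the whole domain and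
  avoids the pole of \<open>csc2_exp\<close>.\<close>

lemma (in elliptic_solution) holomorphic_ellip_y:
  assumes v: "v holomorphic_on domD r \<nu>1 \<nu>2"
  shows "ellip_y \<nu>1 \<nu>2 v holomorphic_on domD r \<nu>1 \<nu>2"
proof -
  let ?S = "domD r \<nu>1 \<nu>2"
  define w where "w = (\<lambda>s. nome_w \<nu>1 \<nu>2 (v s) s)"
  define W where "W = (\<lambda>s. nome_W \<nu>1 \<nu>2 (v s) s)"
  have eh: "(\<lambda>s. f (exp s)) holomorphic_on ?S" if "f holomorphic_on ball 0 R" for f
    by (rule holomorphic_on_compose_gen[OF holomorphic_on_exp that, unfolded o_def])
      (use domD_estimates(8) in auto)
  have F: "(\<lambda>s. hypF (exp s)) holomorphic_on ?S" by (rule eh[OF holomorphic_hypF])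
  have F0: "hypF (exp s) \<noteq> 0" if "s \<in> ?S" for s using hypF_nonzero domD_estimates(8)[OF that] by simp
  note hs = holomorphic_intros v F eh[OF holomorphic_rho]
  have w: "w holomorphic_on ?S" and W: "W holomorphic_on ?S"
    unfolding w_def W_def nome_w_def nome_W_def monC_exp monB_exp
    by (intro hs; use F0 in simp)+
  have sm: "norm (w s) \<le> 1/6" "norm (W s) \<le> 1/6" if "s \<in> ?S" for s
    using domD_estimates(3,5)[OF that] by (auto simp: w_def W_def)
  have smp: "norm (w s * W s) \<le> 1/2" if "s \<in> ?S" for s
  proof -
    have "norm (w s) * norm (W s) \<le> 1/6 * (1/6)" using sm[OF that] by (intro mult_mono) auto
    thus ?thesis by (simp add: norm_mult)
  qed
  have T: "(\<lambda>s. suminf (nome_tail (w s) (W s) (w s * W s))) holomorphic_on ?S"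
    by (intro holomorphic_nome_tail_sum open_domD w W holomorphic_on_mult smp order_trans[OF sm(1)] order_trans[OF sm(2)]) auto
  have ne: "w s \<noteq> 1" "W s \<noteq> 1" if "s \<in> ?S" for s using sm[OF that] by auto
  have "(\<lambda>s. (1 / hypF (exp s))\<^sup>2 * (- 1/3 + csc2_exp (w s) + csc2_exp (W s)
       + suminf (nome_tail (w s) (W s) (w s * W s))) + (1 + exp s) / 3) holomorphic_on ?S"
    by (intro hs holomorphic_csc2_exp w W T) (use F0 ne in auto)
  thus ?thesis
  proof (rule holomorphic_transform)
    fix s assume s: "s \<in> ?S"
    show "(1 / hypF (exp s))\<^sup>2 * (- 1/3 + csc2_exp (w s) + csc2_exp (W s)
       + suminf (nome_tail (w s) (W s) (w s * W s))) + (1 + exp s) / 3 = ellip_y \<nu>1 \<nu>2 v s"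
      unfolding w_def W_def
      by (rule ellip_y_nome_series[of s \<nu>1 \<nu>2 v, symmetric]) (use domD_estimates[OF s] in auto)
  qed
qed

text \<open>\<open>Ln\<close> jumps across the negative axis. Near x it is replaced by the branch Ln
  x + Ln (u/x), holomorphic while u/x is off that axis; as f depends on exp s alone, the choice of
  branch is invisible.\<close>

lemma holomorphic_on_punctured_ball_of_exp:
  assumes f: "f holomorphic_on {s. norm (exp s) < r}"
    and cong: "\<And>s s'. norm (exp s) < r \<Longrightarrow> exp s = exp s' \<Longrightarrow> f s = f s'"
  shows "(\<lambda>x. f (Ln x)) holomorphic_on ball 0 r - {0}"
  unfolding holomorphic_on_def
proof
  fix x :: complex assume x: "x \<in> ball 0 r - {0}"
  define T where "T = (ball 0 r - {0}) \<inter> (\<lambda>u. u / x) -` (- \<real>\<^sub>\<le>\<^sub>0)"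
  have "open T" unfolding T_def using x
    by (intro open_Int open_vimage open_Diff continuous_intros open_Compl closed_nonpos_Reals_complex) auto
  have xT: "x \<in> T" using x by (auto simp: T_def)
  define L where "L = (\<lambda>u. Ln x + Ln (u / x))"
  have ex: "exp (L u) = u" if "u \<in> T" for u
    using that x by (auto simp: L_def T_def exp_add)
  have hL: "L holomorphic_on T" unfolding L_def
    by (intro holomorphic_intros) (use x in \<open>auto simp: T_def\<close>)
  have "(\<lambda>u. f (L u)) holomorphic_on T"
  proof (rule holomorphic_on_compose_gen[OF hL f, unfolded o_def], rule subsetI)
    fix z assume "z \<in> L ` T"
    then obtain u where u: "u \<in> T" "z = L u" by blast
    thus "z \<in> {s. norm (exp s) < r}" unfolding u(2) mem_Collect_eq ex[OF u(1)] by (simp add: T_def)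
  qed
  hence "(\<lambda>u. f (Ln u)) holomorphic_on T"
  proof (rule holomorphic_transform)
    fix u assume u: "u \<in> T"
    show "f (L u) = f (Ln u)" by (rule cong) (use u ex[OF u] in \<open>auto simp: T_def\<close>)
  qed
  hence "(\<lambda>u. f (Ln u)) field_differentiable (at x)"
    using \<open>open T\<close> xT by (simp add: holomorphic_on_imp_differentiable_at)
  thus "(\<lambda>u. f (Ln u)) field_differentiable (at x within ball 0 r - {0})"
    by (rule field_differentiable_at_within)
qed

text \<open>Here \<open>lead1\<close> is identically zero, so its relative error bound can only hold if \<open>y\<close> vanishes. The
  expansion enters through its consequence that \<open>v\<close>, hence \<open>y\<close>, depends on \<open>exp s\<close> alone.\<close>

lemma (in elliptic_solution) ellip_y_eq_0_if_lead1_eq_0: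
  assumes \<nu>2: "\<nu>2 = 1" and A: "coefA \<nu>1 \<nu>2 = 1"
    and v: "v holomorphic_on domD r \<nu>1 \<nu>2"
    and expansion: "has_v_expansion a b c \<nu>1 \<nu>2 (domD r \<nu>1 \<nu>2) v"
    and PVI: "solves_PVI \<mu> (domD r \<nu>1 \<nu>2) (ellip_y \<nu>1 \<nu>2 v)"
    and s: "s \<in> domD r \<nu>1 \<nu>2"
  shows "ellip_y \<nu>1 \<nu>2 v s = 0"
proof -
  define y where "y = ellip_y \<nu>1 \<nu>2 v"
  \<comment> \<open>E is identically 1 here, so B = C = x/16. Both monomials are thus functions of
    x, and the domain reduces to |x| < r.\<close>
  have CB: "monC \<nu>1 \<nu>2 s = exp s / 16" "monB \<nu>1 \<nu>2 s = exp s / 16" for s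
  proof -
    have "xpow (\<nu>2 - 1) s = 1" by (simp add: \<nu>2 xpow_def)
    with ratio_E(1,2)[of s \<nu>1 \<nu>2] show "monC \<nu>1 \<nu>2 s = exp s / 16" "monB \<nu>1 \<nu>2 s = exp s / 16"
      unfolding A by simp_all
  qed
  note C = CB(1) and B = CB(2)
  have dom: "domD r \<nu>1 \<nu>2 = {s. norm (exp s) < r}"
  proof -
    have "norm (exp s) / 16 < r" if "norm (exp s) < r" for s :: complex
      using that norm_ge_zero[of "exp s"] by linarith
    thus ?thesis unfolding domD_def B C by (auto simp: norm_divide)
  qed
  have hol: "y holomorphic_on {s. norm (exp s) < r}"
    using holomorphic_ellip_y[OF v] unfolding dom y_def .
  have vcong: "v s = v s'" if "norm (exp s) < r" and eq: "exp s = exp s'" for s s'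
  proof -
    have d: "s \<in> domD r \<nu>1 \<nu>2" "s' \<in> domD r \<nu>1 \<nu>2" using that unfolding dom mem_Collect_eq by (simp_all only: simp_thms)
    obtain A B C where 1: "((\<lambda>n. a n * exp s ^ n) has_sum A) {1..}"
        "((\<lambda>(n, m). b n m * exp s ^ n * monB \<nu>1 \<nu>2 s ^ m) has_sum B) (UNIV \<times> {1..})"
        "((\<lambda>(n, m). c n m * exp s ^ n * monC \<nu>1 \<nu>2 s ^ m) has_sum C) (UNIV \<times> {1..})"
        "v s = A + B + C"
      using expansion d(1) unfolding has_v_expansion_def by blast
    obtain A' B' C' where 2: "((\<lambda>n. a n * exp s' ^ n) has_sum A') {1..}"
        "((\<lambda>(n, m). b n m * exp s' ^ n * monB \<nu>1 \<nu>2 s' ^ m) has_sum B') (UNIV \<times> {1..})"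
        "((\<lambda>(n, m). c n m * exp s' ^ n * monC \<nu>1 \<nu>2 s' ^ m) has_sum C') (UNIV \<times> {1..})"
        "v s' = A' + B' + C'"
      using expansion d(2) unfolding has_v_expansion_def by blast
    have eqs: "monB \<nu>1 \<nu>2 s' = monB \<nu>1 \<nu>2 s" "monC \<nu>1 \<nu>2 s' = monC \<nu>1 \<nu>2 s" unfolding B C by (simp_all add: eq)
    have "A = A'" "B = B'" "C = C'"
      using has_sum_unique 1(1-3) 2(1-3) unfolding eqs eq [symmetric] by blast+
    thus ?thesis using 1(4) 2(4) by simp
  qed
  have cong: "y s = y s'" if n: "norm (exp s) < r" and eq: "exp s = exp s'" for s s'
  proof -
    have d: "s \<in> domD r \<nu>1 \<nu>2" "s' \<in> domD r \<nu>1 \<nu>2"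
      using that unfolding dom mem_Collect_eq by (simp_all only: simp_thms)
    have w: "nome_w \<nu>1 \<nu>2 (v s') s' = nome_w \<nu>1 \<nu>2 (v s) s" "nome_W \<nu>1 \<nu>2 (v s') s' = nome_W \<nu>1 \<nu>2 (v s) s"
      unfolding nome_w_def nome_W_def B C eq [symmetric] vcong[OF n eq] by (rule refl)+
    have "y s = (1 / hypF (exp s))\<^sup>2 *
       (- 1/3 + csc2_exp (nome_w \<nu>1 \<nu>2 (v s) s) + csc2_exp (nome_W \<nu>1 \<nu>2 (v s) s)
       + suminf (nome_tail (nome_w \<nu>1 \<nu>2 (v s) s) (nome_W \<nu>1 \<nu>2 (v s) s)
           (nome_w \<nu>1 \<nu>2 (v s) s * nome_W \<nu>1 \<nu>2 (v s) s))) + (1 + exp s) / 3" if "s \<in> domD r \<nu>1 \<nu>2" for s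
      unfolding y_def by (rule ellip_y_nome_series[of s \<nu>1 \<nu>2 v]) (use domD_estimates[OF that] in auto)
    from this[OF d(1)] this[OF d(2)] show ?thesis unfolding w eq [symmetric] by simp
  qed
  define Y where "Y = (\<lambda>x. if x = 0 then 0 else y (Ln x))"
  \<comment> \<open>The 4 is the square of the 2 in N <= 2 |x|; as \<open>lead1\<close> vanishes,
    its error estimate turns into |Y| <= k |x|^2.\<close>
  define k where "k = (2 * est_const + 512 + 8 * K2) * 4"
  have kpos: "k > 0" using est_const_nonneg K2 by (simp add: k_def)
  have yY: "y s = Y (exp s)" if "norm (exp s) < r" for s
    unfolding Y_def using cong[OF that, of "Ln (exp s)"] by simp
  have Ybound: "norm (Y x) \<le> k * (norm x)\<^sup>2" if x: "norm x < r" for x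
  proof (cases "x = 0")
    case False
    define s where "s = Ln x"
    have xs: "exp s = x" using False by (simp add: s_def)
    have "s \<in> domD r \<nu>1 \<nu>2" unfolding dom mem_Collect_eq xs by (rule x)
    from domD_estimates(7)[OF this] have "norm (y s - lead1 \<nu>1 \<nu>2 s) \<le> (2 * est_const + 512 + 8 * K2) * (size_N \<nu>1 \<nu>2 s)\<^sup>2"
      by (simp add: y_def)
    moreover have "lead1 \<nu>1 \<nu>2 s = 0" unfolding lead1_eq B C by simp
    moreover have "(2 * est_const + 512 + 8 * K2) * (size_N \<nu>1 \<nu>2 s)\<^sup>2 \<le> (2 * est_const + 512 + 8 * K2) * (2 * norm x)\<^sup>2"
    proof (intro mult_left_mono power_mono)
      show "size_N \<nu>1 \<nu>2 s \<le> 2 * norm x" unfolding size_N_def B C xs by (simp add: norm_divide)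
    qed (use est_const_nonneg K2 size_N_bounds(4) in auto)
    moreover have "(2 * est_const + 512 + 8 * K2) * (2 * norm x)\<^sup>2 = k * (norm x)\<^sup>2"
      unfolding k_def power_mult_distrib by simp
    moreover have "Y x = y s" using False by (simp add: Y_def s_def)
    ultimately show ?thesis by (metis diff_zero order_trans)
  qed (simp add: Y_def)
  have "Y holomorphic_on ball 0 r"
    unfolding Y_def
  proof (rule removable_singularity)
    show "(\<lambda>x. y (Ln x)) holomorphic_on ball 0 r - {0}"
      by (rule holomorphic_on_punctured_ball_of_exp[OF hol cong])
    have "((\<lambda>x::complex. k * (norm x)\<^sup>2) \<longlongrightarrow> k * (norm (0::complex))\<^sup>2) (at 0)" by (intro tendsto_intros)
    hence l: "((\<lambda>x::complex. k * (norm x)\<^sup>2) \<longlongrightarrow> 0) (at 0)" by simp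
    have "\<forall>\<^sub>F x in at (0::complex). x \<in> ball 0 r - {0}"
      by (rule eventually_at_in_open) (use r in auto)
    hence "\<forall>\<^sub>F x in at (0::complex). norm (y (Ln x)) \<le> k * (norm x)\<^sup>2"
    proof eventually_elim
      case (elim x)
      thus ?case using Ybound[of x] by (simp add: Y_def)
    qed
    thus "(\<lambda>x. y (Ln x)) \<midarrow>0\<rightarrow> 0" by (rule Lim_null_comparison[OF _ l])
  qed auto
  note Yhol = this
  have "Y constant_on ball 0 r"
  proof (rule ccontr)
    assume nc: "\<not> Y constant_on ball 0 r"
    have zero: "0 \<in> ball (0::complex) r" "Y 0 = 0" using r by (simp_all add: Y_def)
    show False
    proof (rule holomorphic_factor_zero_nonconstant[OF Yhol open_ball connected_ball zero nc])
      fix g :: "complex \<Rightarrow> complex" and \<rho> :: real and n :: nat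
      assume n: "0 < n" and \<rho>: "0 < \<rho>" "ball (0::complex) \<rho> \<subseteq> ball 0 r" and g: "g holomorphic_on ball 0 \<rho>"
        and Yg: "\<And>x. x \<in> ball 0 \<rho> \<Longrightarrow> Y x = (x - 0) ^ n * g x" and gnz: "\<And>x. x \<in> ball 0 \<rho> \<Longrightarrow> g x \<noteq> 0"
      have \<rho>r: "norm x < r" if "norm x < \<rho>" for x :: complex using \<rho>(2) that by auto
      have ev: "\<forall>\<^sub>F x in at (0::complex). x \<in> ball 0 \<rho> - {0}"
        by (rule eventually_at_in_open) (use \<rho> in auto)
      have g0: "g 0 \<noteq> 0" using gnz \<rho> by simp
      have "isCont g 0" using holomorphic_on_imp_continuous_on[OF g] \<rho> by (simp add: continuous_on_eq_continuous_at)
      hence gl: "(g \<longlongrightarrow> g 0) (at 0)" by (simp add: isCont_def)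
      \<comment> \<open>A simple zero would contradict |Y| <= k |x|^2, so the order has the form m +
        2.\<close>
      have "n \<noteq> 1"
      proof
        assume n1: "n = 1"
        have "((\<lambda>x::complex. k * norm x) \<longlongrightarrow> k * norm (0::complex)) (at 0)" by (intro tendsto_intros)
        hence l: "((\<lambda>x::complex. k * norm x) \<longlongrightarrow> 0) (at 0)" by simp
        have "\<forall>\<^sub>F x in at 0. norm (g x) \<le> k * norm x"
          using ev
        proof eventually_elim
          case (elim x)
          hence "norm x * norm (g x) \<le> norm x * (k * norm x)"
            using Ybound[of x] Yg[of x] \<rho>r[of x] n1 by (simp add: norm_mult power2_eq_square mult_ac)
          thus ?case using elim by (subst (asm) mult_le_cancel_left_pos) auto
        qed
        hence "(g \<longlongrightarrow> 0) (at 0)" by (rule Lim_null_comparison[OF _ l])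
        hence "g 0 = 0" using gl by (intro tendsto_unique[of "at (0::complex)"]) auto
        thus False using g0 by simp
      qed
      then obtain m where m: "n = m + 2" using n by (metis One_nat_def Suc_1 add.commute add_2_eq_Suc' less_imp_Suc_add not0_implies_Suc plus_1_eq_Suc)
      have dY: "(Y has_field_derivative deriv Y x) (at x)" if "norm x < r" for x
        by (rule holomorphic_derivI[OF Yhol]) (use that in auto)
      have dY2: "(deriv Y has_field_derivative deriv (deriv Y) x) (at x)" if "norm x < r" for x
        by (rule holomorphic_derivI[OF holomorphic_deriv[OF Yhol]]) (use that in auto)
      have op: "open {s::complex. norm (exp s) < r}"
        by (intro open_Collect_less continuous_intros)
      \<comment> \<open>The factor exp s of the chain rule is what \<open>ddx\<close> divides by, so
        on the covering it acts as d/dx on Y.\<close>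
      have d1: "ddx y s = deriv Y (exp s)" if s: "norm (exp s) < r" for s
      proof -
        have "(y has_field_derivative deriv Y (exp s) * exp s) (at s)"
        proof (rule has_field_derivative_transform_within_open)
          show "((\<lambda>s. Y (exp s)) has_field_derivative deriv Y (exp s) * exp s) (at s)"
            by (rule DERIV_chain2[OF dY[OF s] DERIV_exp])
        qed (use op s yY in auto)
        thus ?thesis by (simp add: ddx_def DERIV_imp_deriv)
      qed
      have d2: "ddx (ddx y) s = deriv (deriv Y) (exp s)" if s: "norm (exp s) < r" for s
      proof -
        have "(ddx y has_field_derivative deriv (deriv Y) (exp s) * exp s) (at s)"
        proof (rule has_field_derivative_transform_within_open)
          show "((\<lambda>s. deriv Y (exp s)) has_field_derivative deriv (deriv Y) (exp s) * exp s) (at s)"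
            by (rule DERIV_chain2[OF dY2[OF s] DERIV_exp])
        qed (use op s d1 in auto)
        thus ?thesis by (simp add: ddx_def[of "ddx y"] DERIV_imp_deriv)
      qed
      show False
      proof (rule PVI_no_high_order_zero[OF \<rho>(1) g g0, where Y = Y and m = m and \<kappa> = "(2 * \<mu> - 1)\<^sup>2"])
        show "Y x = x ^ (m + 2) * g x" if "x \<in> ball 0 \<rho>" for x using Yg[OF that] by (simp add: m)
        show "\<forall>\<^sub>F x in at 0. Y x \<noteq> 0 \<and> Y x \<noteq> 1 \<and> Y x \<noteq> x \<longrightarrow>
          deriv (deriv Y) x = 1/2 * (1/Y x + 1/(Y x - 1) + 1/(Y x - x)) * (deriv Y x)\<^sup>2
              - (1/x + 1/(x - 1) + 1/(Y x - x)) * deriv Y x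
              + 1/2 * (Y x * (Y x - 1) * (Y x - x)) / (x\<^sup>2 * (x - 1)\<^sup>2)
                * ((2 * \<mu> - 1)\<^sup>2 + x * (x - 1) / (Y x - x)\<^sup>2)"
          using ev
        proof eventually_elim
          case (elim x)
          define s where "s = Ln x"
          have xs: "exp s = x" using elim by (simp add: s_def)
          have xr: "norm x < r" using elim \<rho>r[of x] by simp
          have sn: "norm (exp s) < r" unfolding xs by (rule xr)
          have "y analytic_on {s}"
            using hol op sn by (subst analytic_at) blast
          moreover have "s \<in> domD r \<nu>1 \<nu>2" using sn by (simp add: dom)
          moreover have "y s = Y x" using yY[OF sn] xs by simp
          moreover have "ddx y s = deriv Y x" "ddx (ddx y) s = deriv (deriv Y) x"
            using d1[OF sn] d2[OF sn] xs by simp_all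
          ultimately show ?case
            using PVI xs unfolding solves_PVI_def Let_def y_def [symmetric] by fastforce
        qed
      qed
    qed
  qed
  then obtain q where q: "\<And>x. x \<in> ball 0 r \<Longrightarrow> Y x = q" unfolding constant_on_def by blast
  have "q = 0" using q[of 0] r by (simp add: Y_def)
  have sr: "norm (exp s) < r" using s unfolding dom by simp
  have "y s = 0" using yY[OF sr] q[of "exp s"] sr \<open>q = 0\<close> by simp
  thus ?thesis by (simp add: y_def)
qed

section \<open>The critical behaviour\<close>

context elliptic_solution
begin

text \<open>The power laws of B and C hold exactly along the spiral, with constants fixed by
  \<open>s0\<close>. They give |E| = 16 c1 |x|^(V - 1), so the critical case V = 1, 16 c1 = 1 is
  precisely \<open>cancelling\<close>.\<close>

lemma asymptotics_spiral:
  assumes \<nu>: "Im \<nu>2 \<noteq> 0" and V: "0 < V" "V < 2" and s0: "s0 \<in> domD r \<nu>1 \<nu>2"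
  shows "\<exists>\<delta>. 0 < \<delta> \<and> \<delta> < 1 \<and>
    (if cancelling \<nu>1 \<nu>2 V s0
     then asymp_along3 (spiral \<nu>2 V s0) \<delta> (ellip_y \<nu>1 \<nu>2 v) term1 (term2 \<nu>1 \<nu>2) (term3 \<nu>1 \<nu>2)
     else asymp_along (spiral \<nu>2 V s0) \<delta> (ellip_y \<nu>1 \<nu>2 v) (lead1 \<nu>1 \<nu>2))"
proof -
  define X0 where "X0 = norm (exp s0)"
  define \<sigma> where "\<sigma> = spiral \<nu>2 V s0"
  define c1 where "c1 = norm (monC \<nu>1 \<nu>2 s0) / X0 powr V"
  define c2 where "c2 = norm (monB \<nu>1 \<nu>2 s0) / X0 powr (2 - V)"
  define \<delta> where "\<delta> = min V (min (2 - V) 1) / 2"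
  have X0: "X0 > 0" by (simp add: X0_def)
  have c: "c1 > 0" "c2 > 0" using X0 by (simp_all add: c1_def c2_def)
  have x: "norm (exp (\<sigma> t)) = t" if "t > 0" for t
    unfolding \<sigma>_def by (rule spiral_norms(1)[OF \<nu> that])
  have C: "norm (monC \<nu>1 \<nu>2 (\<sigma> t)) = c1 * norm (exp (\<sigma> t)) powr V"
    and B: "norm (monB \<nu>1 \<nu>2 (\<sigma> t)) = c2 * norm (exp (\<sigma> t)) powr (2 - V)" if "t > 0" for t
    using that X0 unfolding x[OF that] unfolding \<sigma>_def spiral_norms(2,3)[OF \<nu> that]
    unfolding X0_def [symmetric] by (simp_all add: c1_def c2_def powr_divide)
  have pos: "\<forall>\<^sub>F t in at_right (0::real). t > 0" by (simp add: eventually_at_right_less)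
  have lim: "((\<lambda>t. norm (exp (\<sigma> t))) \<longlongrightarrow> 0) (at_right 0)"
  proof (rule Lim_transform_eventually)
    show "((\<lambda>t::real. t) \<longlongrightarrow> 0) (at_right 0)" by (rule tendsto_ident_at)
    show "\<forall>\<^sub>F t in at_right 0. t = norm (exp (\<sigma> t))" using pos by eventually_elim (use x in simp)
  qed
  have near: "\<forall>\<^sub>F t in at_right 0. norm (ellip_y \<nu>1 \<nu>2 v (\<sigma> t) - lead1 \<nu>1 \<nu>2 (\<sigma> t))
      \<le> (2 * est_const + 512 + 8 * K2) * (size_N \<nu>1 \<nu>2 (\<sigma> t))\<^sup>2"
  proof (rule eventually_spiral[of s0])
    fix t assume t: "0 < t" "t \<le> norm (exp s0)"
    have "\<sigma> t \<in> domD r \<nu>1 \<nu>2"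
      unfolding \<sigma>_def by (rule spiral_in_domD[OF \<nu> t _ _ s0]) (use V in auto)
    thus "norm (ellip_y \<nu>1 \<nu>2 v (\<sigma> t) - lead1 \<nu>1 \<nu>2 (\<sigma> t))
      \<le> (2 * est_const + 512 + 8 * K2) * (size_N \<nu>1 \<nu>2 (\<sigma> t))\<^sup>2" by (rule domD_estimates(7))
  qed
  have k: "0 \<le> 2 * est_const + 512 + 8 * K2" using est_const_nonneg K2 by simp
  note pl = power_law_asymptotics[OF V lim near k eventually_mono[OF pos C] eventually_mono[OF pos B] c, folded \<delta>_def]
  have "asymp_along \<sigma> \<delta> (ellip_y \<nu>1 \<nu>2 v) (lead1 \<nu>1 \<nu>2)" if nc: "\<not> cancelling \<nu>1 \<nu>2 V s0"
  proof -
    have "\<exists>\<eta>>0. \<forall>\<^sub>F t in at_right 0. \<eta> * (1 + norm (coefA \<nu>1 \<nu>2 * xpow (\<nu>2 - 1) (\<sigma> t)))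
       \<le> norm (coefA \<nu>1 \<nu>2 * xpow (\<nu>2 - 1) (\<sigma> t) - 1)"
    proof (rule power_law_away_from_1[OF lim])
      show "\<forall>\<^sub>F t in at_right 0. norm (coefA \<nu>1 \<nu>2 * xpow (\<nu>2 - 1) (\<sigma> t)) = 16 * c1 * norm (exp (\<sigma> t)) powr (V - 1)"
        using pos
      proof eventually_elim
        case (elim t)
        have "t * norm (coefA \<nu>1 \<nu>2 * xpow (\<nu>2 - 1) (\<sigma> t)) = 16 * c1 * t powr V"
          using arg_cong[OF ratio_E(1)[of "\<sigma> t" \<nu>1 \<nu>2], of norm] C[OF elim] x[OF elim]
          by (simp only: norm_mult norm_numeral)
        thus ?case unfolding x[OF elim] using elim by (simp add: powr_diff field_simps)
      qed
      show "V - 1 \<noteq> 0 \<or> 16 * c1 \<noteq> 1"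
      proof (rule ccontr)
        assume "\<not> (V - 1 \<noteq> 0 \<or> 16 * c1 \<noteq> 1)"
        hence V1: "V = 1" and c1: "16 * c1 = 1" by auto
        have "X0 * norm (coefA \<nu>1 \<nu>2 * xpow (\<nu>2 - 1) s0) = 16 * norm (monC \<nu>1 \<nu>2 s0)"
          using arg_cong[OF ratio_E(1)[of s0 \<nu>1 \<nu>2], of norm] by (simp only: norm_mult norm_numeral X0_def)
        also have "\<dots> = 16 * c1 * X0" using X0 by (simp add: c1_def V1)
        finally have "norm (coefA \<nu>1 \<nu>2 * xpow (\<nu>2 - 1) s0) = 1" using c1 X0 by simp
        thus False using nc V1 by (simp add: cancelling_def)
      qed
    qed (use c in auto)
    thus ?thesis using pl(2) by blast
  qed
  moreover have "asymp_along3 \<sigma> \<delta> (ellip_y \<nu>1 \<nu>2 v) term1 (term2 \<nu>1 \<nu>2) (term3 \<nu>1 \<nu>2)"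
    by (rule pl(1))
  moreover have "0 < \<delta>" "\<delta> < 1" using V by (auto simp: \<delta>_def)
  ultimately show ?thesis unfolding \<sigma>_def by (intro exI[of _ \<delta>]) auto
qed

text \<open>For real \<open>\<nu>2\<close> the moduli of B and C are constants times powers of |x|,
  whatever arg x does. |E| is proportional to |x|^(n - 1); if n = 1, E is the constant
  \<open>coefA \<nu>1 \<nu>2\<close>, and its value 1 is the degenerate case.\<close>

lemma asymptotics_regular_path:
  assumes \<nu>: "\<nu>2 = of_real n" "0 < n" "n < 2" and path: "regular_path_in (domD r \<nu>1 \<nu>2) \<sigma>"
    and hol: "v holomorphic_on domD r \<nu>1 \<nu>2"
    and expansion: "has_v_expansion a b c \<nu>1 \<nu>2 (domD r \<nu>1 \<nu>2) v"
    and PVI: "solves_PVI \<mu> (domD r \<nu>1 \<nu>2) (ellip_y \<nu>1 \<nu>2 v)"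
  shows "\<exists>\<delta>. 0 < \<delta> \<and> \<delta> < 1 \<and> asymp_along \<sigma> \<delta> (ellip_y \<nu>1 \<nu>2 v) (lead1 \<nu>1 \<nu>2)"
proof -
  define c1 where "c1 = exp (Re (\<i> * of_real pi * \<nu>1) - n * ln 16)"
  define c2 where "c2 = exp (Re (- \<i> * of_real pi * \<nu>1) - (2 - n) * ln 16)"
  define \<delta> where "\<delta> = min n (min (2 - n) 1) / 2"
  have \<delta>: "0 < \<delta>" "\<delta> < 1" using \<nu> by (auto simp: \<delta>_def)
  have c: "c1 > 0" "c2 > 0" by (simp_all add: c1_def c2_def)
  have C: "norm (monC \<nu>1 \<nu>2 s) = c1 * norm (exp s) powr n" for s
    unfolding monC_exp \<nu>(1) c1_def by (simp add: powr_def algebra_simps flip: exp_add)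
  have B: "norm (monB \<nu>1 \<nu>2 s) = c2 * norm (exp s) powr (2 - n)" for s
    unfolding monB_exp \<nu>(1) c2_def by (simp add: powr_def algebra_simps flip: exp_add)
  from path obtain \<gamma> \<gamma>' where \<gamma>: "\<gamma> 0 = 0" "\<forall>t\<in>{0<..1}. \<gamma> t = exp (\<sigma> t)"
    "\<forall>t\<in>{0..1}. (\<gamma> has_vector_derivative \<gamma>' t) (at t within {0..1}) \<and> \<gamma>' t \<noteq> 0"
    and dom: "\<sigma> ` {0<..1} \<subseteq> domD r \<nu>1 \<nu>2"
    unfolding regular_path_in_def by blast
  have ev: "\<forall>\<^sub>F t in at_right (0::real). t \<in> {0<..1}"
    unfolding eventually_at_right_field by (rule exI[of _ 1]) auto
  have lim: "((\<lambda>t. norm (exp (\<sigma> t))) \<longlongrightarrow> 0) (at_right 0)"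
  proof -
    have "continuous (at 0 within {0..1}) \<gamma>"
      using \<gamma>(3) by (intro has_vector_derivative_continuous) auto
    hence "(\<gamma> \<longlongrightarrow> 0) (at 0 within {0..1})" by (simp add: continuous_within \<gamma>(1))
    hence "(\<gamma> \<longlongrightarrow> 0) (at_right 0)"
      by (simp add: at_within_Icc_at_right)
    hence n: "((\<lambda>t. norm (\<gamma> t)) \<longlongrightarrow> 0) (at_right 0)" by (rule tendsto_norm_zero)
    show ?thesis
    proof (rule Lim_transform_eventually[OF n])
      show "\<forall>\<^sub>F t in at_right 0. norm (\<gamma> t) = norm (exp (\<sigma> t))"
        using ev by eventually_elim (use \<gamma>(2) in auto)
    qed
  qed
  have near: "\<forall>\<^sub>F t in at_right 0. norm (ellip_y \<nu>1 \<nu>2 v (\<sigma> t) - lead1 \<nu>1 \<nu>2 (\<sigma> t))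
      \<le> (2 * est_const + 512 + 8 * K2) * (size_N \<nu>1 \<nu>2 (\<sigma> t))\<^sup>2"
    using ev by eventually_elim (rule domD_estimates(7), use dom in auto)
  have k: "0 \<le> 2 * est_const + 512 + 8 * K2" using est_const_nonneg K2 by simp
  note pl = power_law_asymptotics(2)[OF \<nu>(2,3) lim near k always_eventually[OF allI[OF C]]
      always_eventually[OF allI[OF B]] c, folded \<delta>_def]
  show ?thesis
  proof (cases "n = 1 \<and> coefA \<nu>1 \<nu>2 = 1")
    case True
    have \<nu>2: "\<nu>2 = 1" using True \<nu> by simp
    have "lead1 \<nu>1 \<nu>2 s = 0" for s
    proof -
      have "xpow (\<nu>2 - 1) s = 1" by (simp add: \<nu>2 xpow_def)
      with ratio_E(1,2)[of s \<nu>1 \<nu>2] show ?thesis using True unfolding lead1_eq by simp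
    qed
    moreover have "\<forall>\<^sub>F t in at_right 0. ellip_y \<nu>1 \<nu>2 v (\<sigma> t) = 0"
      using ev
    proof eventually_elim
      case (elim t)
      thus ?case using dom True
        by (intro ellip_y_eq_0_if_lead1_eq_0[OF \<nu>2 _ hol expansion PVI]) auto
    qed
    ultimately have "asymp_along \<sigma> \<delta> (ellip_y \<nu>1 \<nu>2 v) (lead1 \<nu>1 \<nu>2)"
      by (intro asymp_along_intro[where k = 0]) simp
    thus ?thesis using \<delta> by blast
  next
    case False
    have "\<exists>\<eta>>0. \<forall>\<^sub>F t in at_right 0. \<eta> * (1 + norm (coefA \<nu>1 \<nu>2 * xpow (\<nu>2 - 1) (\<sigma> t)))
       \<le> norm (coefA \<nu>1 \<nu>2 * xpow (\<nu>2 - 1) (\<sigma> t) - 1)"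
    proof (cases "n = 1")
      case True
      \<comment> \<open>E is constant, so \<eta> is the quotient |E - 1| / (1 + |E|), positive
        because E = 1 is excluded in this branch.\<close>
      define \<eta> where "\<eta> = norm (coefA \<nu>1 \<nu>2 - 1) / (1 + norm (coefA \<nu>1 \<nu>2))"
      have p: "0 < 1 + norm (coefA \<nu>1 \<nu>2)" by (rule add_pos_nonneg) auto
      have "0 < \<eta>" unfolding \<eta>_def using p False True by (intro divide_pos_pos) auto
      moreover have "xpow (\<nu>2 - 1) s = 1" for s using True \<nu>(1) by (simp add: xpow_def)
      hence "\<eta> * (1 + norm (coefA \<nu>1 \<nu>2 * xpow (\<nu>2 - 1) s)) \<le> norm (coefA \<nu>1 \<nu>2 * xpow (\<nu>2 - 1) s - 1)" for s
        using p by (simp add: \<eta>_def)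
      ultimately show ?thesis by (intro exI[of _ \<eta>] conjI always_eventually allI)
    next
      case False
      show ?thesis
      proof (rule power_law_away_from_1[OF lim])
        show "\<forall>\<^sub>F t in at_right 0. norm (coefA \<nu>1 \<nu>2 * xpow (\<nu>2 - 1) (\<sigma> t)) = 16 * c1 * norm (exp (\<sigma> t)) powr (n - 1)"
        proof (rule always_eventually, rule allI)
          fix t
          define X where "X = norm (exp (\<sigma> t))"
          have X: "X > 0" by (simp add: X_def)
          have "X * norm (coefA \<nu>1 \<nu>2 * xpow (\<nu>2 - 1) (\<sigma> t)) = 16 * c1 * X powr n"
            using arg_cong[OF ratio_E(1)[of "\<sigma> t" \<nu>1 \<nu>2], of norm] C[of "\<sigma> t"]
            by (simp only: norm_mult norm_numeral X_def)
          thus "norm (coefA \<nu>1 \<nu>2 * xpow (\<nu>2 - 1) (\<sigma> t)) = 16 * c1 * norm (exp (\<sigma> t)) powr (n - 1)"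
            unfolding X_def [symmetric] using X by (simp add: powr_diff field_simps)
        qed
        show "n - 1 \<noteq> 0 \<or> 16 * c1 \<noteq> 1" using False by simp
      qed (use c in auto)
    qed
    thus ?thesis using pl \<delta> by blast
  qed
qed

end

theorem mainTheorem4:
  fixes \<mu> \<nu>1 \<nu>2 :: complex
    and a :: "nat \<Rightarrow> complex \<Rightarrow> complex"
    and b c :: "nat \<Rightarrow> nat \<Rightarrow> complex \<Rightarrow> complex"
    and M :: "complex \<Rightarrow> real"
  assumes "\<nu>2 \<notin> complex_of_real ` ({..0} \<union> {2..})"
    and "\<And>n. rational_coeff (a n)"
    and "\<And>n m. rational_coeff (b n m)"
    and "\<And>n m. rational_coeff (c n m)"
  shows "\<exists>r0. 0 < r0 \<and> r0 \<le> 1 \<and>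
    (\<forall>r v. 0 < r \<and> r < r0 \<and>
       v holomorphic_on domD r \<nu>1 \<nu>2 \<and>
       has_v_expansion (\<lambda>n. a n \<nu>2) (\<lambda>n m. b n m \<nu>2) (\<lambda>n m. c n m \<nu>2) \<nu>1 \<nu>2 (domD r \<nu>1 \<nu>2) v \<and>
       (\<forall>s\<in>domD r \<nu>1 \<nu>2.
          norm (v s) \<le> M \<nu>2 * (norm (exp s) + norm (monB \<nu>1 \<nu>2 s) + norm (monC \<nu>1 \<nu>2 s))) \<and>
       solves_PVI \<mu> (domD r \<nu>1 \<nu>2) (ellip_y \<nu>1 \<nu>2 v)
     \<longrightarrow>
       (Im \<nu>2 \<noteq> 0 \<longrightarrow>
         (\<forall>V s0. 0 < V \<and> V < 2 \<and> s0 \<in> domD r \<nu>1 \<nu>2 \<longrightarrow>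
           (\<exists>\<delta>. 0 < \<delta> \<and> \<delta> < 1 \<and>
             (if cancelling \<nu>1 \<nu>2 V s0
              then asymp_along3 (spiral \<nu>2 V s0) \<delta> (ellip_y \<nu>1 \<nu>2 v)
                     term1 (term2 \<nu>1 \<nu>2) (term3 \<nu>1 \<nu>2)
              else asymp_along (spiral \<nu>2 V s0) \<delta> (ellip_y \<nu>1 \<nu>2 v) (lead1 \<nu>1 \<nu>2))))) \<and>
       (\<nu>2 \<in> complex_of_real ` {0<..<2} \<longrightarrow>
         (\<forall>\<sigma>. regular_path_in (domD r \<nu>1 \<nu>2) \<sigma> \<longrightarrow>
           (\<exists>\<delta>. 0 < \<delta> \<and> \<delta> < 1 \<and> asymp_along \<sigma> \<delta> (ellip_y \<nu>1 \<nu>2 v) (lead1 \<nu>1 \<nu>2)))) \<and>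
       (Im \<nu>2 \<noteq> 0 \<longrightarrow>
         (\<forall>s0 \<in> domD r \<nu>1 \<nu>2.
           asymp_along (spiral \<nu>2 0 s0) 1 (ellip_y \<nu>1 \<nu>2 v) (lead2 (\<lambda>m. c 0 m \<nu>2) \<nu>1 \<nu>2))) \<and>
       (Im \<nu>2 \<noteq> 0 \<longrightarrow>
         (\<forall>s0 \<in> domD r \<nu>1 \<nu>2.
           asymp_along (spiral \<nu>2 2 s0) 1 (ellip_y \<nu>1 \<nu>2 v) (lead3 (\<lambda>m. b 0 m \<nu>2) \<nu>1 \<nu>2))))"
proof -
  obtain R K where "hyp_bounds R K" using hyp_bounds_exist by blast
  then interpret hyp_bounds R K .
  \<comment> \<open>Neither r nor v is fixed at this point, so one radius serves them all.\<close>
  obtain r0 K2 where sr: "small_regime R K \<nu>1 \<nu>2 (M \<nu>2) r0 K2" using small_regime_exists by blast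
  note r0 = small_regime.r0[OF sr]
  have sol: "elliptic_solution R K \<nu>1 \<nu>2 (M \<nu>2) r0 K2 r v"
    if "0 < r" "r < r0" "\<forall>s\<in>domD r \<nu>1 \<nu>2.
          norm (v s) \<le> M \<nu>2 * (norm (exp s) + norm (monB \<nu>1 \<nu>2 s) + norm (monC \<nu>1 \<nu>2 s))" for r v
    by (intro elliptic_solution.intro sr elliptic_solution_axioms.intro) (use that in \<open>auto simp: size_N_def\<close>)
  show ?thesis
  proof (rule exI[of _ r0], intro conjI allI impI ballI, goal_cases)
    case 1
    show ?case by (rule r0)
  next
    case 2
    show ?case using r0 by simp
  next
    case (3 r v V s0)
    show ?case by (rule elliptic_solution.asymptotics_spiral[OF sol[of r v]]) (use 3 in blast)+
  next
    case (4 r v \<sigma>)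
    obtain n where n: "\<nu>2 = of_real n" "0 < n" "n < 2" using 4 by auto
    show ?case by (rule elliptic_solution.asymptotics_regular_path[OF sol[of r v] n]) (use 4 in blast)+
  next
    case (5 r v s0)
    show ?case by (rule elliptic_solution.asymptotics_V0[OF sol[of r v]]) (use 5 in blast)+
  next
    case (6 r v s0)
    show ?case by (rule elliptic_solution.asymptotics_V2[OF sol[of r v]]) (use 6 in blast)+
  qed
qed

end
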